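(* Let $\mathbb{K}$ be a field and let $\Delta$ be a simplicial complex on the vertex set $X=\{x_1,\dots,x_n\}$. Then $\Delta$ is sequentially Cohen--Macaulay (over $\mathbb{K}$) if and only if the pure skeleton $\Delta^{[i]}$ is Cohen--Macaulay (over $\mathbb{K}$) for all $\mathrm{indim}\,\Delta\le i\le\dim\Delta$.
   Context: Let $R=\mathbb{K}[x_1,\dots,x_n]$. The Stanley--Reisner ideal $I_\Delta\subset R$ is generated by the monomials $\prod_{x_i\in F}x_i$ for $F$ a minimal non-face of $\Delta$, and $\mathbb{K}[\Delta]=R/I_\Delta$. The dimension of a face is $\dim F=|F|-1$ and $\dim\Delta$ is the maximum dimension of a face. The initial dimension of a module $N$ is $\mathrm{indim}\,N=\inf\{\dim R/P\mid P\in\mathrm{Ass}_R N\}$, and $\mathrm{indim}\,\Delta=\mathrm{indim}\,\mathbb{K}[\Delta]-1$, i.e. the minimum dimension of a facet of $\Delta$. The pure $i$-skeleton $\Delta^{[i]}$ is the subcomplex of $\Delta$ generated by all $i$-dimensional faces of $\Delta$. A complex is Cohen--Macaulay (resp. sequentially Cohen--Macaulay) over $\mathbb{K}$ if its Stanley--Reisner ring is. A finitely generated graded module $N$ is sequentially Cohen--Macaulay if, writing $N_i$ for the largest submodule of $N$ with $\dim N_i\le i$, every quotient $N_i/N_{i-1}$ with $\mathrm{indim}\,N\le i\le \dim N$ is Cohen--Macaulay (the zero module being regarded as Cohen--Macaulay). *)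

theory Defs
  imports "HOL-Algebra.Algebra" "HOL-Library.Poly_Mapping" "HOL-Library.Extended_Real"
begin

section \<open>Quotient modules, Krull dimension, associated primes\<close>

text \<open>
  The module records of HOL-Algebra extend the ring records, so a module also has fields
  \<open>mult\<close> and \<open>one\<close>.  They are irrelevant for the module structure and none of
  the notions below looks at them.
\<close>

definition self_module :: "('a, 'm) ring_scheme \<Rightarrow> ('a, 'a) module" where
  "self_module R = \<lparr>carrier = carrier R, monoid.mult = monoid.mult R, one = one R, ring.zero = ring.zero R,
     add = add R, smult = monoid.mult R\<rparr>"

definition quotient_module :: "('a, 'b, 'm) module_scheme \<Rightarrow> 'b set \<Rightarrow> ('a, 'b set) module" where
  "quotient_module N U = \<lparr>carrier = a_rcosets\<^bsub>N\<^esub> U, monoid.mult = rcoset_mult N U,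
     one = U +>\<^bsub>N\<^esub> \<one>\<^bsub>N\<^esub>, ring.zero = U, add = set_add N,
     smult = (\<lambda>r C. \<Union>c\<in>C. U +>\<^bsub>N\<^esub> (r \<odot>\<^bsub>N\<^esub> c))\<rparr>"

definition gen_submodule ::
    "('a, 'r) ring_scheme \<Rightarrow> ('a, 'b, 'm) module_scheme \<Rightarrow> 'b set \<Rightarrow> 'b set" where
  "gen_submodule R N S = \<Inter>{U. submodule U R N \<and> S \<subseteq> U}"

definition annihilator ::
    "('a, 'r) ring_scheme \<Rightarrow> ('a, 'b, 'm) module_scheme \<Rightarrow> 'b set \<Rightarrow> 'a set" where
  "annihilator R N S = {r \<in> carrier R. \<forall>x\<in>S. r \<odot>\<^bsub>N\<^esub> x = \<zero>\<^bsub>N\<^esub>}"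

text \<open>
  Dimensions are extended reals; since \<open>Sup {} = -\<infinity>\<close>, the zero ring and the zero module
  have dimension \<open>-\<infinity>\<close>.
\<close>

definition krull_dim :: "('a, 'm) ring_scheme \<Rightarrow> ereal" where
  "krull_dim S = Sup {ereal (real n) | n. \<exists>P :: nat \<Rightarrow> 'a set.
     (\<forall>i\<le>n. primeideal (P i) S) \<and> (\<forall>i<n. P i \<subset> P (Suc i))}"

definition module_dim ::
    "('a, 'r) ring_scheme \<Rightarrow> ('a, 'b, 'm) module_scheme \<Rightarrow> ereal" where
  "module_dim R N = krull_dim (R Quot annihilator R N (carrier N))"

definition associated_primes ::
    "('a, 'r) ring_scheme \<Rightarrow> ('a, 'b, 'm) module_scheme \<Rightarrow> 'a set set" where
  "associated_primes R N = {P. primeideal P R \<and> (\<exists>x\<in>carrier N. P = annihilator R N {x})}"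

definition module_indim ::
    "('a, 'r) ring_scheme \<Rightarrow> ('a, 'b, 'm) module_scheme \<Rightarrow> ereal" where
  "module_indim R N = Inf {krull_dim (R Quot P) | P. P \<in> associated_primes R N}"


section \<open>Cohen--Macaulay and sequentially Cohen--Macaulay modules\<close>

definition nonzerodivisor_on ::
    "('a, 'b, 'm) module_scheme \<Rightarrow> 'a \<Rightarrow> bool" where
  "nonzerodivisor_on N f \<longleftrightarrow> (\<forall>x\<in>carrier N. f \<odot>\<^bsub>N\<^esub> x = \<zero>\<^bsub>N\<^esub> \<longrightarrow> x = \<zero>\<^bsub>N\<^esub>)"

definition mult_submodule ::
    "('a, 'r) ring_scheme \<Rightarrow> ('a, 'b, 'm) module_scheme \<Rightarrow> 'a list \<Rightarrow> 'b set" where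
  \<comment> \<open>the submodule \<open>(f\<^sub>1, \<dots>, f\<^sub>k) N\<close>\<close>
  "mult_submodule R N fs = gen_submodule R N {f \<odot>\<^bsub>N\<^esub> x | f x. f \<in> set fs \<and> x \<in> carrier N}"

definition regular_sequence ::
    "('a, 'r) ring_scheme \<Rightarrow> ('a, 'b, 'm) module_scheme \<Rightarrow> 'a list \<Rightarrow> bool" where
  "regular_sequence R N fs \<longleftrightarrow> set fs \<subseteq> carrier R \<and>
     (\<forall>i<length fs. nonzerodivisor_on (quotient_module N (mult_submodule R N (take i fs))) (fs ! i)) \<and>
     mult_submodule R N fs \<noteq> carrier N"

text \<open>
  In what follows \<open>\<mm>\<close> is the homogeneous maximal ideal of the standard graded polynomial
  ring \<open>R\<close>, and depth is measured by regular sequences in \<open>\<mm>\<close>.  The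
  definitions are meant for finitely generated graded modules, such as Stanley--Reisner rings and
  the quotients in their dimension filtrations.
\<close>

definition module_depth ::
    "('a, 'r) ring_scheme \<Rightarrow> 'a set \<Rightarrow> ('a, 'b, 'm) module_scheme \<Rightarrow> ereal" where
  "module_depth R \<mm> N =
     Sup {ereal (real (length fs)) | fs. set fs \<subseteq> \<mm> \<and> regular_sequence R N fs}"

definition cohen_macaulay ::
    "('a, 'r) ring_scheme \<Rightarrow> 'a set \<Rightarrow> ('a, 'b, 'm) module_scheme \<Rightarrow> bool" where
  "cohen_macaulay R \<mm> N \<longleftrightarrow>
     carrier N = {\<zero>\<^bsub>N\<^esub>} \<or> module_depth R \<mm> N = module_dim R N"

definition dim_filtration ::
    "('a, 'r) ring_scheme \<Rightarrow> ('a, 'b, 'm) module_scheme \<Rightarrow> int \<Rightarrow> 'b set" where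
  \<comment> \<open>largest with respect to inclusion; it exists whenever \<open>N\<close> is Noetherian\<close>
  "dim_filtration R N i =
     (GREATEST U. submodule U R N \<and> module_dim R (N\<lparr>carrier := U\<rparr>) \<le> ereal (of_int i))"

definition sequentially_cohen_macaulay ::
    "('a, 'r) ring_scheme \<Rightarrow> 'a set \<Rightarrow> ('a, 'b, 'm) module_scheme \<Rightarrow> bool" where
  "sequentially_cohen_macaulay R \<mm> N \<longleftrightarrow>
     (\<forall>i::int. module_indim R N \<le> ereal (of_int i) \<and> ereal (of_int i) \<le> module_dim R N \<longrightarrow>
        cohen_macaulay R \<mm>
          (quotient_module (N\<lparr>carrier := dim_filtration R N i\<rparr>) (dim_filtration R N (i - 1))))"


section \<open>Simplicial complexes and Stanley--Reisner rings\<close>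

text \<open>
  The polynomial ring over the field \<open>'k\<close> in the variables \<open>x \<in> V\<close>: a monomial is an
  exponent vector \<open>'v \<Rightarrow>\<^sub>0 nat\<close>, a polynomial a finitely supported function from monomials to
  coefficients, and the carrier consists of the polynomials in which only variables from
  \<open>V\<close> occur.
\<close>

definition polynomial_ring :: "'v set \<Rightarrow> (('v \<Rightarrow>\<^sub>0 nat) \<Rightarrow>\<^sub>0 'k::field) ring" where
  "polynomial_ring V =
     \<lparr>carrier = {p. \<forall>m\<in>Poly_Mapping.keys p. Poly_Mapping.keys m \<subseteq> V},
      monoid.mult = (*), one = 1, ring.zero = 0, add = (+)\<rparr>"

definition pvar :: "'v \<Rightarrow> (('v \<Rightarrow>\<^sub>0 nat) \<Rightarrow>\<^sub>0 'k::field)" where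
  "pvar x = Poly_Mapping.single (Poly_Mapping.single x 1) 1"

definition irrelevant_ideal :: "'v set \<Rightarrow> (('v \<Rightarrow>\<^sub>0 nat) \<Rightarrow>\<^sub>0 'k::field) set" where
  "irrelevant_ideal V = Idl\<^bsub>polynomial_ring V\<^esub> (pvar ` V)"

text \<open>
  As usual, the empty set is a face, and not every vertex is required to be a
  face (a pure skeleton on the same vertex set may miss some vertices).
\<close>

definition simplicial_complex :: "'v set \<Rightarrow> 'v set set \<Rightarrow> bool" where
  "simplicial_complex V \<Delta> \<longleftrightarrow>
     finite V \<and> \<Delta> \<subseteq> Pow V \<and> {} \<in> \<Delta> \<and> (\<forall>F\<in>\<Delta>. \<forall>G. G \<subseteq> F \<longrightarrow> G \<in> \<Delta>)"

definition face_dim :: "'v set \<Rightarrow> int" where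
  "face_dim F = int (card F) - 1"

definition complex_dim :: "'v set set \<Rightarrow> int" where
  "complex_dim \<Delta> = Max (face_dim ` \<Delta>)"

definition pure_skeleton :: "int \<Rightarrow> 'v set set \<Rightarrow> 'v set set" where
  "pure_skeleton i \<Delta> = {G. \<exists>F\<in>\<Delta>. face_dim F = i \<and> G \<subseteq> F}"

definition minimal_nonfaces :: "'v set \<Rightarrow> 'v set set \<Rightarrow> 'v set set" where
  "minimal_nonfaces V \<Delta> = {F. F \<subseteq> V \<and> F \<notin> \<Delta> \<and> (\<forall>G. G \<subset> F \<longrightarrow> G \<in> \<Delta>)}"

definition stanley_reisner_ideal ::
    "'v set \<Rightarrow> 'v set set \<Rightarrow> (('v \<Rightarrow>\<^sub>0 nat) \<Rightarrow>\<^sub>0 'k::field) set" where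
  "stanley_reisner_ideal V \<Delta> =
     Idl\<^bsub>polynomial_ring V\<^esub> ((\<lambda>F. \<Prod>x\<in>F. pvar x) ` minimal_nonfaces V \<Delta>)"

text \<open>The Stanley--Reisner ring, as a module over the polynomial ring.\<close>

definition stanley_reisner_ring ::
    "'v set \<Rightarrow> 'v set set \<Rightarrow>
      (('v \<Rightarrow>\<^sub>0 nat) \<Rightarrow>\<^sub>0 'k::field, (('v \<Rightarrow>\<^sub>0 nat) \<Rightarrow>\<^sub>0 'k) set) module" where
  "stanley_reisner_ring V \<Delta> =
     quotient_module (self_module (polynomial_ring V)) (stanley_reisner_ideal V \<Delta>)"

definition complex_indim :: "'k::field itself \<Rightarrow> 'v set \<Rightarrow> 'v set set \<Rightarrow> ereal" where
  "complex_indim _ V \<Delta> =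
     module_indim (polynomial_ring V :: (('v \<Rightarrow>\<^sub>0 nat) \<Rightarrow>\<^sub>0 'k) ring) (stanley_reisner_ring V \<Delta>) - 1"

definition cohen_macaulay_complex :: "'k::field itself \<Rightarrow> 'v set \<Rightarrow> 'v set set \<Rightarrow> bool" where
  "cohen_macaulay_complex _ V \<Delta> \<longleftrightarrow>
     cohen_macaulay (polynomial_ring V :: (('v \<Rightarrow>\<^sub>0 nat) \<Rightarrow>\<^sub>0 'k) ring) (irrelevant_ideal V)
       (stanley_reisner_ring V \<Delta>)"

definition sequentially_cohen_macaulay_complex ::
    "'k::field itself \<Rightarrow> 'v set \<Rightarrow> 'v set set \<Rightarrow> bool" where
  "sequentially_cohen_macaulay_complex _ V \<Delta> \<longleftrightarrow>
     sequentially_cohen_macaulay (polynomial_ring V :: (('v \<Rightarrow>\<^sub>0 nat) \<Rightarrow>\<^sub>0 'k) ring)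
       (irrelevant_ideal V) (stanley_reisner_ring V \<Delta>)"


section \<open>Basic facts\<close>

lemma polynomial_ring_simps:
  "carrier (polynomial_ring V) = {p. \<forall>m\<in>Poly_Mapping.keys p. Poly_Mapping.keys m \<subseteq> V}"
  "monoid.mult (polynomial_ring V) = (*)" "add (polynomial_ring V) = (+)"
  "one (polynomial_ring V) = 1" "ring.zero (polynomial_ring V) = 0"
  by (simp_all add: polynomial_ring_def)

lemma cring_polynomial_ring: "cring (polynomial_ring V :: (('v \<Rightarrow>\<^sub>0 nat) \<Rightarrow>\<^sub>0 'k::field) ring)"
proof -
  let ?R = "polynomial_ring V :: (('v \<Rightarrow>\<^sub>0 nat) \<Rightarrow>\<^sub>0 'k) ring"
  have carrI: "p \<in> carrier ?R" if "\<And>m. m \<in> Poly_Mapping.keys p \<Longrightarrow> Poly_Mapping.keys m \<subseteq> V" for p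
    using that by (simp add: polynomial_ring_simps)
  have carrD: "Poly_Mapping.keys m \<subseteq> V" if "p \<in> carrier ?R" "m \<in> Poly_Mapping.keys p" for p m
    using that by (simp add: polynomial_ring_simps)
  have add: "p + q \<in> carrier ?R" if "p \<in> carrier ?R" "q \<in> carrier ?R" for p q
    using keys_add[of p q] carrD[OF that(1)] carrD[OF that(2)] by (intro carrI) blast
  have mult: "p * q \<in> carrier ?R" if pq: "p \<in> carrier ?R" "q \<in> carrier ?R" for p q
  proof (rule carrI)
    fix m assume "m \<in> Poly_Mapping.keys (p * q)"
    then obtain a b where "m = a + b" "a \<in> Poly_Mapping.keys p" "b \<in> Poly_Mapping.keys q"
      using keys_mult[of p q] by blast
    then show "Poly_Mapping.keys m \<subseteq> V"
      using keys_add[of a b] carrD[OF pq(1)] carrD[OF pq(2)] by blast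
  qed
  have uminus: "- p \<in> carrier ?R" if "p \<in> carrier ?R" for p
    using carrD[OF that] by (intro carrI) simp
  have zero: "0 \<in> carrier ?R" and one: "1 \<in> carrier ?R"
    by (auto intro: carrI)
  note ops = polynomial_ring_simps(2-)
  have "abelian_group ?R"
  proof (rule abelian_groupI, unfold ops)
    fix p assume "p \<in> carrier ?R"
    then show "\<exists>q\<in>carrier ?R. q + p = 0"
      using uminus by (intro bexI[of _ "- p"]) simp_all
  qed (simp_all add: add zero ac_simps)
  moreover have "comm_monoid ?R"
    by (rule comm_monoidI, unfold ops) (simp_all add: mult one ac_simps)
  ultimately show ?thesis
    by (rule cringI) (simp add: ops distrib_right)
qed

lemma module_self_module:
  assumes "cring R"
  shows "module R (self_module R)"
proof -
  interpret cring R by fact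
  have "abelian_group (self_module R)"
    by (rule abelian_groupI)
      (auto simp: self_module_def a_assoc intro: a_comm bexI[of _ "\<ominus>\<^bsub>R\<^esub> _"] l_neg)
  then show ?thesis
    by (intro moduleI is_cring) (auto simp: self_module_def l_distr r_distr m_assoc)
qed

lemma submodule_self_module:
  assumes "cring R" "ideal I R"
  shows "submodule I R (self_module R)"
proof -
  interpret cring R by fact
  interpret I: ideal I R by fact
  interpret M: module R "self_module R" by (rule module_self_module) fact
  have "\<ominus>\<^bsub>self_module R\<^esub> a = \<ominus>\<^bsub>R\<^esub> a" for a
    by (simp add: a_inv_def m_inv_def self_module_def)
  then show ?thesis
    by (intro M.submoduleI) (use I.Icarr I.I_l_closed I.I_r_closed in \<open>auto simp: self_module_def\<close>)
qed

lemma smult_quotient_module: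
  assumes "module R N" "submodule U R N" "r \<in> carrier R" "x \<in> carrier N"
  shows "r \<odot>\<^bsub>quotient_module N U\<^esub> (U +>\<^bsub>N\<^esub> x) = U +>\<^bsub>N\<^esub> (r \<odot>\<^bsub>N\<^esub> x)"
proof -
  interpret module R N by fact
  interpret U: submodule U R N by fact
  interpret U: abelian_subgroup U N
    by (intro abelian_subgroupI3 additive_subgroup.intro U.subgroup_axioms M.abelian_group_axioms)
  have "U +>\<^bsub>N\<^esub> (r \<odot>\<^bsub>N\<^esub> c) = U +>\<^bsub>N\<^esub> (r \<odot>\<^bsub>N\<^esub> x)" if c: "c \<in> U +>\<^bsub>N\<^esub> x" for c
  proof -
    obtain u where u: "u \<in> U" "c = u \<oplus>\<^bsub>N\<^esub> x"
      using c by (auto simp: a_r_coset_def r_coset_def)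
    then have "r \<odot>\<^bsub>N\<^esub> c = r \<odot>\<^bsub>N\<^esub> u \<oplus>\<^bsub>N\<^esub> r \<odot>\<^bsub>N\<^esub> x"
      using assms U.a_Hcarr by (simp add: smult_r_distr)
    moreover have "r \<odot>\<^bsub>N\<^esub> u \<in> U"
      using assms(3) u(1) by (rule U.smult_closed)
    ultimately have "r \<odot>\<^bsub>N\<^esub> c \<in> U +>\<^bsub>N\<^esub> (r \<odot>\<^bsub>N\<^esub> x)"
      by (auto simp: a_r_coset_def r_coset_def)
    then show ?thesis
      using assms by (intro M.a_repr_independence[symmetric]) (auto intro: U.a_subgroup)
  qed
  moreover have "x \<in> U +>\<^bsub>N\<^esub> x"
    using assms(4) by (rule U.a_rcos_self)
  ultimately have "(\<Union>c\<in>U +>\<^bsub>N\<^esub> x. U +>\<^bsub>N\<^esub> (r \<odot>\<^bsub>N\<^esub> c)) = U +>\<^bsub>N\<^esub> (r \<odot>\<^bsub>N\<^esub> x)"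
    by (intro UN_constant_eq) blast+
  then show ?thesis
    by (simp only: quotient_module_def module.simps)
qed

lemma module_quotient_module:
  assumes "module R N" "submodule U R N"
  shows "module R (quotient_module N U)"
proof -
  interpret module R N by fact
  interpret U: submodule U R N by fact
  interpret U: abelian_subgroup U N
    by (intro abelian_subgroupI3 additive_subgroup.intro U.subgroup_axioms M.abelian_group_axioms)
  have add: "(U +>\<^bsub>N\<^esub> x) \<oplus>\<^bsub>quotient_module N U\<^esub> (U +>\<^bsub>N\<^esub> y) = U +>\<^bsub>N\<^esub> (x \<oplus>\<^bsub>N\<^esub> y)"
    if "x \<in> carrier N" "y \<in> carrier N" for x y
    using U.a_rcos_sum[OF that] by (simp add: quotient_module_def)
  have carr: "carrier (quotient_module N U) = (\<lambda>x. U +>\<^bsub>N\<^esub> x) ` carrier N"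
    by (auto simp: quotient_module_def A_RCOSETS_def')
  have zero: "\<zero>\<^bsub>quotient_module N U\<^esub> = U +>\<^bsub>N\<^esub> \<zero>\<^bsub>N\<^esub>"
    using M.a_coset_add_zero U.a_subset by (simp add: quotient_module_def)
  have coset: "U +>\<^bsub>N\<^esub> x \<in> carrier (quotient_module N U)" if "x \<in> carrier N" for x
    using that by (simp add: carr)
  have cosetE: thesis if "C \<in> carrier (quotient_module N U)"
    "\<And>x. x \<in> carrier N \<Longrightarrow> C = U +>\<^bsub>N\<^esub> x \<Longrightarrow> thesis" for C thesis
    using that by (auto simp only: carr)
  note [simp] = add zero coset smult_quotient_module[OF assms]
  have "abelian_group (quotient_module N U)"
  proof (rule abelian_groupI)
    fix C assume "C \<in> carrier (quotient_module N U)"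
    then obtain x where x: "x \<in> carrier N" "C = U +>\<^bsub>N\<^esub> x"
      by (rule cosetE)
    then have "(U +>\<^bsub>N\<^esub> (\<ominus>\<^bsub>N\<^esub> x)) \<oplus>\<^bsub>quotient_module N U\<^esub> C = \<zero>\<^bsub>quotient_module N U\<^esub>"
      by (simp add: M.l_neg)
    then show "\<exists>D\<in>carrier (quotient_module N U).
        D \<oplus>\<^bsub>quotient_module N U\<^esub> C = \<zero>\<^bsub>quotient_module N U\<^esub>"
      using x(1) by (intro bexI[of _ "U +>\<^bsub>N\<^esub> (\<ominus>\<^bsub>N\<^esub> x)"] coset M.a_inv_closed)
  qed (elim cosetE | simp add: M.a_ac)+
  then show ?thesis
    by (intro moduleI is_cring)
      (elim cosetE | simp add: smult_l_distr smult_r_distr smult_assoc1)+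
qed

lemma module_stanley_reisner_ring:
  "module (polynomial_ring V) (stanley_reisner_ring V \<Delta> ::
     (('v \<Rightarrow>\<^sub>0 nat) \<Rightarrow>\<^sub>0 'k::field, (('v \<Rightarrow>\<^sub>0 nat) \<Rightarrow>\<^sub>0 'k) set) module)"
proof -
  let ?R = "polynomial_ring V :: (('v \<Rightarrow>\<^sub>0 nat) \<Rightarrow>\<^sub>0 'k) ring"
  interpret cring ?R by (rule cring_polynomial_ring)
  have pvar: "pvar x \<in> carrier ?R" if "x \<in> V" for x
    using that by (auto simp: polynomial_ring_simps pvar_def)
  have "(\<Prod>x\<in>F. pvar x) \<in> carrier ?R" if "F \<subseteq> V" for F
    using that
  proof (induction F rule: infinite_finite_induct)
    case (insert x F)
    then have "pvar x \<otimes>\<^bsub>?R\<^esub> (\<Prod>x\<in>F. pvar x) \<in> carrier ?R"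
      by (intro m_closed pvar) auto
    then show ?case
      unfolding polynomial_ring_simps(2) prod.insert[OF insert.hyps] .
  qed (auto simp: polynomial_ring_simps)
  then have "ideal (stanley_reisner_ideal V \<Delta>) ?R"
    unfolding stanley_reisner_ideal_def
    by (intro genideal_ideal) (auto simp: minimal_nonfaces_def)
  then show ?thesis
    unfolding stanley_reisner_ring_def
    by (intro module_quotient_module module_self_module submodule_self_module is_cring)
qed

end

(*
Every module in sight is a quotient A/U of ideals of R = K[V] spanned by monomials: for a down-closed
family G of subsets of V let I_G be the span of the monomials whose support is not in G, so that
K[G] = R/I_G.  If D_i is the subcomplex generated by the faces with at least i vertices, the i-th step
of the dimension filtration of K[D] is I_{D_{i+1}}/I_D: an ideal is contained in it as soon as it
vanishes at the primes of all faces with more than i vertices.  Its i-th quotient is thus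
I_{D_{i+1}}/I_{D_i}.  Let S_i be the pure skeleton generated by the faces with i vertices and T_i the
complex of the faces with at most i vertices of S_{i+1}.  Then S_i - T_i = D_i - D_{i+1}, and there are
exact sequences
  0 -> I_{D_{i+1}}/I_{D_i} -> K[S_i] -> K[T_i] -> 0  and  0 -> J -> K[S_{i+1}] -> K[T_i] -> 0,
where J has depth i + 1, being filtered by modules that are free over the polynomial ring on a face.
If K[S_{i+1}] is Cohen-Macaulay, the depth lemma shows first that K[T_i] has depth at least i and then
that K[S_i] is Cohen-Macaulay iff the i-th quotient is.  The theorem follows by downward induction on i;
the value of the initial dimension plays no role.

Depth is measured by the vanishing of the Koszul cohomology of the elementary symmetric polynomials
e_1, ..., e_n in the variables, for which the depth lemma is a diagram chase.  A regular sequence of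
length k in the irrelevant ideal kills the cohomology in degrees below k, as a variable x satisfies
x^n in (e_1, ..., e_n).  If all faces of G - G' have at most k vertices, then e_j kills I_{G'}/I_G for
j > k, and the vanishing below k passes to e_1, ..., e_k; by a graded Nakayama argument these then form
a regular sequence.

The bound on Krull dimensions comes from counting monomials: more elements than the size of the largest
face are algebraically dependent modulo I_G, and a chain of primes would make them independent.
*)

theory Submission
  imports Defs
begin

section \<open>Koszul cohomology of quotients of ideals\<close>

text \<open>Regular sequences that witness the depths of the terms of an exact sequence differ from
  term to term and cannot be compared; the vanishing of Koszul cohomology for one fixed list can.
  This list has to serve all modules at once, over every field. General linear forms need not be
  available over a finite field, whereas the elementary symmetric polynomials have coefficients 0
  and 1 and contain, for every k, the tail e_{k+1}, ..., e_n that kills all modules carried by faces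
  with at most k vertices. Their degrees differ, hence the weights in the graded arguments.

  As all modules are quotients A/U inside one ring, a short exact sequence is a chain of submodules
  U, B, A, and a cochain of A/U is a function into A whose equations hold modulo U. Homomorphisms
  between modules do not occur, and diagram chases are computations with functions.

  Homogeneity enters only through truncation at a degree. Degrees are bounded below, so an induction
  on the degree of truncation proves the Nakayama statements, for modules and for cohomology,
  without finite generation.\<close>

definition submod :: "'a::comm_ring_1 set \<Rightarrow> 'a set \<Rightarrow> bool" where
  "submod C A \<longleftrightarrow> 0 \<in> A \<and> (\<forall>a\<in>A. \<forall>b\<in>A. a - b \<in> A) \<and> (\<forall>r\<in>C. \<forall>a\<in>A. r * a \<in> A)"

lemma submodI:
  assumes "0 \<in> A" "\<And>a b. a \<in> A \<Longrightarrow> b \<in> A \<Longrightarrow> a - b \<in> A" "\<And>r a. r \<in> C \<Longrightarrow> a \<in> A \<Longrightarrow> r * a \<in> A"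
  shows "submod C A"
  using assms by (simp add: submod_def)

lemma
  assumes "submod C A"
  shows submod_zero: "0 \<in> A"
    and submod_diff: "a \<in> A \<Longrightarrow> b \<in> A \<Longrightarrow> a - b \<in> A"
    and submod_mult: "r \<in> C \<Longrightarrow> a \<in> A \<Longrightarrow> r * a \<in> A"
  using assms by (simp_all add: submod_def)

lemma submod_uminus: "submod C A \<Longrightarrow> a \<in> A \<Longrightarrow> - a \<in> A"
  using submod_diff[of C A 0 a] submod_zero[of C A] by simp

lemma submod_add: "submod C A \<Longrightarrow> a \<in> A \<Longrightarrow> b \<in> A \<Longrightarrow> a + b \<in> A"
  using submod_diff[of C A a "- b"] submod_uminus[of C A b] by simp

lemma submod_sum: "submod C A \<Longrightarrow> (\<And>i. i \<in> I \<Longrightarrow> f i \<in> A) \<Longrightarrow> sum f I \<in> A"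
  by (induction I rule: infinite_finite_induct) (auto intro: submod_add submod_zero)

text \<open>For a submodule \<open>A\<close> this is \<open>(x_1, ..., x_n) A\<close>: as
  \<open>A\<close> is closed under sums, one coefficient from \<open>A\<close> per generator reaches
  every element.\<close>

fun list_span :: "'a::comm_ring_1 list \<Rightarrow> 'a set \<Rightarrow> 'a set" where
  "list_span [] A = {0}"
| "list_span (x # xs) A = {x * a + s | a s. a \<in> A \<and> s \<in> list_span xs A}"

definition plus_set :: "'a::comm_ring_1 set \<Rightarrow> 'a set \<Rightarrow> 'a set" (infixl "\<boxplus>" 65) where
  "A \<boxplus> B = {a + b | a b. a \<in> A \<and> b \<in> B}"

lemma plus_setI: "a \<in> A \<Longrightarrow> b \<in> B \<Longrightarrow> a + b \<in> A \<boxplus> B"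
  by (auto simp: plus_set_def)

lemma plus_set_assoc: "(A \<boxplus> B) \<boxplus> D = A \<boxplus> (B \<boxplus> D)"
  by (auto simp: plus_set_def) (metis add.assoc)+

lemma plus_set_commute: "A \<boxplus> B = B \<boxplus> A"
  by (auto simp: plus_set_def) (metis add.commute)+

lemma plus_set_zero: "A \<boxplus> {0} = A"
  by (auto simp: plus_set_def)

lemma submod_plus:
  assumes "submod C A" "submod C B"
  shows "submod C (A \<boxplus> B)"
proof (rule submodI)
  show "0 \<in> A \<boxplus> B"
    using plus_setI[OF submod_zero[OF assms(1)] submod_zero[OF assms(2)]] by simp
next
  fix a b assume "a \<in> A \<boxplus> B" "b \<in> A \<boxplus> B"
  then obtain x y x' y' where "a = x + y" "b = x' + y'" "x \<in> A" "y \<in> B" "x' \<in> A" "y' \<in> B"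
    by (auto simp: plus_set_def)
  then have "a - b = (x - x') + (y - y')" "x - x' \<in> A" "y - y' \<in> B"
    using assms by (auto intro: submod_diff)
  then show "a - b \<in> A \<boxplus> B" using plus_setI by metis
next
  fix r a assume "r \<in> C" "a \<in> A \<boxplus> B"
  then obtain x y where "a = x + y" "x \<in> A" "y \<in> B"
    by (auto simp: plus_set_def)
  then have "r * a = r * x + r * y" "r * x \<in> A" "r * y \<in> B"
    using assms \<open>r \<in> C\<close> by (auto intro: submod_mult simp: distrib_left)
  then show "r * a \<in> A \<boxplus> B" using plus_setI by metis
qed

lemma plus_set_left: "submod C B \<Longrightarrow> A \<subseteq> A \<boxplus> B"
  using plus_setI[of _ A 0 B] submod_zero[of C B] by auto

lemma plus_set_right: "submod C A \<Longrightarrow> B \<subseteq> A \<boxplus> B"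
  using plus_setI[of 0 A _ B] submod_zero[of C A] by auto

lemma submod_scaled:
  assumes "submod C A"
  shows "submod C ((*) x ` A)"
proof (rule submodI)
  show "0 \<in> (*) x ` A" using submod_zero[OF assms] by (intro image_eqI[of _ _ 0]) auto
next
  fix a b assume "a \<in> (*) x ` A" "b \<in> (*) x ` A"
  then obtain a' b' where "a = x * a'" "b = x * b'" "a' \<in> A" "b' \<in> A" by auto
  then show "a - b \<in> (*) x ` A"
    by (intro image_eqI[of _ _ "a' - b'"]) (auto simp: right_diff_distrib submod_diff[OF assms])
next
  fix r a assume "r \<in> C" "a \<in> (*) x ` A"
  then obtain a' where "a = x * a'" "a' \<in> A" by auto
  then show "r * a \<in> (*) x ` A"
    using \<open>r \<in> C\<close> by (intro image_eqI[of _ _ "r * a'"]) (auto simp: mult.left_commute submod_mult[OF assms])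
qed

lemma list_span_Cons: "list_span (x # xs) A = (*) x ` A \<boxplus> list_span xs A"
  by (auto simp: plus_set_def)

lemma submod_singleton: "submod C {0}"
  by (rule submodI) auto

lemma submod_list_span: "submod C A \<Longrightarrow> submod C (list_span xs A)"
proof (induction xs)
  case (Cons x xs)
  then show ?case
    unfolding list_span_Cons by (intro submod_plus submod_scaled) auto
qed (simp add: submod_singleton)

lemma list_span_subset: "submod C A \<Longrightarrow> set xs \<subseteq> C \<Longrightarrow> list_span xs A \<subseteq> A"
  by (induction xs) (fastforce intro: submod_zero submod_add submod_mult)+

lemma list_span_mem:
  assumes "submod C A" "x \<in> set xs" "a \<in> A"
  shows "x * a \<in> list_span xs A"
  using assms(2)
proof (induction xs)
  case (Cons y ys)
  show ?case
  proof (cases "x = y")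
    case True
    then show ?thesis using assms(3) submod_zero[OF submod_list_span[OF assms(1)], of ys]
      by (simp, intro exI[of _ a] exI[of _ 0]) simp
  next
    case False
    then have "x * a \<in> list_span ys A" using Cons by auto
    then show ?thesis using submod_zero[OF assms(1)]
      by (simp, intro exI[of _ 0] exI[of _ "x * a"]) simp
  qed
qed auto

lemma list_span_append: "list_span (xs @ ys) A = list_span xs A \<boxplus> list_span ys A"
proof (induction xs)
  case Nil
  then show ?case by (auto simp: plus_set_def)
next
  case (Cons x xs)
  show ?case using Cons by (simp only: append_Cons list_span_Cons plus_set_assoc)
qed

text \<open>
  A Koszul cochain on a list \<open>xs\<close> is indexed by the subsets of \<open>xs\<close>, encoded as words of the same length; its
  degree is the number of entries \<open>True\<close>.  Only the values on the words of the relevant length and degree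
  matter.  With values in \<open>A\<close>, taken modulo \<open>U\<close>, the cochains form the Koszul complex of \<open>A/U\<close>.
\<close>

fun koszul_d :: "'a::comm_ring_1 list \<Rightarrow> (bool list \<Rightarrow> 'a) \<Rightarrow> bool list \<Rightarrow> 'a" where
  "koszul_d [] c l = 0"
| "koszul_d (x # xs) c [] = 0"
| "koszul_d (x # xs) c (False # l) = koszul_d xs (\<lambda>l. c (False # l)) l"
| "koszul_d (x # xs) c (True # l) = x * c (False # l) - koszul_d xs (\<lambda>l. c (True # l)) l"

text \<open>The homotopy showing that a combination of \<open>xs\<close> annihilates the Koszul cohomology.\<close>

fun koszul_h :: "'a::comm_ring_1 list \<Rightarrow> (bool list \<Rightarrow> 'a) \<Rightarrow> bool list \<Rightarrow> 'a" where
  "koszul_h [] c l = 0"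
| "koszul_h (a # as) c [] = 0"
| "koszul_h (a # as) c (False # l) = a * c (True # l) + koszul_h as (\<lambda>l. c (False # l)) l"
| "koszul_h (a # as) c (True # l) = - koszul_h as (\<lambda>l. c (True # l)) l"

section \<open>Linearity of the differential, homotopy identity, cochains by degree\<close>

lemma koszul_d_add: "koszul_d xs (\<lambda>l. c l + c' l) l = koszul_d xs c l + koszul_d xs c' l"
  by (induction xs c l arbitrary: c' rule: koszul_d.induct) (simp_all add: distrib_left)

lemma koszul_d_uminus: "koszul_d xs (\<lambda>l. - c l) l = - koszul_d xs c l"
  by (induction xs c l rule: koszul_d.induct) simp_all

lemma koszul_d_diff: "koszul_d xs (\<lambda>l. c l - c' l) l = koszul_d xs c l - koszul_d xs c' l"
  using koszul_d_add[of xs c "\<lambda>l. - c' l" l] by (simp add: koszul_d_uminus)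

lemma koszul_d_smult: "koszul_d xs (\<lambda>l. r * c l) l = r * koszul_d xs c l"
  by (induction xs c l rule: koszul_d.induct) (simp_all add: algebra_simps)

lemma koszul_d_zero: "koszul_d xs (\<lambda>l. 0) l = 0"
  using koszul_d_diff[of xs "\<lambda>l. 0" "\<lambda>l. 0" l] by simp

lemma koszul_h_add: "koszul_h xs (\<lambda>l. c l + c' l) l = koszul_h xs c l + koszul_h xs c' l"
  by (induction xs c l arbitrary: c' rule: koszul_h.induct) (simp_all add: distrib_left add.assoc add.left_commute)

lemma koszul_h_uminus: "koszul_h xs (\<lambda>l. - c l) l = - koszul_h xs c l"
  by (induction xs c l rule: koszul_h.induct) simp_all

lemma koszul_h_diff: "koszul_h xs (\<lambda>l. c l - c' l) l = koszul_h xs c l - koszul_h xs c' l"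
  using koszul_h_add[of xs c "\<lambda>l. - c' l" l] by (simp add: koszul_h_uminus)

lemma koszul_h_smult: "koszul_h xs (\<lambda>l. r * c l) l = r * koszul_h xs c l"
  by (induction xs c l rule: koszul_h.induct) (simp_all add: algebra_simps)

lemma koszul_d_koszul_d: "koszul_d xs (koszul_d xs c) l = 0"
proof (induction xs arbitrary: c l)
  case (Cons x xs)
  show ?case
  proof (cases l)
    case (Cons b l')
    then show ?thesis
      using Cons.IH by (cases b) (simp_all add: koszul_d_diff koszul_d_smult)
  qed simp
qed simp

fun dot :: "'a::comm_ring_1 list \<Rightarrow> 'a list \<Rightarrow> 'a" where
  "dot (a # as) (x # xs) = a * x + dot as xs"
| "dot _ _ = 0"

lemma koszul_d_koszul_h:
  assumes "length as = length xs" "length l = length xs"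
  shows "koszul_d xs (koszul_h as c) l = dot as xs * c l - koszul_h as (koszul_d xs c) l"
  using assms
proof (induction as xs arbitrary: c l rule: list_induct2)
  case (Cons a as x xs)
  then obtain b l' where l: "l = b # l'" by (cases l) auto
  show ?case
    using Cons l by (cases b) (simp_all add: koszul_d_add koszul_d_smult koszul_d_uminus koszul_h_diff koszul_h_smult algebra_simps)
qed simp

text \<open>Degrees are of type \<open>int\<close>, so that degree \<open>j - 1\<close> exists for
  \<open>j = 0\<close>: it has no words, every function is a cochain there, and degree 0 is no
  special case.\<close>

definition kwords :: "nat \<Rightarrow> int \<Rightarrow> bool list set" where
  "kwords n j = {l. length l = n \<and> int (count_list l True) = j}"

definition cochain :: "'a set \<Rightarrow> nat \<Rightarrow> int \<Rightarrow> (bool list \<Rightarrow> 'a) \<Rightarrow> bool" where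
  "cochain A n j c \<longleftrightarrow> (\<forall>l\<in>kwords n j. c l \<in> A)"

lemma kwords_Cons: "b # l \<in> kwords (Suc n) j \<longleftrightarrow> (if b then l \<in> kwords n (j - 1) else l \<in> kwords n j)"
  by (auto simp: kwords_def)

lemma kwords_Suc_cases: "l \<in> kwords (Suc n) j \<Longrightarrow> (\<And>l'. l = False # l' \<Longrightarrow> l' \<in> kwords n j \<Longrightarrow> P) \<Longrightarrow>
   (\<And>l'. l = True # l' \<Longrightarrow> l' \<in> kwords n (j - 1) \<Longrightarrow> P) \<Longrightarrow> P"
  by (cases l) (auto simp: kwords_def split: if_splits)

lemma kwords_neg: "j < 0 \<Longrightarrow> kwords n j = {}"
  by (auto simp: kwords_def)

text \<open>The Koszul complex of \<open>x # xs\<close> is the mapping cone of multiplication by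
  \<open>x\<close> on that of \<open>xs\<close>: a cochain is a pair of cochains of degrees
  \<open>j\<close> and \<open>j - 1\<close>. The inductions on lists of ring elements rest on
  this.\<close>

lemma cochain_Suc: "cochain A (Suc n) j c \<longleftrightarrow>
    cochain A n j (\<lambda>l. c (False # l)) \<and> cochain A n (j - 1) (\<lambda>l. c (True # l))"
  unfolding cochain_def by (auto simp: kwords_Cons elim!: kwords_Suc_cases)

lemma cochain_mono: "cochain A n j c \<Longrightarrow> A \<subseteq> B \<Longrightarrow> cochain B n j c"
  by (auto simp: cochain_def)

lemma cochain_add: "submod C A \<Longrightarrow> cochain A n j c \<Longrightarrow> cochain A n j c' \<Longrightarrow> cochain A n j (\<lambda>l. c l + c' l)"
  by (auto simp: cochain_def intro: submod_add)

lemma cochain_diff: "submod C A \<Longrightarrow> cochain A n j c \<Longrightarrow> cochain A n j c' \<Longrightarrow> cochain A n j (\<lambda>l. c l - c' l)"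
  by (auto simp: cochain_def intro: submod_diff)

lemma cochain_uminus: "submod C A \<Longrightarrow> cochain A n j c \<Longrightarrow> cochain A n j (\<lambda>l. - c l)"
  by (auto simp: cochain_def intro: submod_uminus)

lemma cochain_smult: "submod C A \<Longrightarrow> r \<in> C \<Longrightarrow> cochain A n j c \<Longrightarrow> cochain A n j (\<lambda>l. r * c l)"
  by (auto simp: cochain_def intro: submod_mult)

lemma cochain_zero: "submod C A \<Longrightarrow> cochain A n j (\<lambda>l. 0)"
  by (auto simp: cochain_def intro: submod_zero)

lemma cochain_koszul_d:
  assumes "submod C A" "set xs \<subseteq> C" "cochain A (length xs) j c"
  shows "cochain A (length xs) (j + 1) (koszul_d xs c)"
  using assms(2,3)
proof (induction xs arbitrary: j c)
  case Nil
  then show ?case using assms(1) by (auto simp: cochain_def intro: submod_zero)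
next
  case (Cons x xs)
  note * = Cons.prems(2)[unfolded length_Cons cochain_Suc]
  have "cochain A (length xs) (j + 1) (koszul_d xs (\<lambda>l. c (False # l)))"
       "cochain A (length xs) j (koszul_d xs (\<lambda>l. c (True # l)))"
    using Cons.IH[of j "\<lambda>l. c (False # l)"] Cons.IH[of "j - 1" "\<lambda>l. c (True # l)"] Cons.prems * by auto
  then show ?case
    unfolding length_Cons cochain_Suc using * Cons.prems assms(1)
    by (auto intro!: cochain_diff[where C=C] cochain_smult[where C=C])
qed

lemma cochain_koszul_h:
  assumes "submod C A" "set as \<subseteq> C" "cochain A (length as) j c"
  shows "cochain A (length as) (j - 1) (koszul_h as c)"
  using assms(2,3)
proof (induction as arbitrary: j c)
  case Nil
  then show ?case using assms(1) by (auto simp: cochain_def intro: submod_zero)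
next
  case (Cons a as)
  note * = Cons.prems(2)[unfolded length_Cons cochain_Suc]
  have "cochain A (length as) (j - 1) (koszul_h as (\<lambda>l. c (False # l)))"
       "cochain A (length as) (j - 1 - 1) (koszul_h as (\<lambda>l. c (True # l)))"
    using Cons.IH[of j "\<lambda>l. c (False # l)"] Cons.IH[of "j - 1" "\<lambda>l. c (True # l)"] Cons.prems * by auto
  then show ?case
    unfolding length_Cons cochain_Suc using * Cons.prems assms(1)
    by (auto intro!: cochain_add[where C=C] cochain_uminus[where C=C] cochain_smult[where C=C])
qed

text \<open>The cohomology of \<open>A/U\<close> vanishes in degree \<open>j\<close>, with cocycles
  and bounding cochains lifted to \<open>A\<close>.\<close>

definition koszul_exact :: "'a::comm_ring_1 list \<Rightarrow> 'a set \<Rightarrow> 'a set \<Rightarrow> int \<Rightarrow> bool" where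
  "koszul_exact xs A U j \<longleftrightarrow> (\<forall>c. cochain A (length xs) j c \<longrightarrow> cochain U (length xs) (j + 1) (koszul_d xs c) \<longrightarrow>
     (\<exists>b. cochain A (length xs) (j - 1) b \<and> cochain U (length xs) j (\<lambda>l. c l - koszul_d xs b l)))"

lemma vanI:
  assumes "\<And>c. cochain A (length xs) j c \<Longrightarrow> cochain U (length xs) (j + 1) (koszul_d xs c) \<Longrightarrow>
     \<exists>b. cochain A (length xs) (j - 1) b \<and> cochain U (length xs) j (\<lambda>l. c l - koszul_d xs b l)"
  shows "koszul_exact xs A U j"
  using assms by (simp add: koszul_exact_def)

lemma vanD:
  assumes "koszul_exact xs A U j" "cochain A (length xs) j c" "cochain U (length xs) (j + 1) (koszul_d xs c)"
  obtains b where "cochain A (length xs) (j - 1) b" "cochain U (length xs) j (\<lambda>l. c l - koszul_d xs b l)"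
  using assms by (auto simp: koszul_exact_def)

lemma koszul_exact_neg: "j < 0 \<Longrightarrow> koszul_exact xs A U j"
  by (rule vanI) (auto simp: cochain_def kwords_neg)

lemma koszul_exact_trivial:
  assumes "submod C A" "A \<subseteq> U"
  shows "koszul_exact xs A U j"
proof (rule vanI)
  fix c assume "cochain A (length xs) j c"
  then show "\<exists>b. cochain A (length xs) (j - 1) b \<and> cochain U (length xs) j (\<lambda>l. c l - koszul_d xs b l)"
    using assms by (intro exI[of _ "\<lambda>l. 0"]) (auto simp: koszul_d_zero cochain_def intro: submod_zero)
qed

text \<open>In the long exact sequence of B/U, A/U, A/B the middle term lies between two vanishing
  ones.\<close>

lemma koszul_exact_extension:
  assumes "submod C A" "submod C B" "submod C U" "B \<subseteq> A" "U \<subseteq> B" "set xs \<subseteq> C"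
    and BU: "koszul_exact xs B U j" and AB: "koszul_exact xs A B j"
  shows "koszul_exact xs A U j"
proof (rule vanI)
  let ?n = "length xs"
  fix c assume c: "cochain A ?n j c" "cochain U ?n (j + 1) (koszul_d xs c)"
  obtain b where b: "cochain A ?n (j - 1) b" "cochain B ?n j (\<lambda>l. c l - koszul_d xs b l)"
    using AB c cochain_mono[OF c(2) assms(5)] by (elim vanD)
  have "koszul_d xs (\<lambda>l. c l - koszul_d xs b l) l = koszul_d xs c l" for l
    by (simp add: koszul_d_diff koszul_d_koszul_d)
  then obtain b1 where b1: "cochain B ?n (j - 1) b1"
     "cochain U ?n j (\<lambda>l. (c l - koszul_d xs b l) - koszul_d xs b1 l)"
    using vanD[OF BU b(2)] c(2) by (simp add: cochain_def) blast
  have "cochain U ?n j (\<lambda>l. c l - koszul_d xs (\<lambda>l. b l + b1 l) l)"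
    using b1(2) by (simp add: koszul_d_add algebra_simps)
  then show "\<exists>b. cochain A ?n (j - 1) b \<and> cochain U ?n j (\<lambda>l. c l - koszul_d xs b l)"
    using cochain_add[OF assms(1) b(1) cochain_mono[OF b1(1) assms(4)]] by blast
qed

text \<open>Degree \<open>j\<close> of B/U lies between degree \<open>j - 1\<close> of A/B and
  degree \<open>j\<close> of A/U.\<close>

lemma koszul_exact_kernel:
  assumes "submod C A" "submod C B" "submod C U" "B \<subseteq> A" "U \<subseteq> B" "set xs \<subseteq> C"
    and AU: "koszul_exact xs A U j" and AB: "koszul_exact xs A B (j - 1)"
  shows "koszul_exact xs B U j"
proof (rule vanI)
  let ?n = "length xs"
  fix c assume c: "cochain B ?n j c" "cochain U ?n (j + 1) (koszul_d xs c)"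
  obtain b where b: "cochain A ?n (j - 1) b" "cochain U ?n j (\<lambda>l. c l - koszul_d xs b l)"
    using AU cochain_mono[OF c(1) assms(4)] c(2) by (elim vanD)
  have "cochain B ?n j (\<lambda>l. c l - (c l - koszul_d xs b l))"
    by (rule cochain_diff[OF assms(2) c(1) cochain_mono[OF b(2) assms(5)]])
  then have "cochain B ?n (j - 1 + 1) (koszul_d xs b)"
    by simp
  then obtain b' where b': "cochain A ?n (j - 1 - 1) b'" "cochain B ?n (j - 1) (\<lambda>l. b l - koszul_d xs b' l)"
    using AB b(1) by (elim vanD)
  have "cochain U ?n j (\<lambda>l. c l - koszul_d xs (\<lambda>l. b l - koszul_d xs b' l) l)"
    using b(2) by (simp add: koszul_d_diff koszul_d_koszul_d)
  then show "\<exists>b. cochain B ?n (j - 1) b \<and> cochain U ?n j (\<lambda>l. c l - koszul_d xs b l)"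
    using b'(2) by blast
qed

text \<open>Degree \<open>j\<close> of A/B lies between degree \<open>j\<close> of A/U and degree
  \<open>j + 1\<close> of B/U.\<close>

lemma koszul_exact_quotient:
  assumes "submod C A" "submod C B" "submod C U" "B \<subseteq> A" "U \<subseteq> B" "set xs \<subseteq> C"
    and BU: "koszul_exact xs B U (j + 1)" and AU: "koszul_exact xs A U j"
  shows "koszul_exact xs A B j"
proof (rule vanI)
  let ?n = "length xs"
  fix c assume c: "cochain A ?n j c" "cochain B ?n (j + 1) (koszul_d xs c)"
  have "cochain U ?n (j + 1 + 1) (koszul_d xs (koszul_d xs c))"
    using submod_zero[OF assms(3)] by (simp add: koszul_d_koszul_d cochain_def)
  then obtain b where b: "cochain B ?n (j + 1 - 1) b" "cochain U ?n (j + 1) (\<lambda>l. koszul_d xs c l - koszul_d xs b l)"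
    using BU c(2) by (elim vanD)
  have "cochain A ?n j (\<lambda>l. c l - b l)"
    using c(1) cochain_mono[OF b(1) assms(4)] by (intro cochain_diff[OF assms(1)]) auto
  moreover have "cochain U ?n (j + 1) (koszul_d xs (\<lambda>l. c l - b l))"
    using b(2) by (simp add: koszul_d_diff cochain_def)
  ultimately obtain b' where b': "cochain A ?n (j - 1) b'" "cochain U ?n j (\<lambda>l. (c l - b l) - koszul_d xs b' l)"
    using vanD[OF AU] by blast
  have "cochain B ?n j (\<lambda>l. ((c l - b l) - koszul_d xs b' l) + b l)"
    using b(1) cochain_mono[OF b'(2) assms(5)] by (intro cochain_add[OF assms(2)]) auto
  then have "cochain B ?n j (\<lambda>l. c l - koszul_d xs b' l)"
    by (simp add: algebra_simps)
  then show "\<exists>b. cochain A ?n (j - 1) b \<and> cochain B ?n j (\<lambda>l. c l - koszul_d xs b l)"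
    using b'(1) by blast
qed

lemma plus_set_choice:
  assumes "cochain (A \<boxplus> B) n j c"
  obtains a b where "cochain A n j a" "cochain B n j b" "\<And>l. l \<in> kwords n j \<Longrightarrow> c l = a l + b l"
proof -
  have "\<forall>l\<in>kwords n j. \<exists>ab. fst ab \<in> A \<and> snd ab \<in> B \<and> c l = fst ab + snd ab"
    using assms by (force simp: cochain_def plus_set_def)
  then obtain f where "\<forall>l\<in>kwords n j. fst (f l) \<in> A \<and> snd (f l) \<in> B \<and> c l = fst (f l) + snd (f l)"
    by (rule bchoice[THEN exE])
  then show ?thesis
    by (intro that[of "\<lambda>l. fst (f l)" "\<lambda>l. snd (f l)"]) (auto simp: cochain_def)
qed

text \<open>The difference of the two functions is a cochain with values in the zero module, and so
  is its differential.\<close>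

lemma koszul_d_cong:
  assumes "\<And>l. l \<in> kwords (length xs) j \<Longrightarrow> c l = c' l" "l \<in> kwords (length xs) (j + 1)"
  shows "koszul_d xs c l = koszul_d xs c' l"
proof -
  have "cochain {0} (length xs) j (\<lambda>l. c l - c' l)"
    using assms(1) by (simp add: cochain_def)
  then have "cochain {0} (length xs) (j + 1) (koszul_d xs (\<lambda>l. c l - c' l))"
    by (intro cochain_koszul_d[where C=UNIV] submod_singleton) auto
  then show ?thesis using assms(2) by (simp add: cochain_def koszul_d_diff)
qed

lemma koszul_d_cong':
  assumes "\<And>l. l \<in> kwords (length xs) (j - 1) \<Longrightarrow> c l = c' l" "l \<in> kwords (length xs) j"
  shows "koszul_d xs c l = koszul_d xs c' l"
  using koszul_d_cong[of xs "j - 1" c c' l] assms by simp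

text \<open>The second isomorphism theorem, (A + U')/U' = A/(A \<inter> U'), on the level of
  cochains: values are split into a part in \<open>A\<close> and a part in
  \<open>U'\<close>.\<close>

lemma koszul_exact_second_iso:
  assumes "submod C A" "submod C U'" "set xs \<subseteq> C"
    and "A' = A \<boxplus> U'" "U = A \<inter> U'"
  shows "koszul_exact xs A' U' j \<longleftrightarrow> koszul_exact xs A U j"
proof
  let ?n = "length xs"
  have AA': "A \<subseteq> A'" using assms plus_set_left by blast
  assume l: "koszul_exact xs A U j"
  show "koszul_exact xs A' U' j"
  proof (rule vanI)
    fix c assume c: "cochain A' ?n j c" "cochain U' ?n (j + 1) (koszul_d xs c)"
    obtain a u where au: "cochain A ?n j a" "cochain U' ?n j u" "\<And>l. l \<in> kwords ?n j \<Longrightarrow> c l = a l + u l"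
      using c(1) assms(4) plus_set_choice by blast
    have eq: "koszul_d xs c l = koszul_d xs a l + koszul_d xs u l" if "l \<in> kwords ?n (j + 1)" for l
      using koszul_d_cong[of xs j c "\<lambda>l. a l + u l" l] au(3) that by (simp add: koszul_d_add)
    have "cochain U' ?n (j + 1) (\<lambda>l. koszul_d xs c l - koszul_d xs u l)"
      by (rule cochain_diff[OF assms(2) c(2) cochain_koszul_d[OF assms(2,3) au(2)]])
    then have "cochain U' ?n (j + 1) (koszul_d xs a)"
      using eq by (simp add: cochain_def)
    moreover have "cochain A ?n (j + 1) (koszul_d xs a)"
      by (rule cochain_koszul_d[OF assms(1,3) au(1)])
    ultimately have "cochain U ?n (j + 1) (koszul_d xs a)"
      using assms(5) by (auto simp: cochain_def)
    then obtain b where b: "cochain A ?n (j - 1) b" "cochain U ?n j (\<lambda>l. a l - koszul_d xs b l)"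
      using l au(1) by (elim vanD)
    have "cochain U' ?n j (\<lambda>l. (a l - koszul_d xs b l) + u l)"
      using b(2) au(2) assms(5) by (intro cochain_add[OF assms(2)]) (auto intro: cochain_mono)
    then have "cochain U' ?n j (\<lambda>l. c l - koszul_d xs b l)"
      using au(3) by (simp add: cochain_def algebra_simps)
    then show "\<exists>b. cochain A' ?n (j - 1) b \<and> cochain U' ?n j (\<lambda>l. c l - koszul_d xs b l)"
      using cochain_mono[OF b(1) AA'] by blast
  qed
next
  let ?n = "length xs"
  have AA': "A \<subseteq> A'" using assms plus_set_left by blast
  assume r: "koszul_exact xs A' U' j"
  show "koszul_exact xs A U j"
  proof (rule vanI)
    fix c assume c: "cochain A ?n j c" "cochain U ?n (j + 1) (koszul_d xs c)"
    then obtain b where b: "cochain A' ?n (j - 1) b" "cochain U' ?n j (\<lambda>l. c l - koszul_d xs b l)"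
      using vanD[OF r cochain_mono[OF c(1) AA'] cochain_mono[OF c(2)]] assms(5) by blast
    obtain a u where au: "cochain A ?n (j - 1) a" "cochain U' ?n (j - 1) u"
        "\<And>l. l \<in> kwords ?n (j - 1) \<Longrightarrow> b l = a l + u l"
      using b(1) assms(4) plus_set_choice by blast
    have eq: "koszul_d xs b l = koszul_d xs a l + koszul_d xs u l" if "l \<in> kwords ?n j" for l
      using koszul_d_cong'[of xs j b "\<lambda>l. a l + u l" l] au(3) that by (simp add: koszul_d_add)
    have "cochain U' ?n j (\<lambda>l. (c l - koszul_d xs b l) + koszul_d xs u l)"
      using cochain_koszul_d[OF assms(2,3) au(2)] b(2) by (intro cochain_add[OF assms(2)]) auto
    then have "cochain U' ?n j (\<lambda>l. c l - koszul_d xs a l)"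
      using eq by (simp add: cochain_def)
    moreover have "cochain A ?n j (\<lambda>l. c l - koszul_d xs a l)"
      using cochain_koszul_d[OF assms(1,3) au(1)] c(1) by (intro cochain_diff[OF assms(1)]) auto
    ultimately have "cochain U ?n j (\<lambda>l. c l - koszul_d xs a l)"
      using assms(5) by (auto simp: cochain_def)
    then show "\<exists>b. cochain A ?n (j - 1) b \<and> cochain U ?n j (\<lambda>l. c l - koszul_d xs b l)"
      using au(1) by blast
  qed
qed

text \<open>For a cocycle \<open>c\<close> modulo \<open>U\<close>, the term
  \<open>koszul_h as (koszul_d xs c)\<close> of the homotopy identity lies in \<open>U\<close>. So
  every combination of \<open>xs\<close> annihilates the cohomology.\<close>

lemma homotopy_boundary:
  assumes "submod C A" "submod C U" "length as = length xs" "set as \<subseteq> C"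
    and c: "cochain A (length xs) j c" "cochain U (length xs) (j + 1) (koszul_d xs c)"
  shows "cochain A (length xs) (j - 1) (koszul_h as c)"
    and "cochain U (length xs) j (\<lambda>l. dot as xs * c l - koszul_d xs (koszul_h as c) l)"
proof -
  let ?n = "length xs"
  show "cochain A ?n (j - 1) (koszul_h as c)"
    using cochain_koszul_h[of C A as j c] assms by simp
  have "cochain U ?n (j + 1 - 1) (koszul_h as (koszul_d xs c))"
    using cochain_koszul_h[of C U as "j + 1" "koszul_d xs c"] assms by simp
  moreover have "dot as xs * c l - koszul_d xs (koszul_h as c) l = koszul_h as (koszul_d xs c) l" if "l \<in> kwords ?n j" for l
    using koszul_d_koszul_h[of as xs l c] that assms by (simp add: kwords_def)
  ultimately show "cochain U ?n j (\<lambda>l. dot as xs * c l - koszul_d xs (koszul_h as c) l)"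
    by (simp add: cochain_def)
qed

text \<open>Since \<open>f = dot as xs\<close> annihilates the cohomology of A/U and is regular on
  A/U, the connecting map from degree \<open>j - 1\<close> of A/(U + f A) onto degree
  \<open>j\<close> of A/U is surjective.\<close>

lemma koszul_exact_regular_element:
  assumes "submod C A" "submod C U" "set xs \<subseteq> C" "length as = length xs" "set as \<subseteq> C"
    and reg: "\<And>a. a \<in> A \<Longrightarrow> dot as xs * a \<in> U \<Longrightarrow> a \<in> U"
    and quot: "koszul_exact xs A (U \<boxplus> (*) (dot as xs) ` A) (j - 1)"
  shows "koszul_exact xs A U j"
proof (rule vanI)
  let ?n = "length xs" and ?f = "dot as xs"
  fix c assume c: "cochain A ?n j c" "cochain U ?n (j + 1) (koszul_d xs c)"
  let ?b0 = "koszul_h as c"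
  note h = homotopy_boundary[OF assms(1,2,4,5) c]
  \<comment> \<open>The differential of \<open>?b0\<close> is \<open>?f * c\<close> up to
    \<open>U\<close>, so \<open>?b0\<close> is a cocycle modulo U + f A.\<close>
  have "cochain (U \<boxplus> (*) ?f ` A) ?n j (koszul_d xs ?b0)"
    unfolding cochain_def
  proof
    fix l assume l: "l \<in> kwords ?n j"
    have "- (?f * c l - koszul_d xs ?b0 l) \<in> U"
      using h(2) l submod_uminus[OF assms(2)] unfolding cochain_def by blast
    moreover have "?f * c l \<in> (*) ?f ` A"
      using c(1) l by (auto simp: cochain_def)
    ultimately have "- (?f * c l - koszul_d xs ?b0 l) + ?f * c l \<in> U \<boxplus> (*) ?f ` A"
      by (rule plus_setI)
    then show "koszul_d xs ?b0 l \<in> U \<boxplus> (*) ?f ` A" by simp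
  qed
  then have "cochain (U \<boxplus> (*) ?f ` A) ?n (j - 1 + 1) (koszul_d xs ?b0)" by simp
  then obtain b' where b': "cochain A ?n (j - 1 - 1) b'"
      "cochain (U \<boxplus> (*) ?f ` A) ?n (j - 1) (\<lambda>l. ?b0 l - koszul_d xs b' l)"
    using quot h(1) by (elim vanD)
  obtain u v where uv: "cochain U ?n (j - 1) u" "cochain ((*) ?f ` A) ?n (j - 1) v"
      "\<And>l. l \<in> kwords ?n (j - 1) \<Longrightarrow> ?b0 l - koszul_d xs b' l = u l + v l"
    using plus_set_choice[OF b'(2)] by blast
  have "\<forall>l\<in>kwords ?n (j - 1). \<exists>w. w \<in> A \<and> v l = ?f * w"
    using uv(2) by (auto simp: cochain_def)
  then obtain w where w: "\<forall>l\<in>kwords ?n (j - 1). w l \<in> A \<and> v l = ?f * w l"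
    by (rule bchoice[THEN exE])
  have wA: "cochain A ?n (j - 1) w" using w by (simp add: cochain_def)
  have eq: "koszul_d xs ?b0 l = koszul_d xs u l + ?f * koszul_d xs w l" if "l \<in> kwords ?n j" for l
  proof -
    have "koszul_d xs ?b0 l = koszul_d xs (\<lambda>l. (koszul_d xs b' l + u l) + ?f * w l) l"
      using uv(3) w that by (intro koszul_d_cong'[of xs j]) (auto simp: algebra_simps)
    then show ?thesis by (simp add: koszul_d_add koszul_d_koszul_d koszul_d_smult)
  qed
  have du: "cochain U ?n (j - 1 + 1) (koszul_d xs u)"
    by (rule cochain_koszul_d[OF assms(2,3) uv(1)])
  have "cochain U ?n j (\<lambda>l. (?f * c l - koszul_d xs ?b0 l) + koszul_d xs u l)"
    using h(2) du by (intro cochain_add[OF assms(2)]) auto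
  \<comment> \<open>Only \<open>u\<close> and \<open>?f * w\<close> contribute to the differential
    of \<open>?b0\<close>; what remains is a multiple of \<open>?f\<close> in \<open>U\<close>, from
    which \<open>?f\<close> can be cancelled.\<close>
  then have "\<forall>l\<in>kwords ?n j. ?f * (c l - koszul_d xs w l) \<in> U"
    by (simp add: cochain_def eq algebra_simps)
  moreover have "cochain A ?n j (\<lambda>l. c l - koszul_d xs w l)"
    using c(1) cochain_koszul_d[OF assms(1,3) wA] by (intro cochain_diff[OF assms(1)]) auto
  ultimately have "cochain U ?n j (\<lambda>l. c l - koszul_d xs w l)"
    using reg by (simp add: cochain_def)
  then show "\<exists>b. cochain A ?n (j - 1) b \<and> cochain U ?n j (\<lambda>l. c l - koszul_d xs b l)"
    using wA by blast
qed

section \<open>Regular sequences, and shortening the list of elements\<close>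

fun regseq :: "'a::comm_ring_1 set \<Rightarrow> 'a set \<Rightarrow> 'a list \<Rightarrow> bool" where
  "regseq A U [] \<longleftrightarrow> True"
| "regseq A U (f # fs) \<longleftrightarrow> (\<forall>a\<in>A. f * a \<in> U \<longrightarrow> a \<in> U) \<and> regseq A (U \<boxplus> (*) f ` A) fs"

lemma list_span_dot:
  assumes "f \<in> list_span xs C"
  obtains as where "length as = length xs" "set as \<subseteq> C" "f = dot as xs"
  using assms
proof (induction xs arbitrary: f thesis)
  case (Cons x xs)
  then obtain a s where "a \<in> C" "s \<in> list_span xs C" "f = x * a + s" by auto
  moreover obtain as where "length as = length xs" "set as \<subseteq> C" "s = dot as xs"
    using Cons.IH \<open>s \<in> list_span xs C\<close> by metis
  ultimately show ?case
    by (intro Cons.prems(1)[of "a # as"]) (auto simp: mult.commute)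
qed simp

text \<open>Each member of the sequence is a combination of \<open>xs\<close>, so
  \<open>koszul_exact_regular_element\<close> applies to it and raises the range of vanishing
  degrees by one.\<close>

lemma koszul_exact_regseq:
  assumes "submod C A" "submod C U" "set xs \<subseteq> C" "set fs \<subseteq> list_span xs C" "regseq A U fs" "j < int (length fs)"
  shows "koszul_exact xs A U j"
  using assms(2,4,5,6)
proof (induction fs arbitrary: U j)
  case Nil
  then show ?case by (simp add: koszul_exact_neg)
next
  case (Cons f fs)
  obtain as where as: "length as = length xs" "set as \<subseteq> C" "f = dot as xs"
    using Cons.prems(2) list_span_dot[of f xs C] by auto
  have "koszul_exact xs A (U \<boxplus> (*) f ` A) (j - 1)"
    using Cons.prems assms(1) by (intro Cons.IH submod_plus submod_scaled) auto
  then show ?case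
    using Cons.prems as by (intro koszul_exact_regular_element[OF assms(1) Cons.prems(1) assms(3) as(1,2)]) auto
qed

text \<open>By the cone sequence, \<open>x\<close> acts injectively on degree \<open>j\<close> of
  the cohomology of \<open>xs\<close> once that of \<open>x # xs\<close> vanishes. A class killed by
  \<open>x ^ r\<close> is therefore zero.\<close>

lemma koszul_exact_Cons_divides:
  assumes "submod C A" "submod C U" "set xs \<subseteq> C" "x \<in> C" "koszul_exact (x # xs) A U j"
    and c: "cochain A (length xs) j c" "cochain U (length xs) (j + 1) (koszul_d xs c)"
    and b: "cochain A (length xs) (j - 1) b" "cochain U (length xs) j (\<lambda>l. x ^ r * c l - koszul_d xs b l)"
  shows "\<exists>b. cochain A (length xs) (j - 1) b \<and> cochain U (length xs) j (\<lambda>l. c l - koszul_d xs b l)"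
  using b
proof (induction r arbitrary: b)
  case 0
  then show ?case by auto
next
  case (Suc r)
  let ?n = "length xs"
  define c0 where "c0 = (\<lambda>l. x ^ r * c l)"
  have pow: "cochain B ?n i e \<Longrightarrow> submod C B \<Longrightarrow> cochain B ?n i (\<lambda>l. x ^ r * e l)" for B i and e
    using assms(4) by (induction r) (auto simp: mult.assoc intro: cochain_smult)
  have c0: "cochain A ?n j c0" "cochain U ?n (j + 1) (koszul_d xs c0)"
    using pow[OF c(1) assms(1)] pow[OF c(2) assms(2)] by (simp_all add: c0_def cochain_def koszul_d_smult)
  \<comment> \<open>The pair of \<open>x ^ r * c\<close> and \<open>b\<close> is a cocycle on
    \<open>x # xs\<close> because \<open>x ^ Suc r * c\<close> is the differential of
    \<open>b\<close> modulo \<open>U\<close>. The \<open>False\<close> half of a cochain bounding it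
    bounds \<open>x ^ r * c\<close>.\<close>
  define e where "e = (\<lambda>l. case l of [] \<Rightarrow> 0 | q # l' \<Rightarrow> if q then b l' else c0 l')"
  have "cochain A (length (x # xs)) j e"
    using c0(1) Suc.prems(1) by (simp add: cochain_Suc e_def)
  moreover have "cochain U (length (x # xs)) (j + 1) (koszul_d (x # xs) e)"
    using c0(2) Suc.prems(2) by (simp add: cochain_Suc e_def c0_def mult.assoc)
  ultimately obtain e' where e': "cochain A (length (x # xs)) (j - 1) e'"
      "cochain U (length (x # xs)) j (\<lambda>l. e l - koszul_d (x # xs) e' l)"
    using assms(5) by (elim vanD)
  show ?case
    using e' by (intro Suc.IH[of "\<lambda>l. e' (False # l)"]) (simp_all add: cochain_Suc e_def c0_def)
qed

text \<open>On the cohomology of \<open>xs\<close> both \<open>f\<close> and \<open>w\<close> act as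
  zero, so \<open>x\<close> acts nilpotently; it also acts injectively by
  \<open>koszul_exact_Cons_divides\<close>.\<close>

lemma koszul_exact_remove:
  assumes "submod C A" "submod C U" "set xs \<subseteq> C" "x \<in> C"
    and "x ^ r = f + w" "f \<in> list_span xs C" "\<And>a. a \<in> A \<Longrightarrow> w * a \<in> U"
    and "koszul_exact (x # xs) A U j"
  shows "koszul_exact xs A U j"
proof (rule vanI)
  fix c assume c: "cochain A (length xs) j c" "cochain U (length xs) (j + 1) (koszul_d xs c)"
  obtain as where as: "length as = length xs" "set as \<subseteq> C" "f = dot as xs"
    using assms(6) list_span_dot by metis
  note h = homotopy_boundary[OF assms(1,2) as(1,2) c]
  have "cochain U (length xs) j (\<lambda>l. w * c l)"
    using c(1) assms(7) by (simp add: cochain_def)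
  then have "cochain U (length xs) j (\<lambda>l. (dot as xs * c l - koszul_d xs (koszul_h as c) l) + w * c l)"
    by (intro cochain_add[OF assms(2) h(2)])
  then have "cochain U (length xs) j (\<lambda>l. x ^ r * c l - koszul_d xs (koszul_h as c) l)"
    by (simp add: assms(5) as(3) algebra_simps)
  then show "\<exists>b. cochain A (length xs) (j - 1) b \<and> cochain U (length xs) j (\<lambda>l. c l - koszul_d xs b l)"
    using koszul_exact_Cons_divides[OF assms(1-4,8) c h(1)] by blast
qed

text \<open>This serves two purposes: with \<open>w = 0\<close> it trades the variables for the e_j,
  with \<open>f = 0\<close> it discards those e_j that annihilate A/U.\<close>

lemma koszul_exact_remove_prefix:
  assumes "submod C A" "submod C U" "set xs \<subseteq> C" "set ys \<subseteq> C"
    and "\<And>y. y \<in> set ys \<Longrightarrow> \<exists>r f w. y ^ r = f + w \<and> f \<in> list_span xs C \<and> (\<forall>a\<in>A. w * a \<in> U)"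
    and "submod C C" "koszul_exact (ys @ xs) A U j"
  shows "koszul_exact xs A U j"
  using assms(4,5,7)
proof (induction ys)
  case (Cons y ys)
  have sub: "set (ys @ xs) \<subseteq> C" using Cons.prems assms(3) by auto
  obtain r f w where rfw: "y ^ r = f + w" "f \<in> list_span xs C" "\<forall>a\<in>A. w * a \<in> U"
    using Cons.prems(2)[of y] by auto
  have "list_span xs C \<subseteq> list_span (ys @ xs) C"
    unfolding list_span_append using submod_list_span[OF assms(6)] by (rule plus_set_right)
  then have "koszul_exact (ys @ xs) A U j"
    using Cons.prems rfw sub by (intro koszul_exact_remove[OF assms(1,2), of "ys @ xs" y r f w]) auto
  then show ?case using Cons by auto
qed simp

section \<open>The two highest degrees\<close>

lemma kwords_top: "kwords n (int n) = {replicate n True}"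
proof -
  have "l = replicate n True" if "length l = n" "count_list l True = n" for l
    using that
  proof (induction l arbitrary: n)
    case (Cons b l)
    have "count_list l True \<le> length l" by (rule count_le_length)
    then show ?case using Cons by (cases b) auto
  qed simp
  moreover have "count_list (replicate n True) True = n"
    by (induction n) auto
  ultimately show ?thesis by (auto simp: kwords_def)
qed

lemma kwords_above: "j > int n \<Longrightarrow> kwords n j = {}"
proof -
  assume "j > int n"
  moreover have "int (count_list l True) \<le> int n" if "length l = n" for l
    using count_le_length[of l True] that by simp
  ultimately show "kwords n j = {}" by (force simp: kwords_def)
qed

text \<open>The top degree has a single word, so the last differential maps onto
  \<open>list_span xs A\<close> and the top cohomology is A/(U + (xs) A). This gives one inclusion,
  \<open>top_koszul_d\<close> the other.\<close>

lemma koszul_d_top: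
  assumes "submod C A" "cochain A (length xs) (int (length xs) - 1) b"
  shows "koszul_d xs b (replicate (length xs) True) \<in> list_span xs A"
  using assms(2)
proof (induction xs arbitrary: b)
  case (Cons x xs)
  let ?n = "length xs"
  have b: "cochain A ?n (int ?n) (\<lambda>l. b (False # l))"
       "cochain A ?n (int ?n - 1) (\<lambda>l. b (True # l))"
    using Cons.prems by (simp_all add: cochain_Suc)
  have "b (False # replicate ?n True) \<in> A"
    using b(1) by (simp add: cochain_def kwords_top)
  moreover have "- koszul_d xs (\<lambda>l. b (True # l)) (replicate ?n True) \<in> list_span xs A"
    using Cons.IH[OF b(2)] by (rule submod_uminus[OF submod_list_span[OF assms(1)]])
  ultimately show ?case by force
qed simp

lemma top_koszul_d:
  assumes "submod C A" "s \<in> list_span xs A"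
  shows "\<exists>b. cochain A (length xs) (int (length xs) - 1) b \<and> koszul_d xs b (replicate (length xs) True) = s"
  using assms(2)
proof (induction xs arbitrary: s)
  case Nil
  then show ?case by (intro exI[of _ "\<lambda>l. 0"]) (simp add: cochain_zero[OF assms(1)])
next
  case (Cons x xs)
  let ?n = "length xs"
  obtain a s' where s: "a \<in> A" "s' \<in> list_span xs A" "s = x * a + s'" using Cons.prems by auto
  obtain b where b: "cochain A ?n (int ?n - 1) b" "koszul_d xs b (replicate ?n True) = - s'"
    using Cons.IH[OF submod_uminus[OF submod_list_span[OF assms(1)] s(2)]] by blast
  define c where "c = (\<lambda>l. case l of [] \<Rightarrow> 0 | q # l' \<Rightarrow> if q then b l' else a)"
  have "cochain A (Suc ?n) (int ?n) c"
    using b(1) s(1) by (simp add: cochain_Suc c_def) (simp add: cochain_def)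
  then show ?case
    using b(2) s(3) by (intro exI[of _ c]) (simp add: c_def)
qed

lemma koszul_exact_top:
  assumes "submod C A" "submod C U" "koszul_exact xs A U (int (length xs))" "a \<in> A"
  shows "a \<in> U \<boxplus> list_span xs A"
proof -
  let ?n = "length xs"
  obtain b where b: "cochain A ?n (int ?n - 1) b" "cochain U ?n (int ?n) (\<lambda>l. a - koszul_d xs b l)"
    using assms(3) by (rule vanD[where c = "\<lambda>l. a"]) (use assms(4) in \<open>auto simp: cochain_def kwords_above\<close>)
  have "(a - koszul_d xs b (replicate ?n True)) + koszul_d xs b (replicate ?n True) \<in> U \<boxplus> list_span xs A"
    using b by (intro plus_setI koszul_d_top[OF assms(1)]) (simp_all add: cochain_def kwords_top)
  then show ?thesis by simp
qed

text \<open>By the cone sequence, vanishing just below the top degree of \<open>y # ys\<close> makes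
  \<open>y\<close> injective on the top cohomology of \<open>ys\<close>, which is A/(U + (ys) A). If
  \<open>y * a\<close> is in \<open>U\<close> up to the differential of \<open>b\<close>, the
  cocycle to bound is the pair of \<open>a\<close> and \<open>b\<close>.\<close>

lemma koszul_exact_Cons_top_regular:
  assumes "submod C A" "submod C U" "koszul_exact (y # ys) A U (int (length ys))" "a \<in> A" "y * a \<in> U \<boxplus> list_span ys A"
  shows "a \<in> U \<boxplus> list_span ys A"
proof -
  let ?n = "length ys"
  obtain u s where us: "u \<in> U" "s \<in> list_span ys A" "y * a = u + s"
    using assms(5) by (auto simp: plus_set_def)
  obtain b where b: "cochain A ?n (int ?n - 1) b" "koszul_d ys b (replicate ?n True) = s"
    using top_koszul_d[OF assms(1) us(2)] by blast
  define c where "c = (\<lambda>l. case l of [] \<Rightarrow> 0 | q # l' \<Rightarrow> if q then b l' else a)"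
  have c: "cochain A (length (y # ys)) (int ?n) c"
    using b(1) assms(4) by (simp add: cochain_Suc c_def) (simp add: cochain_def)
  have "cochain U (length (y # ys)) (int ?n + 1) (koszul_d (y # ys) c)"
    using b(2) us by (simp add: cochain_Suc c_def) (simp add: cochain_def kwords_above kwords_top)
  then obtain e where e: "cochain A (length (y # ys)) (int ?n - 1) e"
      "cochain U (length (y # ys)) (int ?n) (\<lambda>l. c l - koszul_d (y # ys) e l)"
    using assms(3) c by (elim vanD)
  let ?t = "replicate ?n True" and ?e0 = "\<lambda>l. e (False # l)"
  have "cochain A ?n (int ?n - 1) ?e0" "cochain U ?n (int ?n) (\<lambda>l. a - koszul_d ys ?e0 l)"
    using e by (simp_all add: cochain_Suc c_def)
  then have "cochain A ?n (int ?n - 1) ?e0" "a - koszul_d ys ?e0 ?t \<in> U"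
    by (simp_all add: cochain_def kwords_top)
  then have "(a - koszul_d ys ?e0 ?t) + koszul_d ys ?e0 ?t \<in> U \<boxplus> list_span ys A"
    by (intro plus_setI koszul_d_top[OF assms(1)])
  then show ?thesis by simp
qed

section \<open>Graded Nakayama arguments\<close>

fun word_weight :: "int list \<Rightarrow> bool list \<Rightarrow> int" where
  "word_weight (d # ds) (b # l) = (if b then d else 0) + word_weight ds l"
| "word_weight _ _ = 0"

lemma wt_le: "(\<And>d. d \<in> set ds \<Longrightarrow> 0 \<le> d) \<Longrightarrow> word_weight ds l \<le> sum_list ds"
proof (induction ds l rule: word_weight.induct)
  case (1 d ds b l)
  then have "word_weight ds l \<le> sum_list ds" "0 \<le> d" by auto
  then show ?case by auto
qed (auto intro: sum_list_nonneg)

lemma finite_kwords: "finite (kwords n j)"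
  by (rule finite_subset[OF _ finite_lists_length_eq[of "UNIV :: bool set" n]]) (auto simp: kwords_def)

text \<open>\<open>tr t\<close> models the removal of all terms of degree above \<open>t\<close>.
  Additive projections of this kind are all that is used of a grading; decompositions into
  homogeneous components do not occur.\<close>

locale truncation =
  fixes tr :: "int \<Rightarrow> 'a::comm_ring_1 \<Rightarrow> 'a"
  assumes tr_diff: "tr t (a - b) = tr t a - tr t b"
    and tr_idem: "tr t (tr t a) = tr t a"
    and tr_neg: "t < 0 \<Longrightarrow> tr t a = 0"
    and tr_eventually: "\<exists>t0. \<forall>t\<ge>t0. tr t a = a"
begin

lemma tr_zero: "tr t 0 = 0"
  using tr_diff[of t 0 0] by simp

lemma tr_uminus: "tr t (- a) = - tr t a"
  using tr_diff[of t 0 a] by (simp add: tr_zero)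

lemma tr_add: "tr t (a + b) = tr t a + tr t b"
  using tr_diff[of t a "- b"] by (simp add: tr_uminus)

text \<open>Homogeneity is expressed by the effect on truncations. Degree 0 is excluded because
  every descent below needs multiplication by \<open>y\<close> to raise degrees.\<close>

definition homog :: "int \<Rightarrow> 'a \<Rightarrow> bool" where
  "homog d y \<longleftrightarrow> 0 < d \<and> (\<forall>t a. tr t (y * a) = y * tr (t - d) a)"

definition graded :: "'a set \<Rightarrow> bool" where
  "graded A \<longleftrightarrow> (\<forall>t. \<forall>a\<in>A. tr t a \<in> A)"

text \<open>The cut-off at \<open>l\<close> is shifted by the degrees of the list elements that
  \<open>l\<close> selects. With this shift \<open>koszul_d\<close> has degree 0 on a homogeneous
  list and commutes with truncation.\<close>

definition trunc_cochain :: "int list \<Rightarrow> int \<Rightarrow> (bool list \<Rightarrow> 'a) \<Rightarrow> bool list \<Rightarrow> 'a" where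
  "trunc_cochain ds t c l = tr (t + word_weight ds l) (c l)"

lemma koszul_d_trunc_cochain:
  assumes "list_all2 homog ds xs"
  shows "koszul_d xs (trunc_cochain ds t c) l = trunc_cochain ds t (koszul_d xs c) l"
  using assms
proof (induction ds xs arbitrary: c t l rule: list_all2_induct)
  case Nil
  then show ?case by (simp add: trunc_cochain_def tr_zero)
next
  case (Cons d ds x xs)
  show ?case
  proof (cases l)
    case Nil
    then show ?thesis by (simp add: trunc_cochain_def tr_zero)
  next
    case l: (Cons b l')
    have 1: "(\<lambda>l. trunc_cochain (d # ds) t c (False # l)) = trunc_cochain ds t (\<lambda>l. c (False # l))"
        "(\<lambda>l. trunc_cochain (d # ds) t c (True # l)) = trunc_cochain ds (t + d) (\<lambda>l. c (True # l))"
      by (auto simp: trunc_cochain_def fun_eq_iff algebra_simps)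
    have 2: "tr (t + d + word_weight ds l') (x * a) = x * tr (t + word_weight ds l') a" for a
      using Cons.hyps(1) by (simp add: homog_def algebra_simps)
    show ?thesis
    proof (cases b)
      case True
      have "koszul_d (x # xs) (trunc_cochain (d # ds) t c) l
          = x * tr (t + word_weight ds l') (c (False # l')) - koszul_d xs (trunc_cochain ds (t + d) (\<lambda>l. c (True # l))) l'"
        using l True 1 by (simp add: trunc_cochain_def[of "d # ds" t c "False # l'"])
      also have "\<dots> = trunc_cochain (d # ds) t (koszul_d (x # xs) c) l"
        unfolding Cons.IH using l True 2 by (simp add: trunc_cochain_def tr_diff add.assoc)
      finally show ?thesis .
    next
      case False
      then have "koszul_d (x # xs) (trunc_cochain (d # ds) t c) l = koszul_d xs (trunc_cochain ds t (\<lambda>l. c (False # l))) l'"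
        using l 1 by simp
      then show ?thesis
        unfolding Cons.IH using l False by (simp add: trunc_cochain_def)
    qed
  qed
qed

lemma cochain_trunc_cochain: "graded A \<Longrightarrow> cochain A n j c \<Longrightarrow> cochain A n j (trunc_cochain ds t c)"
  by (simp add: cochain_def graded_def trunc_cochain_def)

text \<open>
  The long exact sequence writes a cocycle as a coboundary plus \<open>y\<close> times a cocycle; truncation makes the
  latter of smaller degree, and the degrees are bounded below.
\<close>

lemma koszul_exact_Cons_truncated:
  assumes A: "submod C A" "submod C U" "graded A" "graded U" and C: "set ys \<subseteq> C" "y \<in> C"
    and hom: "list_all2 homog ds ys" "homog d y" and koszul_exact: "koszul_exact (y # ys) A U (j + 1)"
    and c: "cochain A (length ys) j c" "cochain U (length ys) (j + 1) (koszul_d ys c)"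
    and tr: "\<And>l. l \<in> kwords (length ys) j \<Longrightarrow> trunc_cochain ds t c l = c l"
  shows "\<exists>b. cochain A (length ys) (j - 1) b \<and> cochain U (length ys) j (\<lambda>l. c l - koszul_d ys b l)"
  using c tr
proof (induction "nat (1 + t + sum_list ds)" arbitrary: t c rule: less_induct)
  case less
  let ?n = "length ys"
  have nonneg: "\<And>e. e \<in> set ds \<Longrightarrow> 0 \<le> e"
    using hom(1) by (induction rule: list_all2_induct) (auto simp: homog_def)
  show ?case
  \<comment> \<open>The values of \<open>c\<close> have degree at most
    \<open>t + sum_list ds\<close>, since a word weighs at most \<open>sum_list ds\<close>. Once
    this is negative, \<open>c\<close> vanishes.\<close>
  proof (cases "t + sum_list ds < 0")
    case True
    have "c l = 0" if "l \<in> kwords ?n j" for l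
    proof -
      have "word_weight ds l \<le> sum_list ds" using nonneg by (rule wt_le)
      then have "trunc_cochain ds t c l = 0"
        unfolding trunc_cochain_def using True by (intro tr_neg) linarith
      then show ?thesis using less.prems(3)[OF that] by simp
    qed
    then show ?thesis
      using submod_zero[OF A(1)] submod_zero[OF A(2)]
      by (intro exI[of _ "\<lambda>l. 0"]) (simp add: cochain_def koszul_d_zero)
  next
    case False
    \<comment> \<open>The pair of 0 and \<open>c\<close> is a cocycle on \<open>y # ys\<close>. A
      pair bounding it writes \<open>c\<close> as \<open>y * ?b0\<close> minus a differential,
      modulo \<open>U\<close>, and makes \<open>?b0\<close> a cocycle.\<close>
    define e where "e = (\<lambda>l. case l of [] \<Rightarrow> 0 | q # l' \<Rightarrow> if q then c l' else 0)"
    have e: "cochain A (Suc ?n) (j + 1) e" "cochain U (Suc ?n) (j + 1 + 1) (koszul_d (y # ys) e)"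
      using less.prems(1,2) submod_zero[OF A(1)] submod_zero[OF A(2)] submod_uminus[OF A(2)]
      by (simp_all add: cochain_Suc e_def) (simp_all add: cochain_def koszul_d_zero add.commute)
    obtain b where b: "cochain A (Suc ?n) j b" "cochain U (Suc ?n) (j + 1) (\<lambda>l. e l - koszul_d (y # ys) b l)"
      using vanD[OF koszul_exact, of e] e by auto
    let ?b0 = "\<lambda>l. b (False # l)" and ?b1 = "\<lambda>l. b (True # l)"
    have b01: "cochain A ?n j ?b0" "cochain A ?n (j - 1) ?b1"
      using b(1) by (simp_all add: cochain_Suc)
    have cb: "cochain U ?n j (\<lambda>l. c l - (y * ?b0 l - koszul_d ys ?b1 l))"
      using b(2) by (simp add: cochain_Suc e_def)
    have "cochain U ?n (j + 1) (\<lambda>l. - koszul_d ys ?b0 l)"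
      using b(2) by (simp add: cochain_Suc e_def)
    then have db0: "cochain U ?n (j + 1) (koszul_d ys ?b0)"
      using cochain_uminus[OF A(2)] by fastforce
    \<comment> \<open>Since \<open>c\<close> is unchanged by truncation at \<open>t\<close>, only
      the part of \<open>?b0\<close> up to \<open>t - d\<close> matters; the induction hypothesis
      applies to that part because \<open>d\<close> is positive.\<close>
    define b0 where "b0 = trunc_cochain ds (t - d) ?b0"
    define b1 where "b1 = trunc_cochain ds t ?b1"
    have d: "0 < d" "\<And>t a. tr t (y * a) = y * tr (t - d) a"
      using hom(2) by (auto simp: homog_def)
    have "cochain A ?n j b0" unfolding b0_def by (rule cochain_trunc_cochain[OF A(3) b01(1)])
    moreover have "koszul_d ys b0 = trunc_cochain ds (t - d) (koszul_d ys ?b0)"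
      unfolding b0_def by (rule ext, rule koszul_d_trunc_cochain[OF hom(1)])
    then have "cochain U ?n (j + 1) (koszul_d ys b0)"
      using cochain_trunc_cochain[OF A(4) db0] by simp
    moreover have "trunc_cochain ds (t - d) b0 l = b0 l" for l
      by (simp add: b0_def trunc_cochain_def tr_idem)
    ultimately obtain b' where b': "cochain A ?n (j - 1) b'" "cochain U ?n j (\<lambda>l. b0 l - koszul_d ys b' l)"
      using less.hyps[of "t - d" b0] d(1) False by auto
    have "cochain U ?n j (trunc_cochain ds t (\<lambda>l. c l - (y * ?b0 l - koszul_d ys ?b1 l)))"
      by (rule cochain_trunc_cochain[OF A(4) cb])
    moreover have "trunc_cochain ds t (\<lambda>l. c l - (y * ?b0 l - koszul_d ys ?b1 l)) l = c l - (y * b0 l - koszul_d ys b1 l)"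
      if "l \<in> kwords ?n j" for l
    proof -
      have "trunc_cochain ds t (\<lambda>l. c l - (y * ?b0 l - koszul_d ys ?b1 l)) l
        = trunc_cochain ds t c l - (tr (t + word_weight ds l) (y * ?b0 l) - trunc_cochain ds t (koszul_d ys ?b1) l)"
        by (simp add: trunc_cochain_def tr_diff)
      also have "trunc_cochain ds t c l = c l" by (rule less.prems(3)[OF that])
      also have "tr (t + word_weight ds l) (y * ?b0 l) = y * b0 l"
        by (simp add: d(2) b0_def trunc_cochain_def algebra_simps)
      also have "trunc_cochain ds t (koszul_d ys ?b1) l = koszul_d ys b1 l"
        by (simp add: b1_def koszul_d_trunc_cochain[OF hom(1)])
      finally show ?thesis .
    qed
    ultimately have "cochain U ?n j (\<lambda>l. c l - (y * b0 l - koszul_d ys b1 l))"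
      by (simp add: cochain_def)
    from cochain_add[OF A(2) this cochain_smult[OF A(2) C(2) b'(2)]]
    have "cochain U ?n j (\<lambda>l. c l - koszul_d ys (\<lambda>l. y * b' l - b1 l) l)"
      by (simp add: koszul_d_diff koszul_d_smult algebra_simps)
    moreover have "cochain A ?n (j - 1) (\<lambda>l. y * b' l - b1 l)"
      by (rule cochain_diff[OF A(1) cochain_smult[OF A(1) C(2) b'(1)]])
        (simp add: b1_def cochain_trunc_cochain[OF A(3) b01(2)])
    ultimately show ?thesis by blast
  qed
qed

text \<open>Vanishing in degree \<open>j + 1\<close> for \<open>y # ys\<close> makes
  \<open>y\<close> surjective on degree \<open>j\<close> for \<open>ys\<close>; as \<open>y\<close>
  has positive degree, only the zero module allows this.\<close>

lemma koszul_exact_Cons_graded: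
  assumes "submod C A" "submod C U" "graded A" "graded U" "set ys \<subseteq> C" "y \<in> C"
    and "list_all2 homog ds ys" "homog d y" and "koszul_exact (y # ys) A U (j + 1)"
  shows "koszul_exact ys A U j"
proof (rule vanI)
  fix c assume c: "cochain A (length ys) j c" "cochain U (length ys) (j + 1) (koszul_d ys c)"
  have "\<forall>l. \<exists>t0. \<forall>t\<ge>t0. tr t (c l) = c l"
    by (simp add: tr_eventually)
  then obtain t0 where t0: "\<forall>l. \<forall>t\<ge>t0 l. tr t (c l) = c l"
    by (rule choice[THEN exE])
  \<comment> \<open>There are finitely many words of degree \<open>j\<close>, so one cut-off leaves
    all relevant values of \<open>c\<close> unchanged.\<close>
  define t where "t = Max (insert 0 ((\<lambda>l. t0 l - word_weight ds l) ` kwords (length ys) j))"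
  have "trunc_cochain ds t c l = c l" if "l \<in> kwords (length ys) j" for l
  proof -
    have "t0 l - word_weight ds l \<le> t" unfolding t_def using that finite_kwords by (intro Max_ge) auto
    then show ?thesis unfolding trunc_cochain_def by (intro t0[rule_format]) linarith
  qed
  then show "\<exists>b. cochain A (length ys) (j - 1) b \<and> cochain U (length ys) j (\<lambda>l. c l - koszul_d ys b l)"
    using koszul_exact_Cons_truncated[OF assms c] by blast
qed

lemma nakayama_list_span:
  assumes "graded U" "graded A" "submod C U" "set xs \<subseteq> C" "list_all2 homog ds xs" "s \<in> list_span xs A"
    and "\<And>a t'. a \<in> A \<Longrightarrow> t' < t \<Longrightarrow> tr t' a \<in> U"
  shows "tr t s \<in> U"
  using assms(5,4,6)
proof (induction ds xs arbitrary: s rule: list_all2_induct)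
  case Nil
  then show ?case by (simp add: tr_zero submod_zero[OF assms(3)])
next
  case (Cons d ds x xs)
  then obtain a s' where s: "a \<in> A" "s' \<in> list_span xs A" "s = x * a + s'" by auto
  have "tr t s = x * tr (t - d) a + tr t s'"
    using Cons.hyps(1) s by (simp add: tr_add homog_def)
  moreover have "tr (t - d) a \<in> U"
    using Cons.hyps(1) by (intro assms(7) s) (simp add: homog_def)
  ultimately show ?case
    using Cons s by (auto intro!: submod_add[OF assms(3)] submod_mult[OF assms(3)])
qed

text \<open>In a decomposition of \<open>a\<close> along U + (xs) A, the part up to degree
  \<open>t\<close> needs coefficients only in degrees below \<open>t\<close>, because the generators
  have positive degree. The induction on \<open>t\<close> starts at negative degrees, where all is
  zero.\<close>

lemma nakayama:
  assumes "graded U" "graded A" "submod C A" "submod C U" "set xs \<subseteq> C" "list_all2 homog ds xs"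
    and "A \<subseteq> U \<boxplus> list_span xs A"
  shows "A \<subseteq> U"
proof -
  have *: "tr t a \<in> U" if "a \<in> A" for t a
    using that
  proof (induction "nat (1 + t)" arbitrary: t a rule: less_induct)
    case less
    show ?case
    proof (cases "t < 0")
      case True
      then show ?thesis by (simp add: tr_neg submod_zero[OF assms(4)])
    next
      case False
      obtain u s where us: "u \<in> U" "s \<in> list_span xs A" "a = u + s"
        using assms(7) less.prems by (auto simp: plus_set_def)
      have "tr t s \<in> U"
        by (rule nakayama_list_span[OF assms(1,2,4,5,6) us(2)])
          (use False less.hyps in auto)
      then show ?thesis
        using us assms(1) by (auto simp: tr_add graded_def intro: submod_add[OF assms(4)])
    qed
  qed
  show ?thesis
  proof
    fix a assume "a \<in> A"
    moreover obtain t where "tr t a = a" using tr_eventually[of a] by auto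
    ultimately show "a \<in> U" using * by metis
  qed
qed

text \<open>Removing the head of the list costs one degree, so for every suffix all degrees below
  its length vanish. For \<open>y # ys\<close> the degree just below the top is the regularity of
  \<open>y\<close> modulo \<open>ys\<close>. The list is thus a regular sequence when read from the
  right.\<close>

lemma koszul_exact_imp_regular:
  assumes "submod C A" "submod C U" "graded A" "graded U" "set xs \<subseteq> C" "list_all2 homog ds xs"
    and "\<And>j. j < int (length xs) \<Longrightarrow> koszul_exact xs A U j"
    and "xs = zs @ y # ys" "a \<in> A" "y * a \<in> U \<boxplus> list_span ys A"
  shows "a \<in> U \<boxplus> list_span ys A"
  using assms(5-8)
proof (induction zs arbitrary: xs ds)
  case Nil
  then have "koszul_exact (y # ys) A U (int (length ys))" by simp
  then show ?case by (rule koszul_exact_Cons_top_regular[OF assms(1,2) _ assms(9,10)])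
next
  case (Cons z zs)
  obtain e es where ds: "ds = e # es" "homog e z" "list_all2 homog es (zs @ y # ys)"
    using Cons.prems unfolding Cons.prems(4) append_Cons list_all2_Cons2 by blast
  have "koszul_exact (zs @ y # ys) A U j" if "j < int (length (zs @ y # ys))" for j
    using Cons.prems(1,4) Cons.prems(3)[of "j + 1"] that
    by (intro koszul_exact_Cons_graded[OF assms(1-4) _ _ ds(3,2)]) simp_all
  then show ?case
    using Cons.prems(1,4) ds(3) by (intro Cons.IH[of "zs @ y # ys" es]) simp_all
qed

end

section \<open>Monomial ideals and elementary symmetric polynomials\<close>

abbreviation supp :: "('a \<Rightarrow>\<^sub>0 'b::zero) \<Rightarrow> 'a set" where "supp \<equiv> Poly_Mapping.keys"
abbreviation coef :: "('a \<Rightarrow>\<^sub>0 'b::zero) \<Rightarrow> 'a \<Rightarrow> 'b" where "coef \<equiv> Poly_Mapping.lookup"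
abbreviation psingle :: "'a \<Rightarrow> 'b \<Rightarrow> 'a \<Rightarrow>\<^sub>0 'b::zero" where "psingle \<equiv> Poly_Mapping.single"

lemma poly_mapping_sum_single: "p = (\<Sum>m\<in>supp p. psingle m (coef p m))"
  by (rule poly_mapping_eqI)
    (auto simp: lookup_sum lookup_single when_def not_in_keys_iff_lookup_eq_zero)

lemma poly_mapping_closure:
  fixes Y :: "('a \<Rightarrow>\<^sub>0 'b::comm_monoid_add) set"
  assumes "0 \<in> Y" "\<And>p q. p \<in> Y \<Longrightarrow> q \<in> Y \<Longrightarrow> p + q \<in> Y"
    and "\<And>m. m \<in> supp p \<Longrightarrow> psingle m (coef p m) \<in> Y"
  shows "p \<in> Y"
proof -
  have "(\<Sum>m\<in>M. psingle m (coef p m)) \<in> Y" if "M \<subseteq> supp p" "finite M" for M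
    using that(2,1) by (induction M) (use assms in auto)
  from this[of "supp p"] show ?thesis by (simp flip: poly_mapping_sum_single)
qed

lemma lookup_single_mult_add:
  fixes m :: "'v \<Rightarrow>\<^sub>0 nat" and p :: "('v \<Rightarrow>\<^sub>0 nat) \<Rightarrow>\<^sub>0 'k::field"
  shows "coef (psingle m c * p) (m + m') = c * coef p m'"
proof -
  have "p \<in> {p. coef (psingle m c * p) (m + m') = c * coef p m'}"
    by (rule poly_mapping_closure)
      (simp_all add: distrib_left lookup_add mult_single lookup_single when_def)
  then show ?thesis by simp
qed

lemma supp_single_mult: "supp (psingle m c * p) \<subseteq> (+) m ` supp p"
  using keys_mult[of "psingle m c" p] by (auto split: if_splits)

lemma supp_single_mult_eq:
  fixes m :: "'v \<Rightarrow>\<^sub>0 nat" and p :: "('v \<Rightarrow>\<^sub>0 nat) \<Rightarrow>\<^sub>0 'k::field"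
  shows "supp (psingle m 1 * p) = (+) m ` supp p"
  using supp_single_mult[of m 1 p] by (auto simp: in_keys_iff lookup_single_mult_add)

lemma keys_add_nat: "supp (m + m') = supp m \<union> supp m'" for m m' :: "'v \<Rightarrow>\<^sub>0 nat"
  by (auto simp: in_keys_iff lookup_add)

definition monomial_span :: "('v \<Rightarrow>\<^sub>0 nat) set \<Rightarrow> (('v \<Rightarrow>\<^sub>0 nat) \<Rightarrow>\<^sub>0 'k::field) set" where
  "monomial_span S = {p. supp p \<subseteq> S}"

lemma monomial_span_zero: "0 \<in> monomial_span S" and monomial_span_add: "p \<in> monomial_span S \<Longrightarrow> q \<in> monomial_span S \<Longrightarrow> p + q \<in> monomial_span S"
  and monomial_span_diff: "p \<in> monomial_span S \<Longrightarrow> q \<in> monomial_span S \<Longrightarrow> p - q \<in> monomial_span S"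
  and monomial_span_single: "m \<in> S \<Longrightarrow> psingle m c \<in> monomial_span S"
  using keys_add[of p q] keys_diff[of p q] by (auto simp: monomial_span_def)

lemma monomial_span_mult: "p \<in> monomial_span S \<Longrightarrow> q \<in> monomial_span T \<Longrightarrow> (\<And>m m'. m \<in> S \<Longrightarrow> m' \<in> T \<Longrightarrow> m + m' \<in> W) \<Longrightarrow> p * q \<in> monomial_span W"
  using keys_mult[of p q] by (fastforce simp: monomial_span_def)

lemma monomial_span_mono: "S \<subseteq> T \<Longrightarrow> monomial_span S \<subseteq> monomial_span T"
  by (auto simp: monomial_span_def)

lemma monomial_span_Int: "monomial_span S \<inter> monomial_span T = monomial_span (S \<inter> T)"
  by (auto simp: monomial_span_def)

lemma monomial_span_least:
  fixes Y :: "(('v \<Rightarrow>\<^sub>0 nat) \<Rightarrow>\<^sub>0 'k::field) set"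
  assumes "0 \<in> Y" "\<And>p q. p \<in> Y \<Longrightarrow> q \<in> Y \<Longrightarrow> p + q \<in> Y" "\<And>m c. m \<in> S \<Longrightarrow> psingle m c \<in> Y"
  shows "monomial_span S \<subseteq> Y"
proof
  fix p :: "('v \<Rightarrow>\<^sub>0 nat) \<Rightarrow>\<^sub>0 'k" assume "p \<in> monomial_span S"
  then have "\<And>m. m \<in> supp p \<Longrightarrow> psingle m (coef p m) \<in> Y"
    using assms(3) by (auto simp: monomial_span_def)
  from poly_mapping_closure[OF assms(1,2) this] show "p \<in> Y" by simp
qed

lemma submod_monomial_span:
  assumes "\<And>w m. w \<in> T \<Longrightarrow> m \<in> S \<Longrightarrow> w + m \<in> S"
  shows "submod (monomial_span T) (monomial_span S)"
  by (rule submodI) (auto intro: monomial_span_zero monomial_span_diff monomial_span_mult[of _ T _ S] assms)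

lemma monomial_span_plus: "monomial_span S \<boxplus> monomial_span T = monomial_span (S \<union> T)"
proof
  show "monomial_span S \<boxplus> monomial_span T \<subseteq> monomial_span (S \<union> T)"
    unfolding plus_set_def using monomial_span_mono[of S "S \<union> T"] monomial_span_mono[of T "S \<union> T"] by (auto intro: monomial_span_add)
  \<comment> \<open>With no scalars \<open>submod\<close> describes additive subgroups, which is
    what \<open>monomial_span_least\<close> asks for.\<close>
  have sub: "submod {} (monomial_span S \<boxplus> monomial_span T)"
    by (intro submod_plus submodI) (auto intro: monomial_span_zero monomial_span_diff)
  show "monomial_span (S \<union> T) \<subseteq> monomial_span S \<boxplus> monomial_span T"
  proof (rule monomial_span_least)
    fix m c assume "m \<in> S \<union> T"
    then show "psingle m c \<in> monomial_span S \<boxplus> monomial_span T"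
      using plus_setI[of "psingle m c" "monomial_span S" 0 "monomial_span T"] plus_setI[of 0 "monomial_span S" "psingle m c" "monomial_span T"]
      by (auto intro: monomial_span_single monomial_span_zero)
  qed (auto intro: submod_zero[OF sub] submod_add[OF sub])
qed

lemma monomial_span_scaled: "(*) (psingle m 1) ` monomial_span S = (monomial_span ((+) m ` S) :: (('v \<Rightarrow>\<^sub>0 nat) \<Rightarrow>\<^sub>0 'k::field) set)"
proof
  show "(*) (psingle m 1) ` monomial_span S \<subseteq> (monomial_span ((+) m ` S) :: (('v \<Rightarrow>\<^sub>0 nat) \<Rightarrow>\<^sub>0 'k) set)"
    using supp_single_mult[of m 1] by (fastforce simp: monomial_span_def)
  have sub: "submod {} ((*) (psingle m 1) ` (monomial_span S :: (('v \<Rightarrow>\<^sub>0 nat) \<Rightarrow>\<^sub>0 'k) set))"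
    by (intro submod_scaled submodI) (auto intro: monomial_span_zero monomial_span_diff)
  show "monomial_span ((+) m ` S) \<subseteq> (*) (psingle m 1) ` (monomial_span S :: (('v \<Rightarrow>\<^sub>0 nat) \<Rightarrow>\<^sub>0 'k) set)"
  proof (rule monomial_span_least)
    fix w :: "'v \<Rightarrow>\<^sub>0 nat" and c :: 'k assume "w \<in> (+) m ` S"
    then obtain w' where "w' \<in> S" "w = m + w'" by auto
    then show "psingle w c \<in> (*) (psingle m 1) ` monomial_span S"
      by (intro image_eqI[of _ _ "psingle w' c"]) (auto simp: mult_single intro: monomial_span_single)
  qed (auto intro: submod_zero[OF sub] submod_add[OF sub])
qed

definition polys :: "'v set \<Rightarrow> (('v \<Rightarrow>\<^sub>0 nat) \<Rightarrow>\<^sub>0 'k::field) set" where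
  "polys V = monomial_span {m. supp m \<subseteq> V}"

definition nonface_ideal :: "'v set \<Rightarrow> 'v set set \<Rightarrow> (('v \<Rightarrow>\<^sub>0 nat) \<Rightarrow>\<^sub>0 'k::field) set" where
  "nonface_ideal V \<Gamma> = monomial_span {m. supp m \<subseteq> V \<and> supp m \<notin> \<Gamma>}"

definition down_closed :: "'v set set \<Rightarrow> bool" where
  "down_closed \<Gamma> \<longleftrightarrow> (\<forall>F\<in>\<Gamma>. \<forall>G. G \<subseteq> F \<longrightarrow> G \<in> \<Gamma>)"

lemma down_closedD: "down_closed \<Gamma> \<Longrightarrow> F \<in> \<Gamma> \<Longrightarrow> G \<subseteq> F \<Longrightarrow> G \<in> \<Gamma>"
  by (auto simp: down_closed_def)

lemma submod_polys: "submod (polys V) (polys V)"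
  unfolding polys_def by (rule submod_monomial_span) (auto simp: keys_add_nat)

lemma one_polys: "1 \<in> polys V"
  by (auto simp: polys_def monomial_span_def)

lemma submod_nonface_ideal: "down_closed \<Gamma> \<Longrightarrow> submod (polys V) (nonface_ideal V \<Gamma>)"
  unfolding polys_def nonface_ideal_def by (rule submod_monomial_span) (auto simp: keys_add_nat dest: down_closedD)

lemma nonface_ideal_empty: "nonface_ideal V {} = polys V"
  by (simp add: nonface_ideal_def polys_def)

lemma nonface_ideal_antimono: "\<Gamma> \<subseteq> \<Gamma>' \<Longrightarrow> nonface_ideal V \<Gamma>' \<subseteq> nonface_ideal V \<Gamma>"
  unfolding nonface_ideal_def by (rule monomial_span_mono) auto

lemma nonface_ideal_subset_polys: "nonface_ideal V \<Gamma> \<subseteq> polys V"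
  unfolding nonface_ideal_def polys_def by (rule monomial_span_mono) auto

section \<open>The grading by total degree\<close>

definition mdeg :: "('v \<Rightarrow>\<^sub>0 nat) \<Rightarrow> nat" where
  "mdeg m = (\<Sum>x\<in>supp m. coef m x)"

lemma mdeg_add: "mdeg (m + m') = mdeg m + mdeg m'"
  unfolding mdeg_def by (rule setsum_keys_plus_distrib) auto

definition ptrunc :: "int \<Rightarrow> (('v \<Rightarrow>\<^sub>0 nat) \<Rightarrow>\<^sub>0 'k::field) \<Rightarrow> (('v \<Rightarrow>\<^sub>0 nat) \<Rightarrow>\<^sub>0 'k)" where
  "ptrunc t p = Poly_Mapping.mapp (\<lambda>m c. if int (mdeg m) \<le> t then c else 0) p"

lemma lookup_ptrunc: "coef (ptrunc t p) m = (if int (mdeg m) \<le> t then coef p m else 0)"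
  by (auto simp: ptrunc_def lookup_mapp when_def not_in_keys_iff_lookup_eq_zero)

interpretation ptrunc: truncation "ptrunc :: int \<Rightarrow> (('v \<Rightarrow>\<^sub>0 nat) \<Rightarrow>\<^sub>0 'k::field) \<Rightarrow> _"
proof
  fix t :: int and a b :: "('v \<Rightarrow>\<^sub>0 nat) \<Rightarrow>\<^sub>0 'k"
  show "ptrunc t (a - b) = ptrunc t a - ptrunc t b" "ptrunc t (ptrunc t a) = ptrunc t a"
    by (auto intro!: poly_mapping_eqI simp: lookup_ptrunc lookup_minus)
  show "t < 0 \<Longrightarrow> ptrunc t a = 0"
    by (auto intro!: poly_mapping_eqI simp: lookup_ptrunc)
  have "ptrunc t a = a" if "t \<ge> int (Max (insert 0 (mdeg ` supp a)))" for t
  proof (rule poly_mapping_eqI)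
    fix m
    show "coef (ptrunc t a) m = coef a m"
    proof (cases "m \<in> supp a")
      case True
      then have "mdeg m \<le> Max (insert 0 (mdeg ` supp a))" by (intro Max_ge) auto
      then show ?thesis using that by (simp add: lookup_ptrunc)
    qed (simp add: lookup_ptrunc not_in_keys_iff_lookup_eq_zero)
  qed
  then show "\<exists>t0. \<forall>t\<ge>t0. ptrunc t a = a" by blast
qed

lemma graded_monomial_span: "ptrunc.graded (monomial_span S)"
  by (auto simp: ptrunc.graded_def monomial_span_def ptrunc_def dest: keys_mapp_subset[THEN subsetD])

lemma homog_single:
  fixes m :: "'v \<Rightarrow>\<^sub>0 nat"
  assumes "0 < mdeg m"
  shows "ptrunc.homog (int (mdeg m)) (psingle m (1 :: 'k::field))"
  unfolding ptrunc.homog_def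
proof (intro conjI allI)
  fix t and a :: "('v \<Rightarrow>\<^sub>0 nat) \<Rightarrow>\<^sub>0 'k"
  have "a \<in> {a. ptrunc t (psingle m 1 * a) = psingle m 1 * ptrunc (t - int (mdeg m)) a}"
  proof (rule poly_mapping_closure)
    have single: "ptrunc s (psingle w c) = (if int (mdeg w) \<le> s then psingle w c else 0)" for s w and c :: 'k
      by (auto intro!: poly_mapping_eqI simp: lookup_ptrunc lookup_single when_def)
    show "psingle w (coef a w) \<in> {a. ptrunc t (psingle m 1 * a) = psingle m 1 * ptrunc (t - int (mdeg m)) a}" for w
      by (auto simp: mult_single single mdeg_add)
  qed (auto simp: ptrunc.tr_zero ptrunc.tr_add distrib_left)
  then show "ptrunc t (psingle m 1 * a) = psingle m 1 * ptrunc (t - int (mdeg m)) a" by simp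
qed (use assms in simp)

lemma homog_sum:
  assumes "0 < d" "finite I" "\<And>i. i \<in> I \<Longrightarrow> ptrunc.homog d (f i)"
  shows "ptrunc.homog d (sum f I)"
  using assms(2,3)
proof (induction I)
  case (insert i I)
  then show ?case by (auto simp: ptrunc.homog_def distrib_right ptrunc.tr_add)
qed (simp add: ptrunc.homog_def ptrunc.tr_zero assms(1))

section \<open>Elementary symmetric polynomials\<close>

definition indic :: "'v set \<Rightarrow> 'v \<Rightarrow>\<^sub>0 nat" where
  "indic Y = (\<Sum>x\<in>Y. psingle x 1)"

lemma lookup_indic: "finite Y \<Longrightarrow> coef (indic Y) x = (if x \<in> Y then 1 else 0)"
  by (simp add: indic_def lookup_sum lookup_single when_def)

lemma supp_indic: "finite Y \<Longrightarrow> supp (indic Y) = Y"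
  by (rule Set.set_eqI) (simp only: in_keys_iff lookup_indic, simp)

lemma mdeg_indic: "finite Y \<Longrightarrow> mdeg (indic Y) = card Y"
  by (simp add: mdeg_def supp_indic lookup_indic)

lemma prod_pvar: "finite Y \<Longrightarrow> (\<Prod>x\<in>Y. pvar x) = psingle (indic Y) (1::'k::field)"
  by (induction Y rule: finite_induct) (simp_all add: indic_def pvar_def mult_single)

definition esym :: "'v set \<Rightarrow> nat \<Rightarrow> (('v \<Rightarrow>\<^sub>0 nat) \<Rightarrow>\<^sub>0 'k::field)" where
  "esym V j = (\<Sum>Y | Y \<subseteq> V \<and> card Y = j. psingle (indic Y) 1)"

text \<open>The order is e_k, ..., e_1: those of large index form a prefix that can be removed, and
  reading from the right gives the regular sequence e_1, ..., e_k. The index starts at 1, since e_0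
  is the unit 1.\<close>

definition esyms :: "'v set \<Rightarrow> nat \<Rightarrow> (('v \<Rightarrow>\<^sub>0 nat) \<Rightarrow>\<^sub>0 'k::field) list" where
  "esyms V k = rev (map (esym V) [1..<k + 1])"

lemma length_esyms [simp]: "length (esyms V k) = k"
  by (simp add: esyms_def)

lemma set_esyms: "set (esyms V k) = esym V ` {1..k}"
  by (auto simp: esyms_def)

lemma esym_polys: "finite V \<Longrightarrow> esym V j \<in> polys V"
  unfolding esym_def
  by (intro submod_sum[OF submod_polys])
    (auto simp: polys_def supp_indic[OF finite_subset] intro!: monomial_span_single)

lemma set_esyms_polys: "finite V \<Longrightarrow> set (esyms V k) \<subseteq> polys V"
  by (auto simp: set_esyms esym_polys)

lemma homog_esym: "finite V \<Longrightarrow> 0 < j \<Longrightarrow> ptrunc.homog (int j) (esym V j)"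
  unfolding esym_def
proof (intro homog_sum)
  fix Y assume "finite V" "0 < j" "Y \<in> {Y. Y \<subseteq> V \<and> card Y = j}"
  then show "ptrunc.homog (int j) (psingle (indic Y) 1)"
    using homog_single[of "indic Y"] by (auto simp: mdeg_indic dest: finite_subset)
qed auto

lemma homog_esyms: "finite V \<Longrightarrow> \<exists>ds. list_all2 ptrunc.homog ds (esyms V k)"
  by (intro exI[of _ "rev (map int [1..<k + 1])"])
    (auto simp: esyms_def list_all2_rev list_all2_map1 list_all2_map2 list_all2_same homog_esym)

text \<open>The variable is a root of the product of \<open>T - u\<close> over all variables
  \<open>u\<close>, a monic polynomial in \<open>T\<close> whose lower coefficients are the e_j up
  to sign.\<close>

lemma pvar_power_esyms:
  assumes "finite V" "v \<in> V"
  shows "(pvar v :: ('v \<Rightarrow>\<^sub>0 nat) \<Rightarrow>\<^sub>0 'k::field) ^ card V \<in> list_span (esyms V (card V)) (polys V)"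
proof -
  let ?n = "card V" and ?x = "pvar v :: ('v \<Rightarrow>\<^sub>0 nat) \<Rightarrow>\<^sub>0 'k"
  have sub: "submod (polys V) (list_span (esyms V ?n) (polys V :: (('v \<Rightarrow>\<^sub>0 nat) \<Rightarrow>\<^sub>0 'k) set))"
    by (rule submod_list_span[OF submod_polys])
  have x: "?x \<in> polys V" using assms by (auto simp: pvar_def polys_def intro!: monomial_span_single)
  have pow: "?x ^ r \<in> polys V" for r
    by (induction r) (auto intro: one_polys submod_mult[OF submod_polys x])
  have expand: "(\<Prod>u\<in>Y. - pvar u) * (\<Prod>u\<in>V - Y. ?x) = (-1) ^ card Y * ?x ^ (?n - card Y) * psingle (indic Y) 1"
    if "Y \<subseteq> V" for Y
  proof -
    have "(\<Prod>u\<in>Y. - pvar u) = (-1) ^ card Y * (\<Prod>u\<in>Y. pvar u :: ('v \<Rightarrow>\<^sub>0 nat) \<Rightarrow>\<^sub>0 'k)"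
      using prod.distrib[of "\<lambda>_. -1" "\<lambda>u. pvar u :: ('v \<Rightarrow>\<^sub>0 nat) \<Rightarrow>\<^sub>0 'k" Y] by simp
    then show ?thesis
      using that assms(1) by (simp add: prod_pvar finite_subset card_Diff_subset)
  qed
  have "0 = (\<Prod>u\<in>V. - pvar u + ?x)"
    using assms by (intro prod_zero[symmetric]) (auto intro!: bexI[of _ v])
  also have "\<dots> = (\<Sum>Y\<in>Pow V. (\<Prod>u\<in>Y. - pvar u) * (\<Prod>u\<in>V - Y. ?x))"
    using assms(1) by (rule prod_add)
  also have "\<dots> = (\<Sum>Y\<in>Pow V. (-1) ^ card Y * ?x ^ (?n - card Y) * psingle (indic Y) 1)"
    by (intro sum.cong refl expand) auto
  also have "\<dots> = (\<Sum>j\<in>{0..?n}. \<Sum>Y | Y \<in> Pow V \<and> card Y = j. (-1) ^ card Y * ?x ^ (?n - card Y) * psingle (indic Y) 1)"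
    using assms(1) by (intro sum.group[symmetric]) (auto intro: card_mono)
  also have "\<dots> = (\<Sum>j\<in>{0..?n}. (-1) ^ j * ?x ^ (?n - j) * esym V j)"
    by (intro sum.cong refl) (simp add: esym_def sum_distrib_left)
  also have "\<dots> = ?x ^ ?n * esym V 0 + (\<Sum>j\<in>{1..?n}. (-1) ^ j * ?x ^ (?n - j) * esym V j)"
    by (subst sum.atLeast_Suc_atMost) auto
  also have "esym V 0 = (1 :: ('v \<Rightarrow>\<^sub>0 nat) \<Rightarrow>\<^sub>0 'k)"
  proof -
    have "{Y. Y \<subseteq> V \<and> card Y = 0} = {{}}" using assms(1) by (auto dest: finite_subset)
    then show ?thesis by (simp add: esym_def indic_def)
  qed
  finally have "?x ^ ?n = - (\<Sum>j\<in>{1..?n}. (-1) ^ j * ?x ^ (?n - j) * esym V j)"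
    by (simp add: eq_neg_iff_add_eq_0)
  moreover have "(-1) ^ j * ?x ^ (?n - j) * esym V j \<in> list_span (esyms V ?n) (polys V)" if "j \<in> {1..?n}" for j
  proof -
    have "esym V j * ?x ^ (?n - j) \<in> list_span (esyms V ?n) (polys V)"
      using that by (intro list_span_mem[OF submod_polys] pow) (auto simp: set_esyms)
    then show ?thesis
      using submod_uminus[OF sub] by (cases "even j") (auto simp: mult.commute)
  qed
  ultimately show ?thesis
    by (auto intro!: submod_uminus[OF sub] submod_sum[OF sub])
qed

section \<open>Depth of quotients of monomial ideals\<close>

definition depth_ge :: "'v set \<Rightarrow> int \<Rightarrow> (('v \<Rightarrow>\<^sub>0 nat) \<Rightarrow>\<^sub>0 'k::field) set \<Rightarrow> (('v \<Rightarrow>\<^sub>0 nat) \<Rightarrow>\<^sub>0 'k) set \<Rightarrow> bool" where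
  "depth_ge V k A U \<longleftrightarrow> (\<forall>j<k. koszul_exact (esyms V (card V)) A U j)"

text \<open>The sequence consists of combinations of the variables, so vanishing is first obtained
  for the variables followed by the e_j. The variables are then removed, being nilpotent modulo the
  e_j.\<close>

lemma regseq_depth_ge:
  assumes "finite V" "submod (polys V) A" "submod (polys V) U" "set vs = V"
    and "set fs \<subseteq> list_span (map pvar vs) (polys V)" "regseq A U fs"
  shows "depth_ge V (int (length fs)) A U"
  unfolding depth_ge_def
proof (intro allI impI)
  fix j assume j: "j < int (length fs)"
  let ?xs = "map pvar vs" and ?es = "esyms V (card V)"
  have vars: "set ?xs \<subseteq> polys V"
    using assms(4) by (auto simp: pvar_def polys_def intro!: monomial_span_single)
  have es: "set ?es \<subseteq> polys V" by (rule set_esyms_polys[OF assms(1)])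
  have "list_span ?xs (polys V) \<subseteq> list_span (?xs @ ?es) (polys V)"
    unfolding list_span_append by (rule plus_set_left[OF submod_list_span[OF submod_polys]])
  then have "koszul_exact (?xs @ ?es) A U j"
    using assms vars es j by (intro koszul_exact_regseq[of "polys V" A U _ fs]) auto
  moreover have "\<exists>r f w. y ^ r = f + w \<and> f \<in> list_span ?es (polys V) \<and> (\<forall>a\<in>A. w * a \<in> U)"
    if "y \<in> set ?xs" for y
  proof -
    from that obtain v where "y = pvar v" "v \<in> V" using assms(4) by auto
    then show "\<exists>r f w. y ^ r = f + w \<and> f \<in> list_span ?es (polys V) \<and> (\<forall>a\<in>A. w * a \<in> U)"
      using pvar_power_esyms[OF assms(1)] submod_zero[OF assms(3)]
      by (intro exI[of _ "card V"] exI[of _ "y ^ card V"] exI[of _ 0]) auto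
  qed
  ultimately show "koszul_exact ?es A U j"
    using koszul_exact_remove_prefix[OF assms(2,3) es vars _ submod_polys] by blast
qed

lemma depth_ge_esyms:
  fixes A U :: "(('v \<Rightarrow>\<^sub>0 nat) \<Rightarrow>\<^sub>0 'k::field) set"
  assumes "finite V" "submod (polys V) A" "submod (polys V) U" "k \<le> card V"
    and "\<And>j a. k < j \<Longrightarrow> j \<le> card V \<Longrightarrow> a \<in> A \<Longrightarrow> esym V j * a \<in> U"
    and "depth_ge V i A U" "j < i"
  shows "koszul_exact (esyms V k) A U j"
proof -
  have "[1..<card V + 1] = [1..<k + 1] @ [k + 1..<card V + 1]"
    using upt_add_eq_append[of 1 "k + 1" "card V - k"] assms(4) by simp
  then have split: "esyms V (card V) = rev (map (esym V) [k + 1..<card V + 1]) @ esyms V k"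
    by (simp add: esyms_def)
  let ?ys = "rev (map (esym V) [k + 1..<card V + 1]) :: (('v \<Rightarrow>\<^sub>0 nat) \<Rightarrow>\<^sub>0 'k) list"
  have "koszul_exact (esyms V (card V)) A U j"
    using assms(6,7) by (simp add: depth_ge_def)
  then have "koszul_exact (?ys @ esyms V k) A U j"
    unfolding split .
  moreover have "set ?ys \<subseteq> polys V"
    by (auto intro: esym_polys[OF assms(1)])
  moreover have "\<exists>r f w. y ^ r = f + w \<and> f \<in> list_span (esyms V k) (polys V) \<and> (\<forall>a\<in>A. w * a \<in> U)"
    if "y \<in> set ?ys" for y
  proof -
    from that have "\<forall>a\<in>A. y * a \<in> U" using assms(5) by auto
    then show ?thesis
      using submod_zero[OF submod_list_span[OF submod_polys]]
      by (intro exI[of _ 1] exI[of _ 0] exI[of _ y]) auto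
  qed
  ultimately show ?thesis
    using koszul_exact_remove_prefix[OF assms(2,3) set_esyms_polys[OF assms(1)] _ _ submod_polys] by blast
qed

text \<open>The support of a term of the product contains a set outside \<open>\<Gamma>'\<close>, so
  it is outside \<open>\<Gamma>'\<close>; it has at least \<open>j\<close> vertices, too many for a
  member of \<open>\<Gamma> - \<Gamma>'\<close>. Hence it is outside
  \<open>\<Gamma>\<close>.\<close>

lemma esym_annihilates:
  assumes "finite V" "down_closed \<Gamma>'" "\<And>F. F \<in> \<Gamma> - \<Gamma>' \<Longrightarrow> card F \<le> k" "k < j" "a \<in> nonface_ideal V \<Gamma>'"
  shows "esym V j * a \<in> (nonface_ideal V \<Gamma> :: (('v \<Rightarrow>\<^sub>0 nat) \<Rightarrow>\<^sub>0 'k::field) set)"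
  unfolding nonface_ideal_def
proof (rule monomial_span_mult)
  show "a \<in> monomial_span {m. supp m \<subseteq> V \<and> supp m \<notin> \<Gamma>'}" using assms(5) by (simp add: nonface_ideal_def)
  have "submod {} (monomial_span {m. supp m \<subseteq> V \<and> card (supp m) = j} :: (('v \<Rightarrow>\<^sub>0 nat) \<Rightarrow>\<^sub>0 'k) set)"
    by (rule submodI) (auto intro: monomial_span_zero monomial_span_diff)
  then show "esym V j \<in> (monomial_span {m. supp m \<subseteq> V \<and> card (supp m) = j} :: (('v \<Rightarrow>\<^sub>0 nat) \<Rightarrow>\<^sub>0 'k) set)"
    unfolding esym_def
    by (rule submod_sum) (auto intro!: monomial_span_single simp: supp_indic[OF finite_subset[OF _ assms(1)]])
  fix m m' :: "'v \<Rightarrow>\<^sub>0 nat"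
  assume m: "m \<in> {m. supp m \<subseteq> V \<and> card (supp m) = j}" "m' \<in> {m. supp m \<subseteq> V \<and> supp m \<notin> \<Gamma>'}"
  have "supp (m + m') \<notin> \<Gamma>'"
    using m down_closedD[OF assms(2), of "supp (m + m')" "supp m'"] by (auto simp: keys_add_nat)
  moreover have "j \<le> card (supp (m + m'))"
    using m assms(1) by (auto simp: keys_add_nat intro!: card_mono)
  ultimately have "supp (m + m') \<notin> \<Gamma>"
    using assms(3)[of "supp (m + m')"] assms(4) by auto
  then show "m + m' \<in> {m. supp m \<subseteq> V \<and> supp m \<notin> \<Gamma>}"
    using m by (auto simp: keys_add_nat)
qed

text \<open>The monomials in question are those with support exactly \<open>F\<close>. They span a
  free module of rank one over the polynomial ring on \<open>F\<close>, generated by the product of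
  the vertices of \<open>F\<close>, on which these variables form a regular sequence.\<close>

lemma face_depth:
  assumes "finite V" "F \<subseteq> V" "F \<notin> \<Gamma>" "down_closed \<Gamma>" "down_closed (insert F \<Gamma>)"
  shows "depth_ge V (int (card F)) (nonface_ideal V \<Gamma>) (nonface_ideal V (insert F \<Gamma>) :: (('v \<Rightarrow>\<^sub>0 nat) \<Rightarrow>\<^sub>0 'k::field) set)"
proof -
  \<comment> \<open>\<open>Q W\<close> holds the exponents of the submodule obtained from the
    denominator by adding \<open>pvar w\<close> times the numerator for all \<open>w\<close> in
    \<open>W\<close>. A monomial with support \<open>F\<close> is such a multiple if some
    \<open>w\<close> occurs at least twice: once for the generator, once for the factor.\<close>
  define Q :: "'v set \<Rightarrow> ('v \<Rightarrow>\<^sub>0 nat) set" where "Q W = {m. supp m \<subseteq> V \<and> supp m \<notin> \<Gamma> \<and> (supp m = F \<longrightarrow> (\<exists>w\<in>W. 2 \<le> coef m w))}" for W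
  let ?A = "nonface_ideal V \<Gamma> :: (('v \<Rightarrow>\<^sub>0 nat) \<Rightarrow>\<^sub>0 'k) set"
  have sub: "G \<in> \<Gamma>" if "G \<subset> F" for G
    using that down_closedD[OF assms(5), of F G] by auto
  have step: "monomial_span (Q W) \<boxplus> (*) (pvar v) ` ?A = monomial_span (Q (insert v W))" if "v \<in> F" for v W
  proof -
    have "Q W \<union> (+) (psingle v 1) ` {m. supp m \<subseteq> V \<and> supp m \<notin> \<Gamma>} = Q (insert v W)"
    proof (intro equalityI subsetI)
      fix m assume "m \<in> Q W \<union> (+) (psingle v 1) ` {m. supp m \<subseteq> V \<and> supp m \<notin> \<Gamma>}"
      then consider "m \<in> Q W" | m' where "m = psingle v 1 + m'" "supp m' \<subseteq> V" "supp m' \<notin> \<Gamma>" by auto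
      then show "m \<in> Q (insert v W)"
      proof cases
        case 1
        then show ?thesis by (auto simp: Q_def)
      next
        case 2
        have s: "supp m = insert v (supp m')" using 2 by (simp add: keys_add_nat)
        have "supp m \<notin> \<Gamma>" using s 2(3) down_closedD[OF assms(4), of "supp m" "supp m'"] by auto
        moreover have "2 \<le> coef m v" if "supp m = F"
        proof -
          \<comment> \<open>Proper subsets of \<open>F\<close> are in \<open>\<Gamma>\<close>, so a
            monomial outside \<open>\<Gamma>\<close> with a multiple of support \<open>F\<close> has
            support \<open>F\<close> already.\<close>
          have "supp m' = F" using that s sub[of "supp m'"] 2(3) by auto
          then have "v \<in> supp m'" using \<open>v \<in> F\<close> by simp
          then show ?thesis using 2(1) by (simp add: lookup_add in_keys_iff)
        qed
        ultimately show ?thesis using 2(2) s \<open>v \<in> F\<close> assms(2) by (auto simp: Q_def)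
      qed
    next
      fix m assume m: "m \<in> Q (insert v W)"
      show "m \<in> Q W \<union> (+) (psingle v 1) ` {m. supp m \<subseteq> V \<and> supp m \<notin> \<Gamma>}"
      proof (cases "m \<in> Q W")
        case False
        then have mv: "supp m = F" "2 \<le> coef m v" using m by (auto simp: Q_def)
        define m' where "m' = m - psingle v 1"
        have "m = psingle v 1 + m'"
          using mv(2) by (auto intro!: poly_mapping_eqI simp: m'_def lookup_add lookup_minus lookup_single when_def)
        moreover have "supp m' = supp m"
          using mv(2) by (auto simp: m'_def in_keys_iff lookup_minus lookup_single when_def)
        ultimately show ?thesis using mv(1) assms(2,3) by auto
      qed simp
    qed
    then show ?thesis by (simp add: nonface_ideal_def pvar_def monomial_span_scaled monomial_span_plus)
  qed
  have reg: "regseq ?A (monomial_span (Q W)) (map pvar vs)" if "distinct vs" "set vs \<subseteq> F" "W \<inter> set vs = {}" for vs W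
    using that
  proof (induction vs arbitrary: W)
    case (Cons v vs)
    have "a \<in> monomial_span (Q W)" if a: "a \<in> ?A" "pvar v * a \<in> monomial_span (Q W)" for a
      unfolding monomial_span_def
    proof (intro CollectI subsetI)
      fix m assume m: "m \<in> supp a"
      then have "m + psingle v 1 \<in> supp (pvar v * a)"
        by (auto simp: pvar_def supp_single_mult_eq add.commute)
      then have mv: "m + psingle v 1 \<in> Q W" using a(2) by (auto simp: monomial_span_def)
      \<comment> \<open>As \<open>v\<close> is not in \<open>W\<close>, multiplication by
        \<open>pvar v\<close> leaves the exponents at \<open>W\<close> unchanged.\<close>
      have "\<exists>w\<in>W. 2 \<le> coef m w" if "supp m = F"
      proof -
        have "supp (m + psingle v 1) = F" using that Cons.prems by (auto simp: keys_add_nat)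
        then obtain w where "w \<in> W" "2 \<le> coef (m + psingle v 1) w" using mv by (auto simp: Q_def)
        then show ?thesis
          using Cons.prems by (auto intro!: bexI[of _ w] simp: lookup_add lookup_single when_def split: if_splits)
      qed
      then show "m \<in> Q W" using m a(1) by (auto simp: Q_def nonface_ideal_def monomial_span_def)
    qed
    moreover have "regseq ?A (monomial_span (Q (insert v W))) (map pvar vs)"
      using Cons.prems by (intro Cons.IH) auto
    ultimately show ?case using step[of v W] Cons.prems by simp
  qed simp
  obtain vs where vs: "set vs = V" "distinct vs" using finite_distinct_list[OF assms(1)] by blast
  obtain fs where fs: "set fs = F" "distinct fs"
    using finite_distinct_list[OF finite_subset[OF assms(2,1)]] by blast
  have "monomial_span (Q {}) = (nonface_ideal V (insert F \<Gamma>) :: (('v \<Rightarrow>\<^sub>0 nat) \<Rightarrow>\<^sub>0 'k) set)"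
    unfolding nonface_ideal_def Q_def by (rule arg_cong[of _ _ monomial_span]) auto
  then have "regseq ?A (nonface_ideal V (insert F \<Gamma>)) (map pvar fs)"
    using reg[of fs "{}"] fs by simp
  moreover have "set (map pvar fs) \<subseteq> list_span (map pvar vs) (polys V :: (('v \<Rightarrow>\<^sub>0 nat) \<Rightarrow>\<^sub>0 'k) set)"
  proof
    fix y :: "('v \<Rightarrow>\<^sub>0 nat) \<Rightarrow>\<^sub>0 'k" assume "y \<in> set (map pvar fs)"
    then have "y * 1 \<in> list_span (map pvar vs) (polys V)"
      using fs vs assms(2) by (intro list_span_mem[OF submod_polys] one_polys) auto
    then show "y \<in> list_span (map pvar vs) (polys V)" by simp
  qed
  ultimately have "depth_ge V (int (length (map pvar fs :: (('v \<Rightarrow>\<^sub>0 nat) \<Rightarrow>\<^sub>0 'k) list))) ?A (nonface_ideal V (insert F \<Gamma>))"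
    by (intro regseq_depth_ge[OF assms(1) submod_nonface_ideal submod_nonface_ideal vs(1)] assms(4,5))
  then show ?thesis using fs distinct_card[of fs] by simp
qed

text \<open>The depth lemma in three forms: a bound for the middle, the left and the right term of
  the sequence B/U, A/U, A/B.\<close>

lemma depth_ge_extension:
  assumes "finite V" "submod (polys V) A" "submod (polys V) B" "submod (polys V) U" "B \<subseteq> A" "U \<subseteq> B"
  shows "depth_ge V k B U \<Longrightarrow> depth_ge V k A B \<Longrightarrow> depth_ge V k A U"
    and "depth_ge V k A U \<Longrightarrow> depth_ge V (k - 1) A B \<Longrightarrow> depth_ge V k B U"
    and "depth_ge V (k + 1) B U \<Longrightarrow> depth_ge V k A U \<Longrightarrow> depth_ge V k A B"
proof -
  note facts = assms(2-) set_esyms_polys[OF assms(1), of "card V"]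
  show "depth_ge V k B U \<Longrightarrow> depth_ge V k A B \<Longrightarrow> depth_ge V k A U"
    using koszul_exact_extension[OF facts] by (simp add: depth_ge_def)
  show "depth_ge V k A U \<Longrightarrow> depth_ge V (k - 1) A B \<Longrightarrow> depth_ge V k B U"
    using koszul_exact_kernel[OF facts] by (simp add: depth_ge_def)
  show "depth_ge V (k + 1) B U \<Longrightarrow> depth_ge V k A U \<Longrightarrow> depth_ge V k A B"
    using koszul_exact_quotient[OF facts] by (simp add: depth_ge_def)
qed

lemma depth_ge_mono: "depth_ge V k A U \<Longrightarrow> i \<le> k \<Longrightarrow> depth_ge V i A U"
  by (auto simp: depth_ge_def)

lemma faces_depth:
  assumes "finite V" "\<Gamma> \<subseteq> Pow V" "down_closed \<Gamma>" "down_closed \<Gamma>'" "\<Gamma>' \<subseteq> \<Gamma>"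
    and "\<And>F. F \<in> \<Gamma> - \<Gamma>' \<Longrightarrow> card F = k"
  shows "depth_ge V (int k) (nonface_ideal V \<Gamma>') (nonface_ideal V \<Gamma> :: (('v \<Rightarrow>\<^sub>0 nat) \<Rightarrow>\<^sub>0 'k::field) set)"
proof -
  have "finite \<Gamma>" using finite_subset[OF assms(2)] assms(1) by simp
  then show ?thesis
    using assms(4-6)
  proof (induction "card (\<Gamma> - \<Gamma>')" arbitrary: \<Gamma>')
    case 0
    then have "\<Gamma> = \<Gamma>'" by auto
    then show ?case
      by (auto simp: depth_ge_def intro!: koszul_exact_trivial[OF submod_nonface_ideal] \<open>down_closed \<Gamma>'\<close>)
  next
    case (Suc n)
    then obtain F where F: "F \<in> \<Gamma>" "F \<notin> \<Gamma>'" by (metis Diff_iff card_eq_0_iff ex_in_conv nat.distinct(1))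
    \<comment> \<open>The faces to be added all have \<open>k\<close> vertices, so a proper subset
      of one of them is already in \<open>\<Gamma>'\<close>. They can be added in any order.\<close>
    have dc: "down_closed (insert F \<Gamma>')"
      unfolding down_closed_def
    proof (intro ballI allI impI)
      fix H G assume H: "H \<in> insert F \<Gamma>'" "G \<subseteq> H"
      show "G \<in> insert F \<Gamma>'"
      proof (cases "H = F \<and> G \<noteq> F")
        case True
        then have "G \<subset> F" "finite F" using H F assms(1,2) by (auto dest: finite_subset)
        then have "card G < card F" by (simp add: psubset_card_mono)
        moreover have "G \<in> \<Gamma>" using down_closedD[OF assms(3) F(1)] \<open>G \<subset> F\<close> by auto
        ultimately show ?thesis using Suc.prems(4)[of F] Suc.prems(4)[of G] F by auto
      next
        case False
        then show ?thesis using H down_closedD[OF Suc.prems(2)] by auto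
      qed
    qed
    have "\<Gamma> - insert F \<Gamma>' = (\<Gamma> - \<Gamma>') - {F}" by auto
    then have "n = card (\<Gamma> - insert F \<Gamma>')" using Suc.hyps(2) Suc.prems(1) F by simp
    then have "depth_ge V (int k) (nonface_ideal V (insert F \<Gamma>')) (nonface_ideal V \<Gamma> :: (('v \<Rightarrow>\<^sub>0 nat) \<Rightarrow>\<^sub>0 'k) set)"
      using Suc.prems F dc by (intro Suc.hyps(1)) auto
    moreover have "depth_ge V (int k) (nonface_ideal V \<Gamma>') (nonface_ideal V (insert F \<Gamma>') :: (('v \<Rightarrow>\<^sub>0 nat) \<Rightarrow>\<^sub>0 'k) set)"
      using face_depth[OF assms(1) _ F(2) Suc.prems(2) dc] F Suc.prems(4)[of F] assms(2) by auto
    moreover have "nonface_ideal V (insert F \<Gamma>') \<subseteq> nonface_ideal V \<Gamma>'" "nonface_ideal V \<Gamma> \<subseteq> nonface_ideal V (insert F \<Gamma>')"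
      using F Suc.prems(3) by (auto intro!: nonface_ideal_antimono)
    ultimately show ?case
      using depth_ge_extension(1)[OF assms(1) submod_nonface_ideal[OF Suc.prems(2)] submod_nonface_ideal[OF dc] submod_nonface_ideal[OF assms(3)]]
      by blast
  qed
qed

section \<open>Krull dimension of quotients of polynomial rings\<close>

abbreviation PR :: "'v set \<Rightarrow> (('v \<Rightarrow>\<^sub>0 nat) \<Rightarrow>\<^sub>0 'k::field) ring" where
  "PR \<equiv> polynomial_ring"

lemma carrier_PR: "carrier (PR V) = polys V"
  by (auto simp: polynomial_ring_simps polys_def monomial_span_def)

lemma PR_uminus:
  assumes "a \<in> polys V"
  shows "\<ominus>\<^bsub>PR V\<^esub> a = - a"
proof -
  interpret cring "PR V :: (('a \<Rightarrow>\<^sub>0 nat) \<Rightarrow>\<^sub>0 'b) ring" by (rule cring_polynomial_ring)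
  show ?thesis
    using assms submod_uminus[OF submod_polys assms]
    by (intro minus_equality) (auto simp: carrier_PR polynomial_ring_simps(2-))
qed

lemma PR_minus: "a \<in> polys V \<Longrightarrow> b \<in> polys V \<Longrightarrow> a \<ominus>\<^bsub>PR V\<^esub> b = a - b"
  by (simp add: a_minus_def PR_uminus polynomial_ring_simps(3))

lemma ideal_iff: "ideal I (PR V) \<longleftrightarrow> I \<subseteq> polys V \<and> submod (polys V) I"
proof
  interpret cring "PR V :: (('a \<Rightarrow>\<^sub>0 nat) \<Rightarrow>\<^sub>0 'b) ring" by (rule cring_polynomial_ring)
  assume "ideal I (PR V)"
  then interpret I: ideal I "PR V" .
  have sub: "I \<subseteq> polys V" using I.a_subset by (simp add: carrier_PR)
  have um: "- b \<in> I" if "b \<in> I" for b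
    using I.a_inv_closed[OF that] PR_uminus[of b V] that sub by (metis subsetD)
  have "submod (polys V) I"
  proof (rule submodI)
    show "0 \<in> I" using I.zero_closed by (simp add: polynomial_ring_simps)
    show "a - b \<in> I" if "a \<in> I" "b \<in> I" for a b
      using I.a_closed[OF that(1) um[OF that(2)]] by (simp add: polynomial_ring_simps)
    show "r * a \<in> I" if "r \<in> polys V" "a \<in> I" for r a
      using I.I_l_closed[OF that(2), of r] that(1) by (simp add: carrier_PR polynomial_ring_simps(2))
  qed
  with sub show "I \<subseteq> polys V \<and> submod (polys V) I" ..
next
  interpret cring "PR V :: (('a \<Rightarrow>\<^sub>0 nat) \<Rightarrow>\<^sub>0 'b) ring" by (rule cring_polynomial_ring)
  assume I: "I \<subseteq> polys V \<and> submod (polys V) I"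
  then have s: "submod (polys V) I" by simp
  show "ideal I (PR V)"
  proof (rule idealI)
    show "ring (PR V :: (('a \<Rightarrow>\<^sub>0 nat) \<Rightarrow>\<^sub>0 'b) ring)" by (rule ring_axioms)
    show "subgroup I (add_monoid (PR V))"
    proof (rule add.subgroupI)
      show "\<ominus>\<^bsub>PR V\<^esub> a \<in> I" if "a \<in> I" for a
        using that I submod_uminus[OF s that] by (auto simp: PR_uminus)
    qed (use I submod_zero[OF s] submod_add[OF s] in \<open>auto simp: carrier_PR polynomial_ring_simps(3)\<close>)
    fix a x :: "('a \<Rightarrow>\<^sub>0 nat) \<Rightarrow>\<^sub>0 'b" assume "a \<in> I" "x \<in> carrier (PR V)"
    then have "x * a \<in> I" using submod_mult[OF s] by (simp add: carrier_PR)
    then show "x \<otimes>\<^bsub>PR V\<^esub> a \<in> I" "a \<otimes>\<^bsub>PR V\<^esub> x \<in> I"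
      by (simp_all add: polynomial_ring_simps(2) mult.commute)
  qed
qed

definition prime_set :: "'v set \<Rightarrow> (('v \<Rightarrow>\<^sub>0 nat) \<Rightarrow>\<^sub>0 'k::field) set \<Rightarrow> bool" where
  "prime_set V P \<longleftrightarrow> P \<subseteq> polys V \<and> submod (polys V) P \<and> 1 \<notin> P \<and>
     (\<forall>a\<in>polys V. \<forall>b\<in>polys V. a * b \<in> P \<longrightarrow> a \<in> P \<or> b \<in> P)"

lemma primeideal_iff: "primeideal P (PR V) \<longleftrightarrow> prime_set V P"
proof
  assume "primeideal P (PR V)"
  then interpret P: primeideal P "PR V" .
  have id: "P \<subseteq> polys V" "submod (polys V) P" using P.is_ideal by (auto simp: ideal_iff)
  have "1 \<notin> P"
  proof
    assume "1 \<in> P"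
    then have "a \<in> P" if "a \<in> polys V" for a
      using submod_mult[OF id(2) that] by fastforce
    then show False using P.I_notcarr id by (auto simp: carrier_PR)
  qed
  then show "prime_set V P"
    using id P.I_prime by (auto simp: prime_set_def carrier_PR polynomial_ring_simps(2))
next
  assume P: "prime_set V P"
  then have "1 \<in> polys V - P" using one_polys by (auto simp: prime_set_def)
  then show "primeideal P (PR V)"
    using P by (intro primeidealI cring_polynomial_ring)
      (auto simp: prime_set_def ideal_iff carrier_PR polynomial_ring_simps(2))
qed

section \<open>Algebraic independence along a chain of primes\<close>

fun list_monomial :: "'a::comm_ring_1 list \<Rightarrow> nat list \<Rightarrow> 'a" where
  "list_monomial (f # fs) (n # e) = f ^ n * list_monomial fs e"
| "list_monomial _ _ = 1"

lemma submod_power: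
  assumes "submod C C" "1 \<in> C" "f \<in> C"
  shows "f ^ n \<in> C"
  using assms by (induction n) (auto intro: submod_mult)

lemma mon_closed:
  assumes "submod C C" "1 \<in> C" "set fs \<subseteq> C"
  shows "list_monomial fs e \<in> C"
  using assms(3)
  by (induction fs e rule: list_monomial.induct) (auto intro: submod_mult[OF assms(1)] submod_power[OF assms(1,2)] assms(2))

lemma const_polys: "psingle 0 c \<in> polys V"
  by (auto simp: polys_def intro!: monomial_span_single)

lemma prime_set_power:
  assumes "prime_set V P" "f \<in> polys V" "f \<notin> P" "s \<in> polys V" "f ^ n * s \<in> P"
  shows "s \<in> P"
  using assms(5)
proof (induction n)
  case (Suc n)
  have "f ^ n * s \<in> polys V"
    by (rule submod_mult[OF submod_polys submod_power[OF submod_polys one_polys assms(2)] assms(4)])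
  then have "f ^ n * s \<in> P"
    using Suc.prems assms(1-3) by (auto simp: prime_set_def mult.assoc)
  then show ?case by (rule Suc.IH)
qed simp

text \<open>
  A relation of lowest order in the first variable survives, after division by a power of \<open>f\<^sub>1\<close>,
  modulo the next prime of the chain, where it involves fewer variables.
\<close>

lemma prime_chain_independent:
  fixes P :: "nat \<Rightarrow> (('v \<Rightarrow>\<^sub>0 nat) \<Rightarrow>\<^sub>0 'k::field) set"
  assumes "\<And>i. i \<le> length fs \<Longrightarrow> prime_set V (P i)" "\<And>i. i < length fs \<Longrightarrow> P i \<subseteq> P (Suc i)"
    and "\<And>i. i < length fs \<Longrightarrow> fs ! i \<in> P (Suc i) - P i" "set fs \<subseteq> polys V"
    and "finite E" "\<And>e. e \<in> E \<Longrightarrow> length e = length fs"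
    and "(\<Sum>e\<in>E. psingle 0 (c e) * list_monomial fs e) \<in> P 0"
  shows "\<forall>e\<in>E. c e = 0"
  using assms
proof (induction fs arbitrary: P E c)
  case Nil
  have P: "prime_set V (P 0)" using Nil.prems(1) by simp
  show ?case
  proof (intro ballI)
    fix e assume "e \<in> E"
    then have E: "e = []" "E = {[]}" using Nil.prems(6) by auto
    show "c e = 0"
    proof (rule ccontr)
      assume "c e \<noteq> 0"
      then have "psingle 0 (inverse (c e)) * psingle 0 (c e) = (1 :: ('v \<Rightarrow>\<^sub>0 nat) \<Rightarrow>\<^sub>0 'k)"
        by (simp add: mult_single)
      moreover have "psingle 0 (c e) \<in> P 0" using Nil.prems(7) E by simp
      ultimately show False
        using P submod_mult[of "polys V" "P 0" "psingle 0 (inverse (c e))" "psingle 0 (c e)"] const_polys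
        by (auto simp: prime_set_def)
    qed
  qed
next
  case (Cons f fs)
  have P0: "prime_set V (P 0)" and P1: "prime_set V (P 1)" using Cons.prems(1)[of 0] Cons.prems(1)[of 1] by auto
  have P1s: "submod (polys V) (P 1)" using P1 by (simp add: prime_set_def)
  have f: "f \<in> polys V" "f \<notin> P 0" "f \<in> P 1" using Cons.prems(3)[of 0] Cons.prems(4) by auto
  have fs: "set fs \<subseteq> polys V" using Cons.prems(4) by simp
  show ?case
  proof (rule ccontr)
    assume neq: "\<not> (\<forall>e\<in>E. c e = 0)"
    define E' where "E' = {e\<in>E. c e \<noteq> 0}"
    have E': "finite E'" "E' \<noteq> {}" using Cons.prems(5) neq by (auto simp: E'_def)
    define t where "t = Min (hd ` E')"
    have t: "t \<le> hd e" if "e \<in> E'" for e using that E' by (simp add: t_def)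
    have len: "e = hd e # tl e" "length (tl e) = length fs" if "e \<in> E'" for e
      using Cons.prems(6)[of e] that by (auto simp: E'_def) (cases e; auto)+
    define g where "g e = psingle 0 (c e) * f ^ (hd e - t) * list_monomial fs (tl e)" for e
    have g: "g e \<in> polys V" for e
      unfolding g_def using submod_power[OF submod_polys one_polys f(1)] mon_closed[OF submod_polys one_polys fs]
      by (intro submod_mult[OF submod_polys]) (auto intro: const_polys)
    have "(\<Sum>e\<in>E. psingle 0 (c e) * list_monomial (f # fs) e) = (\<Sum>e\<in>E'. psingle 0 (c e) * list_monomial (f # fs) e)"
      unfolding E'_def using Cons.prems(5) by (intro sum.mono_neutral_right) auto
    also have "\<dots> = (\<Sum>e\<in>E'. f ^ t * g e)"
    proof (rule sum.cong[OF refl])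
      fix e assume e: "e \<in> E'"
      have "list_monomial (f # fs) e = f ^ hd e * list_monomial fs (tl e)"
        by (subst len(1)[OF e]) (rule list_monomial.simps)
      moreover have "f ^ hd e = f ^ t * f ^ (hd e - t)" using t[OF e] by (simp flip: power_add)
      ultimately show "psingle 0 (c e) * list_monomial (f # fs) e = f ^ t * g e" by (simp add: g_def ac_simps)
    qed
    finally have "f ^ t * (\<Sum>e\<in>E'. g e) \<in> P 0" using Cons.prems(7) by (simp add: sum_distrib_left)
    then have "(\<Sum>e\<in>E'. g e) \<in> P 0"
      by (rule prime_set_power[OF P0 f(1,2) submod_sum[OF submod_polys g]])
    then have S: "(\<Sum>e\<in>E'. g e) \<in> P 1" using Cons.prems(2)[of 0] by auto
    \<comment> \<open>\<open>P 1\<close> contains \<open>f\<close>, so modulo \<open>P 1\<close>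
      only the terms where \<open>f\<close> has the least exponent \<open>t\<close> survive; after
      the division they no longer involve \<open>f\<close>.\<close>
    define E0 where "E0 = {e\<in>E'. hd e = t}"
    have "g e \<in> P 1" if "e \<in> E' - E0" for e
    proof -
      have "t \<noteq> hd e" "t \<le> hd e" using that t[of e] by (auto simp: E0_def)
      then obtain k where "hd e - t = Suc k" by (cases "hd e - t") auto
      then have "g e = (psingle 0 (c e) * f ^ k * list_monomial fs (tl e)) * f" by (simp add: g_def ac_simps)
      moreover have "psingle 0 (c e) * f ^ k * list_monomial fs (tl e) \<in> polys V"
        using submod_power[OF submod_polys one_polys f(1)] mon_closed[OF submod_polys one_polys fs]
        by (intro submod_mult[OF submod_polys]) (auto intro: const_polys)
      ultimately show ?thesis using submod_mult[OF P1s _ f(3)] by simp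
    qed
    then have "(\<Sum>e\<in>E' - E0. g e) \<in> P 1" by (rule submod_sum[OF P1s])
    moreover have "(\<Sum>e\<in>E'. g e) = (\<Sum>e\<in>E' - E0. g e) + (\<Sum>e\<in>E0. g e)"
      using E'(1) by (intro sum.subset_diff) (auto simp: E0_def)
    ultimately have "(\<Sum>e\<in>E0. g e) \<in> P 1"
      using submod_diff[OF P1s S] by fastforce
    moreover have "(\<Sum>e\<in>E0. g e) = (\<Sum>e'\<in>tl ` E0. psingle 0 (c (t # e')) * list_monomial fs e')"
    proof -
      have eq: "e = t # tl e" if "e \<in> E0" for e using that len(1)[of e] by (auto simp: E0_def)
      then have "inj_on tl E0" by (intro inj_onI) metis
      moreover have "g e = psingle 0 (c (t # tl e)) * list_monomial fs (tl e)" if "e \<in> E0" for e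
        using that eq[OF that] by (simp add: g_def E0_def)
      ultimately show ?thesis by (simp add: sum.reindex)
    qed
    ultimately have *: "(\<Sum>e'\<in>tl ` E0. psingle 0 (c (t # e')) * list_monomial fs e') \<in> P 1" by simp
    have "\<forall>e\<in>tl ` E0. c (t # e) = 0"
    proof (rule Cons.IH[of "\<lambda>i. P (Suc i)"])
      show "prime_set V (P (Suc i))" if "i \<le> length fs" for i using Cons.prems(1)[of "Suc i"] that by simp
      show "P (Suc i) \<subseteq> P (Suc (Suc i))" if "i < length fs" for i using Cons.prems(2)[of "Suc i"] that by simp
      show "fs ! i \<in> P (Suc (Suc i)) - P (Suc i)" if "i < length fs" for i
        using Cons.prems(3)[of "Suc i"] that by simp
      show "finite (tl ` E0)" using E'(1) by (simp add: E0_def)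
      show "length e = length fs" if "e \<in> tl ` E0" for e using that len(2) by (auto simp: E0_def)
    qed (use fs * in auto)
    moreover have "t \<in> hd ` E'" unfolding t_def using E' by (intro Min_in) auto
    then obtain e where "e \<in> E0" by (auto simp: E0_def)
    ultimately show False using len(1)[of e] by (auto simp: E0_def E'_def)
  qed
qed

section \<open>Algebraic dependence by counting monomials\<close>

lemma homogeneous_system_solution:
  fixes A :: "'i \<Rightarrow> 'm \<Rightarrow> 'k::field"
  assumes "finite M" "finite I" "card M < card I"
  shows "\<exists>c. (\<exists>i\<in>I. c i \<noteq> 0) \<and> (\<forall>m\<in>M. (\<Sum>i\<in>I. c i * A i m) = 0)"
  using assms
proof (induction M arbitrary: I A rule: finite_induct)
  case empty
  then have "\<exists>i. i \<in> I" by (metis card_gt_0_iff ex_in_conv gr_implies_not_zero neq0_conv)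
  then show ?case by (intro exI[of _ "\<lambda>_. 1"]) auto
next
  case (insert m M)
  show ?case
  proof (cases "\<forall>i\<in>I. A i m = 0")
    case True
    then show ?thesis using insert.IH[of I A] insert.prems insert.hyps by auto
  next
    case False
    then obtain i0 where i0: "i0 \<in> I" "A i0 m \<noteq> 0" by auto
    \<comment> \<open>Gaussian elimination: \<open>B\<close> is the system after the equation
      \<open>m\<close> is eliminated with pivot \<open>i0\<close>, and the value of
      \<open>c'\<close> at \<open>i0\<close> solves that equation.\<close>
    define B where "B i w = A i w - A i m / A i0 m * A i0 w" for i w
    have "card M < card (I - {i0})" using insert.prems insert.hyps i0 by simp
    then obtain c where c: "\<exists>i\<in>I - {i0}. c i \<noteq> 0" "\<forall>w\<in>M. (\<Sum>i\<in>I - {i0}. c i * B i w) = 0"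
      using insert.IH[of "I - {i0}" B] insert.prems by auto
    define c' where "c' = c(i0 := - (\<Sum>i\<in>I - {i0}. c i * (A i m / A i0 m)))"
    have eq: "(\<Sum>i\<in>I. c' i * A i w) = (\<Sum>i\<in>I - {i0}. c i * B i w)" for w
    proof -
      have "(\<Sum>i\<in>I. c' i * A i w) = c' i0 * A i0 w + (\<Sum>i\<in>I - {i0}. c' i * A i w)"
        using insert.prems i0 by (simp add: sum.remove)
      also have "(\<Sum>i\<in>I - {i0}. c' i * A i w) = (\<Sum>i\<in>I - {i0}. c i * A i w)"
        by (rule sum.cong) (auto simp: c'_def)
      also have "c' i0 * A i0 w = - (\<Sum>i\<in>I - {i0}. c i * (A i m / A i0 m * A i0 w))"
        by (simp add: c'_def sum_distrib_right mult.assoc)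
      finally show ?thesis by (simp add: B_def right_diff_distrib sum_subtractf)
    qed
    have "B i m = 0" for i using i0 by (simp add: B_def)
    then have "\<forall>w\<in>insert m M. (\<Sum>i\<in>I. c' i * A i w) = 0" using c(2) by (simp add: eq)
    moreover have "\<exists>i\<in>I. c' i \<noteq> 0" using c(1) by (auto simp: c'_def)
    ultimately show ?thesis by blast
  qed
qed

text \<open>Bounding each exponent separately, and not the total degree, leaves at most
  \<open>(d + 1) ^ card F\<close> vectors on a face \<open>F\<close>, and the bounds add up under
  multiplication.\<close>

definition bounded_exps :: "'v set \<Rightarrow> nat \<Rightarrow> ('v \<Rightarrow>\<^sub>0 nat) set" where
  "bounded_exps V d = {m. supp m \<subseteq> V \<and> (\<forall>x. coef m x \<le> d)}"

lemma bounded_exps_mult: "p \<in> monomial_span (bounded_exps V a) \<Longrightarrow> q \<in> monomial_span (bounded_exps V b) \<Longrightarrow> p * q \<in> monomial_span (bounded_exps V (a + b))"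
  by (rule monomial_span_mult) (auto simp: bounded_exps_def keys_add_nat lookup_add intro: add_mono)

lemma bounded_exps_power: "p \<in> monomial_span (bounded_exps V a) \<Longrightarrow> p ^ n \<in> monomial_span (bounded_exps V (n * a))"
proof (induction n)
  case 0
  then show ?case by (simp add: monomial_span_def bounded_exps_def)
next
  case (Suc n)
  then show ?case using bounded_exps_mult[of p V a "p ^ n" "n * a"] by simp
qed

lemma bounded_exps_list_monomial:
  assumes "set fs \<subseteq> monomial_span (bounded_exps V d)" "length e = length fs" "set e \<subseteq> {..D}"
  shows "list_monomial fs e \<in> monomial_span (bounded_exps V (length fs * (D * d)))"
  using assms(2,1,3)
proof (induction e fs rule: list_induct2)
  case Nil
  then show ?case by (simp add: monomial_span_def bounded_exps_def)
next
  case (Cons n e f fs)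
  have "f ^ n \<in> monomial_span (bounded_exps V (n * d))" using Cons.prems by (intro bounded_exps_power) auto
  moreover have "monomial_span (bounded_exps V (n * d)) \<subseteq> monomial_span (bounded_exps V (D * d))"
    using Cons.prems by (intro monomial_span_mono) (auto simp: bounded_exps_def intro: order_trans mult_le_mono1)
  ultimately show ?case using Cons by (auto intro: bounded_exps_mult)
qed

lemma bounded_exps_exists:
  assumes "p \<in> polys V"
  shows "\<exists>d. p \<in> monomial_span (bounded_exps V d)"
proof -
  define d where "d = (\<Sum>m\<in>supp p. \<Sum>x\<in>supp m. coef m x)"
  have "coef m x \<le> d" if "m \<in> supp p" for m x
  proof (cases "x \<in> supp m")
    case True
    then have "coef m x \<le> (\<Sum>x\<in>supp m. coef m x)" by (intro member_le_sum) auto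
    also have "\<dots> \<le> d" unfolding d_def using that by (intro member_le_sum) auto
    finally show ?thesis .
  qed (simp add: in_keys_iff)
  then show ?thesis using assms by (intro exI[of _ d]) (auto simp: monomial_span_def polys_def bounded_exps_def)
qed

lemma bounded_exps_exists_list:
  assumes "set fs \<subseteq> polys V"
  shows "\<exists>d. set fs \<subseteq> monomial_span (bounded_exps V d)"
  using assms
proof (induction fs)
  case (Cons f fs)
  then obtain d1 d2 where "set fs \<subseteq> monomial_span (bounded_exps V d1)" "f \<in> monomial_span (bounded_exps V d2)"
    using bounded_exps_exists[of f V] by auto
  moreover have "monomial_span (bounded_exps V d1) \<subseteq> monomial_span (bounded_exps V (d1 + d2))"
      "monomial_span (bounded_exps V d2) \<subseteq> monomial_span (bounded_exps V (d1 + d2))"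
    by (intro monomial_span_mono; force simp: bounded_exps_def intro: trans_le_add1 trans_le_add2)+
  ultimately show ?case by (intro exI[of _ "d1 + d2"]) auto
qed simp

lemma card_bounded_exps:
  assumes "finite F"
  shows "finite (bounded_exps F N) \<and> card (bounded_exps F N) \<le> (N + 1) ^ card F"
proof -
  let ?r = "\<lambda>m. restrict (coef m) F"
  have inj: "inj_on ?r (bounded_exps F N)"
  proof (rule inj_onI, rule poly_mapping_eqI)
    fix a b :: "'a \<Rightarrow>\<^sub>0 nat" and x
    assume ab: "a \<in> bounded_exps F N" "b \<in> bounded_exps F N" "?r a = ?r b"
    show "coef a x = coef b x"
    proof (cases "x \<in> F")
      case True
      then show ?thesis using fun_cong[OF ab(3), of x] by simp
    next
      case False
      then have "x \<notin> supp a" "x \<notin> supp b" using ab by (auto simp: bounded_exps_def)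
      then show ?thesis by (simp add: in_keys_iff)
    qed
  qed
  have sub: "?r ` bounded_exps F N \<subseteq> F \<rightarrow>\<^sub>E {..N}" by (auto simp: bounded_exps_def)
  have fin: "finite (F \<rightarrow>\<^sub>E {..N})" using assms by (intro finite_PiE) auto
  have "card (F \<rightarrow>\<^sub>E {..N}) = (N + 1) ^ card F" using assms by (simp add: card_PiE)
  then show ?thesis
    using card_inj_on_le[OF inj sub fin] inj_on_finite[OF inj sub fin] by simp
qed

lemma algebraic_relation:
  fixes fs :: "(('v \<Rightarrow>\<^sub>0 nat) \<Rightarrow>\<^sub>0 'k::field) list"
  assumes "finite V" "\<Gamma> \<subseteq> Pow V" "set fs \<subseteq> polys V" "\<And>F. F \<in> \<Gamma> \<Longrightarrow> card F < length fs"
  shows "\<exists>E c. finite E \<and> (\<forall>e\<in>E. length e = length fs) \<and> (\<exists>e\<in>E. c e \<noteq> 0) \<and>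
     (\<Sum>e\<in>E. psingle 0 (c e) * list_monomial fs e) \<in> nonface_ideal V \<Gamma>"
proof -
  let ?m = "length fs"
  have fin: "finite \<Gamma>" using assms(1,2) finite_subset by fastforce
  obtain d where d: "set fs \<subseteq> monomial_span (bounded_exps V d)" using bounded_exps_exists_list[OF assms(3)] by blast
  \<comment> \<open>There are \<open>(D + 1) ^ ?m\<close> products of the \<open>fs\<close> with
    exponents up to \<open>D\<close>, against at most
    \<open>card \<Gamma> * (N + 1) ^ (?m - 1)\<close> monomials outside the ideal that can occur in
    them. As \<open>N + 1\<close> is at most \<open>(?m * d + 1) * (D + 1)\<close>, this
    \<open>D\<close> bounds the latter by \<open>D * (D + 1) ^ (?m - 1)\<close>, which is smaller
    for positive \<open>?m\<close>.\<close>
  define D where "D = card \<Gamma> * (?m * d + 1) ^ (?m - 1)"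
  define N where "N = ?m * (D * d)"
  define E where "E = {e. set e \<subseteq> {..D} \<and> length e = ?m}"
  \<comment> \<open>Each vector in \<open>M\<close> contributes one linear equation for the
    coefficients; solving them all leaves only monomials of the ideal.\<close>
  define M where "M = (\<Union>F\<in>\<Gamma>. bounded_exps F N)"
  have E: "finite E" "card E = (D + 1) ^ ?m"
    unfolding E_def using finite_lists_length_eq[of "{..D}" ?m] card_lists_length_eq[of "{..D}" ?m] by auto
  have finM: "finite M"
    unfolding M_def using fin card_bounded_exps assms(1,2) by (auto dest: finite_subset)
  have "card M \<le> (\<Sum>F\<in>\<Gamma>. card (bounded_exps F N))"
    unfolding M_def using fin by (rule card_UN_le)
  also have "\<dots> \<le> (\<Sum>F\<in>\<Gamma>. (N + 1) ^ (?m - 1))"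
  proof (rule sum_mono)
    fix F assume F: "F \<in> \<Gamma>"
    then have "finite F" using assms(1,2) by (auto dest: finite_subset)
    then have "card (bounded_exps F N) \<le> (N + 1) ^ card F"
      using card_bounded_exps by blast
    also have "\<dots> \<le> (N + 1) ^ (?m - 1)"
      using assms(4)[OF F] by (intro power_increasing) auto
    finally show "card (bounded_exps F N) \<le> (N + 1) ^ (?m - 1)" .
  qed
  also have "\<dots> = card \<Gamma> * (N + 1) ^ (?m - 1)" by simp
  also have "\<dots> \<le> card \<Gamma> * ((?m * d + 1) * (D + 1)) ^ (?m - 1)"
    by (intro mult_left_mono power_mono) (auto simp: N_def algebra_simps)
  also have "\<dots> = card \<Gamma> * (?m * d + 1) ^ (?m - 1) * (D + 1) ^ (?m - 1)"
    by (simp only: power_mult_distrib mult.assoc)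
  also have "card \<Gamma> * (?m * d + 1) ^ (?m - 1) = D" by (simp only: D_def)
  finally have le: "card M \<le> D * (D + 1) ^ (?m - 1)" .
  have "card M < card E"
  proof (cases "?m = 0")
    case True
    then have "\<Gamma> = {}" using assms(4) by auto
    then show ?thesis using E by (simp add: M_def)
  next
    case False
    then have "(D + 1) ^ ?m = (D + 1) * (D + 1) ^ (?m - 1)" by (cases ?m) auto
    moreover have "D * (D + 1) ^ (?m - 1) < (D + 1) * (D + 1) ^ (?m - 1)" by simp
    ultimately show ?thesis using le E by linarith
  qed
  then obtain c where c: "\<exists>e\<in>E. c e \<noteq> 0" "\<forall>m\<in>M. (\<Sum>e\<in>E. c e * coef (list_monomial fs e) m) = 0"
    using homogeneous_system_solution[OF finM E(1), of "\<lambda>e m. coef (list_monomial fs e) m"] by blast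
  let ?p = "\<Sum>e\<in>E. psingle 0 (c e) * list_monomial fs e"
  have coef: "coef ?p m = (\<Sum>e\<in>E. c e * coef (list_monomial fs e) m)" for m
    using lookup_single_mult_add[where m = 0 and m' = m and ?'k = 'k] by (simp add: lookup_sum)
  have "?p \<in> nonface_ideal V \<Gamma>"
    unfolding nonface_ideal_def monomial_span_def
  proof (intro CollectI subsetI)
    fix m assume m: "m \<in> supp ?p"
    have "\<exists>e\<in>E. coef (list_monomial fs e) m \<noteq> 0"
    proof (rule ccontr)
      assume "\<not> ?thesis"
      then have "coef ?p m = 0" unfolding coef by simp
      then show False using m by (simp add: in_keys_iff)
    qed
    then obtain e where e: "e \<in> E" "m \<in> supp (list_monomial fs e)" by (auto simp: in_keys_iff)
    then have "m \<in> bounded_exps V N"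
      using bounded_exps_list_monomial[OF d, of e D] by (auto simp: E_def N_def monomial_span_def)
    moreover have "m \<notin> M" using m c(2) by (auto simp: in_keys_iff coef)
    ultimately show "supp m \<subseteq> V \<and> supp m \<notin> \<Gamma>"
      by (auto simp: bounded_exps_def M_def)
  qed
  then show ?thesis using c(1) E(1) by (intro exI[of _ E] exI[of _ c]) (auto simp: E_def)
qed

lemma prime_chain_bound:
  fixes P :: "nat \<Rightarrow> (('v \<Rightarrow>\<^sub>0 nat) \<Rightarrow>\<^sub>0 'k::field) set"
  assumes "finite V" "\<Gamma> \<subseteq> Pow V" "nonface_ideal V \<Gamma> \<subseteq> P 0"
    and "\<And>i. i \<le> n \<Longrightarrow> prime_set V (P i)" "\<And>i. i < n \<Longrightarrow> P i \<subset> P (Suc i)"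
  shows "\<exists>F\<in>\<Gamma>. n \<le> card F"
proof (rule ccontr)
  assume neg: "\<not> ?thesis"
  have "\<forall>i. \<exists>f. i < n \<longrightarrow> f \<in> P (Suc i) - P i" using assms(5) by blast
  then obtain f where f: "\<forall>i. i < n \<longrightarrow> f i \<in> P (Suc i) - P i" by (rule choice[THEN exE])
  let ?fs = "map f [0..<n]"
  have fs: "set ?fs \<subseteq> polys V"
  proof
    fix g assume "g \<in> set ?fs"
    then obtain i where "i < n" "g = f i" by auto
    then have "g \<in> P (Suc i)" "P (Suc i) \<subseteq> polys V"
      using f assms(4)[of "Suc i"] by (auto simp: prime_set_def)
    then show "g \<in> polys V" by blast
  qed
  obtain E c where E: "finite E" "\<forall>e\<in>E. length e = length ?fs" "\<exists>e\<in>E. c e \<noteq> 0"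
      "(\<Sum>e\<in>E. psingle 0 (c e) * list_monomial ?fs e) \<in> nonface_ideal V \<Gamma>"
    using algebraic_relation[OF assms(1,2) fs] neg by (auto simp: not_le)
  have "\<forall>e\<in>E. c e = 0"
  proof (rule prime_chain_independent[of ?fs V P])
    show "prime_set V (P i)" if "i \<le> length ?fs" for i using assms(4) that by simp
    show "P i \<subseteq> P (Suc i)" if "i < length ?fs" for i using assms(5)[of i] that by simp
    show "?fs ! i \<in> P (Suc i) - P i" if "i < length ?fs" for i using f that by simp
    show "length e = length ?fs" if "e \<in> E" for e using E(2) that by blast
    show "(\<Sum>e\<in>E. psingle 0 (c e) * list_monomial ?fs e) \<in> P 0" using E(4) assms(3) by blast
  qed (rule fs E(1))+
  then show False using E(3) by blast
qed

text \<open>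
  There is no order on the variables, hence no notion of leading term; the exponent vectors are
  therefore compared through an enumeration of \<open>V\<close>.
\<close>

definition reindex :: "('v \<Rightarrow> nat) \<Rightarrow> ('v \<Rightarrow>\<^sub>0 nat) \<Rightarrow> (nat \<Rightarrow>\<^sub>0 nat)" where
  "reindex \<iota> m = (\<Sum>x\<in>supp m. psingle (\<iota> x) (coef m x))"

lemma reindex_add: "reindex \<iota> (m + m') = reindex \<iota> m + reindex \<iota> m'"
  unfolding reindex_def by (rule setsum_keys_plus_distrib) (auto simp: single_add)

lemma reindex_inj:
  assumes "inj_on \<iota> V" "supp m \<subseteq> V" "supp m' \<subseteq> V" "reindex \<iota> m = reindex \<iota> m'"
  shows "m = m'"
proof (rule poly_mapping_eqI)
  have eq: "coef (reindex \<iota> w) (\<iota> x) = coef w x" if "x \<in> V" "supp w \<subseteq> V" for w x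
  proof -
    have "coef (reindex \<iota> w) (\<iota> x) = (\<Sum>y\<in>supp w. if y = x then coef w y else 0)"
      unfolding reindex_def lookup_sum lookup_single when_def
      using assms(1) that by (intro sum.cong) (auto dest: inj_onD)
    then show ?thesis by (auto simp: not_in_keys_iff_lookup_eq_zero)
  qed
  fix x
  show "coef m x = coef m' x"
  proof (cases "x \<in> V")
    case True
    then show ?thesis using eq[OF True assms(2)] eq[OF True assms(3)] assms(4) by simp
  next
    case False
    then have "x \<notin> supp m" "x \<notin> supp m'" using assms(2,3) by auto
    then show ?thesis by (simp add: in_keys_iff)
  qed
qed

text \<open>The quotient is the polynomial ring on \<open>F\<close>. It is a domain by a product of
  leading terms, chosen among the monomials supported on \<open>F\<close>.\<close>

lemma prime_set_face:
  assumes "finite V" "F \<subseteq> V"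
  shows "prime_set V (nonface_ideal V (Pow F) :: (('v \<Rightarrow>\<^sub>0 nat) \<Rightarrow>\<^sub>0 'k::field) set)"
  unfolding prime_set_def
proof (intro conjI ballI impI)
  show "nonface_ideal V (Pow F) \<subseteq> polys V" by (rule nonface_ideal_subset_polys)
  show "submod (polys V) (nonface_ideal V (Pow F))" by (rule submod_nonface_ideal) (auto simp: down_closed_def)
  show "1 \<notin> nonface_ideal V (Pow F)" by (auto simp: nonface_ideal_def monomial_span_def)
  fix p q :: "('v \<Rightarrow>\<^sub>0 nat) \<Rightarrow>\<^sub>0 'k"
  assume pq: "p \<in> polys V" "q \<in> polys V" "p * q \<in> nonface_ideal V (Pow F)"
  show "p \<in> nonface_ideal V (Pow F) \<or> q \<in> nonface_ideal V (Pow F)"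
  proof (rule ccontr)
    assume "\<not> ?thesis"
    then have ne: "{m\<in>supp p. supp m \<subseteq> F} \<noteq> {}" "{m\<in>supp q. supp m \<subseteq> F} \<noteq> {}"
      using pq by (auto simp: nonface_ideal_def polys_def monomial_span_def)
    obtain \<iota> :: "'v \<Rightarrow> nat" where \<iota>: "inj_on \<iota> V" using finite_imp_inj_to_nat_seg[OF assms(1)] by blast
    have leading: "\<exists>a\<in>supp r. supp a \<subseteq> F \<and> (\<forall>m\<in>supp r. supp m \<subseteq> F \<longrightarrow> reindex \<iota> m \<le> reindex \<iota> a)"
      if "{m\<in>supp r. supp m \<subseteq> F} \<noteq> {}" for r :: "('v \<Rightarrow>\<^sub>0 nat) \<Rightarrow>\<^sub>0 'k"
    proof -
      let ?S = "{m\<in>supp r. supp m \<subseteq> F}"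
      have "Max (reindex \<iota> ` ?S) \<in> reindex \<iota> ` ?S" using that by (intro Max_in) auto
      then obtain a where "a \<in> ?S" "reindex \<iota> a = Max (reindex \<iota> ` ?S)" by auto
      then show ?thesis by (intro bexI[of _ a]) auto
    qed
    obtain a b where a: "a \<in> supp p" "supp a \<subseteq> F" "\<forall>m\<in>supp p. supp m \<subseteq> F \<longrightarrow> reindex \<iota> m \<le> reindex \<iota> a"
      and b: "b \<in> supp q" "supp b \<subseteq> F" "\<forall>m\<in>supp q. supp m \<subseteq> F \<longrightarrow> reindex \<iota> m \<le> reindex \<iota> b"
      using leading ne by meson
    \<comment> \<open>A product of monomials supported on \<open>F\<close> has both factors
      supported on \<open>F\<close>, where \<open>a\<close> and \<open>b\<close> are maximal; so
      \<open>a + b\<close> arises only from the leading pair.\<close>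
    have unique: "m = a \<and> m' = b" if m: "m \<in> supp p" "m' \<in> supp q" "m + m' = a + b" for m m'
    proof -
      have sub: "supp m \<subseteq> F" "supp m' \<subseteq> F"
        using a(2) b(2) arg_cong[OF m(3), of supp] by (auto simp: keys_add_nat)
      then have "reindex \<iota> m \<le> reindex \<iota> a" "reindex \<iota> m' \<le> reindex \<iota> b" using a b m by auto
      moreover have "reindex \<iota> m + reindex \<iota> m' = reindex \<iota> a + reindex \<iota> b"
        using m(3) by (simp flip: reindex_add)
      ultimately have "reindex \<iota> m = reindex \<iota> a" "reindex \<iota> m' = reindex \<iota> b"
        by (metis add_le_cancel_left add_right_cancel order_antisym add_le_cancel_right add_left_cancel)+
      then show ?thesis using reindex_inj[OF \<iota>] sub a(2) b(2) assms(2) by blast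
    qed
    define p' where "p' = p - psingle a (coef p a)"
    have p': "p = psingle a (coef p a) + p'" "supp p' \<subseteq> supp p" "a \<notin> supp p'"
      using a(1) by (auto simp: p'_def in_keys_iff lookup_minus lookup_single when_def split: if_splits)
    have "a + b \<notin> supp (p' * q)"
    proof
      assume "a + b \<in> supp (p' * q)"
      then obtain m m' where "m \<in> supp p'" "m' \<in> supp q" "a + b = m + m'" using keys_mult[of p' q] by blast
      then show False using unique[of m m'] p' by auto
    qed
    then have "coef (p * q) (a + b) = coef (psingle a (coef p a) * q) (a + b)"
      by (subst p'(1)) (simp add: distrib_right lookup_add not_in_keys_iff_lookup_eq_zero)
    also have "\<dots> = coef p a * coef q b" by (rule lookup_single_mult_add)
    also have "\<dots> \<noteq> 0" using a(1) b(1) by (simp add: in_keys_iff)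
    finally have "a + b \<in> supp (p * q)" by (simp add: in_keys_iff)
    then have "\<not> supp (a + b) \<subseteq> F" using pq(3) unfolding nonface_ideal_def monomial_span_def by blast
    then show False using a(2) b(2) by (simp add: keys_add_nat)
  qed
qed

section \<open>Primes of quotient rings and bounds on the Krull dimension\<close>

lemma PR_coset_eq:
  assumes "ideal I (PR V)" "a \<in> polys V" "b \<in> polys V"
  shows "I +>\<^bsub>PR V\<^esub> a = I +>\<^bsub>PR V\<^esub> b \<longleftrightarrow> a - b \<in> I"
proof -
  interpret cring "PR V :: (('a \<Rightarrow>\<^sub>0 nat) \<Rightarrow>\<^sub>0 'b) ring" by (rule cring_polynomial_ring)
  show ?thesis
    using quotient_eq_iff_same_a_r_cos[OF assms(1), of a b] assms(2,3) by (simp add: carrier_PR PR_minus)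
qed

lemma zero_PR_quot: "\<zero>\<^bsub>PR V Quot I\<^esub> = I"
  by (simp add: FactRing_def)

lemma carrier_PR_quot: "carrier (PR V Quot I) = (+>\<^bsub>PR V\<^esub>) I ` polys V"
  unfolding FactRing_def by (auto simp: A_RCOSETS_def' carrier_PR)

lemma primeideal_vimage_quot:
  assumes "ideal I (PR V)" "primeideal Q (PR V Quot I)"
  shows "primeideal {r \<in> polys V. I +>\<^bsub>PR V\<^esub> r \<in> Q} (PR V)"
    and "I \<subseteq> {r \<in> polys V. I +>\<^bsub>PR V\<^esub> r \<in> Q}"
proof -
  interpret R: cring "PR V :: (('a \<Rightarrow>\<^sub>0 nat) \<Rightarrow>\<^sub>0 'b) ring" by (rule cring_polynomial_ring)
  interpret I: ideal I "PR V" by fact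
  interpret Q: primeideal Q "PR V Quot I" by fact
  interpret h: ring_hom_ring "PR V" "PR V Quot I" "(+>\<^bsub>PR V\<^esub>) I" by (rule I.rcos_ring_hom_ring)
  have carr: "carrier (PR V Quot I) = (+>\<^bsub>PR V\<^esub>) I ` carrier (PR V)"
    by (simp only: carrier_PR_quot carrier_PR)
  have id: "ideal {r \<in> polys V. I +>\<^bsub>PR V\<^esub> r \<in> Q} (PR V)"
    using h.ideal_vimage[OF Q.is_ideal] by (simp add: carrier_PR)
  have "carrier (PR V) \<noteq> {r \<in> polys V. I +>\<^bsub>PR V\<^esub> r \<in> Q}"
  proof
    assume "carrier (PR V) = {r \<in> polys V. I +>\<^bsub>PR V\<^esub> r \<in> Q}"
    then have "carrier (PR V Quot I) \<subseteq> Q" unfolding carr by auto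
    then show False using Q.I_notcarr Q.a_subset by blast
  qed
  then show "primeideal {r \<in> polys V. I +>\<^bsub>PR V\<^esub> r \<in> Q} (PR V)"
  proof (rule primeidealI[OF id R.is_cring])
    fix a b assume ab: "a \<in> carrier (PR V)" "b \<in> carrier (PR V)" "a \<otimes>\<^bsub>PR V\<^esub> b \<in> {r \<in> polys V. I +>\<^bsub>PR V\<^esub> r \<in> Q}"
    then have "(I +>\<^bsub>PR V\<^esub> a) \<otimes>\<^bsub>PR V Quot I\<^esub> (I +>\<^bsub>PR V\<^esub> b) \<in> Q"
      using h.hom_mult[OF ab(1,2)] by simp
    from Q.I_prime[OF h.hom_closed[OF ab(1)] h.hom_closed[OF ab(2)] this]
    show "a \<in> {r \<in> polys V. I +>\<^bsub>PR V\<^esub> r \<in> Q} \<or> b \<in> {r \<in> polys V. I +>\<^bsub>PR V\<^esub> r \<in> Q}"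
      using ab(1,2) unfolding carrier_PR by blast
  qed
  show "I \<subseteq> {r \<in> polys V. I +>\<^bsub>PR V\<^esub> r \<in> Q}"
  proof
    fix r assume r: "r \<in> I"
    have "I +>\<^bsub>PR V\<^esub> r \<in> Q"
      using additive_subgroup.zero_closed[OF ideal.axioms(1)[OF Q.is_ideal]]
      unfolding R.a_rcos_zero[OF assms(1) r] zero_PR_quot .
    moreover have "r \<in> polys V" using assms(1) r by (auto simp: ideal_iff)
    ultimately show "r \<in> {r \<in> polys V. I +>\<^bsub>PR V\<^esub> r \<in> Q}" by blast
  qed
qed

lemma krull_dim_le:
  fixes I :: "(('v \<Rightarrow>\<^sub>0 nat) \<Rightarrow>\<^sub>0 'k::field) set"
  assumes "finite V" "\<Gamma> \<subseteq> Pow V" "ideal I (PR V)" "nonface_ideal V \<Gamma> \<subseteq> I" "\<And>F. F \<in> \<Gamma> \<Longrightarrow> int (card F) \<le> i"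
  shows "krull_dim (PR V Quot I) \<le> ereal (of_int i)"
  unfolding krull_dim_def
proof (rule Sup_least)
  fix x assume "x \<in> {ereal (real n) |n. \<exists>P. (\<forall>i\<le>n. primeideal (P i) (PR V Quot I)) \<and> (\<forall>i<n. P i \<subset> P (Suc i))}"
  then obtain n Q where Q: "x = ereal (real n)" "\<forall>i\<le>n. primeideal (Q i) (PR V Quot I)" "\<forall>i<n. Q i \<subset> Q (Suc i)"
    by auto
  define P where "P i = {r \<in> polys V. I +>\<^bsub>PR V\<^esub> r \<in> Q i}" for i
  have P: "primeideal (P j) (PR V)" "I \<subseteq> P j" if "j \<le> n" for j
    using primeideal_vimage_quot[OF assms(3), of "Q j"] Q(2) that by (auto simp: P_def)
  \<comment> \<open>Each \<open>Q j\<close> is recovered from its preimage, so strict inclusions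
    remain strict when pulled back.\<close>
  have img: "Q j = (+>\<^bsub>PR V\<^esub>) I ` P j" if "j \<le> n" for j
  proof -
    interpret Qj: primeideal "Q j" "PR V Quot I" using Q(2) that by blast
    have "Q j \<subseteq> (+>\<^bsub>PR V\<^esub>) I ` polys V"
      using Qj.a_subset by (simp only: carrier_PR_quot)
    then show ?thesis by (auto simp: P_def)
  qed
  have "P j \<subset> P (Suc j)" if "j < n" for j
    using Q(3) that img[of j] img[of "Suc j"] by (auto simp: P_def)
  moreover have "nonface_ideal V \<Gamma> \<subseteq> P 0" using P(2)[of 0] assms(4) by blast
  moreover have "prime_set V (P j)" if "j \<le> n" for j using P(1)[OF that] by (simp add: primeideal_iff)
  ultimately obtain F where "F \<in> \<Gamma>" "n \<le> card F"
    using prime_chain_bound[OF assms(1,2), of P n] by blast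
  then have "int n \<le> i" using assms(5)[of F] by linarith
  then show "x \<le> ereal (of_int i)" using Q(1) by (metis ereal_less_eq(3) of_int_le_iff of_int_of_nat_eq)
qed

lemma primeideal_image_quot:
  assumes "ideal I (PR V)" "primeideal P (PR V)" "I \<subseteq> P"
  shows "primeideal ((+>\<^bsub>PR V\<^esub>) I ` P) (PR V Quot I)"
    and "r \<in> polys V \<Longrightarrow> I +>\<^bsub>PR V\<^esub> r \<in> (+>\<^bsub>PR V\<^esub>) I ` P \<Longrightarrow> r \<in> P"
proof -
  interpret R: cring "PR V :: (('a \<Rightarrow>\<^sub>0 nat) \<Rightarrow>\<^sub>0 'b) ring" by (rule cring_polynomial_ring)
  interpret I: ideal I "PR V" by fact
  interpret P: primeideal P "PR V" by fact
  interpret h: ring_hom_ring "PR V" "PR V Quot I" "(+>\<^bsub>PR V\<^esub>) I" by (rule I.rcos_ring_hom_ring)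
  have Ps: "P \<subseteq> polys V" "submod (polys V) P" using P.is_ideal by (auto simp: ideal_iff)
  have mem: "r \<in> P" if r: "r \<in> polys V" "I +>\<^bsub>PR V\<^esub> r \<in> (+>\<^bsub>PR V\<^esub>) I ` P" for r
  proof -
    obtain p where p: "p \<in> P" "I +>\<^bsub>PR V\<^esub> r = I +>\<^bsub>PR V\<^esub> p" using r(2) by auto
    then have "r - p \<in> P" using PR_coset_eq[OF assms(1) r(1), of p] Ps(1) assms(3) by auto
    then show ?thesis using submod_add[OF Ps(2) _ p(1)] by fastforce
  qed
  then show "r \<in> polys V \<Longrightarrow> I +>\<^bsub>PR V\<^esub> r \<in> (+>\<^bsub>PR V\<^esub>) I ` P \<Longrightarrow> r \<in> P" .
  note carr = carrier_PR_quot[of V I]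
  show "primeideal ((+>\<^bsub>PR V\<^esub>) I ` P) (PR V Quot I)"
  proof (rule primeidealI)
    show "ideal ((+>\<^bsub>PR V\<^esub>) I ` P) (PR V Quot I)"
      by (rule R.ring_ideal_imp_quot_ideal[OF assms(1) P.is_ideal])
    show "cring (PR V Quot I)" by (rule I.quotient_is_cring[OF R.is_cring])
    show "carrier (PR V Quot I) \<noteq> (+>\<^bsub>PR V\<^esub>) I ` P"
    proof
      assume eq: "carrier (PR V Quot I) = (+>\<^bsub>PR V\<^esub>) I ` P"
      have "r \<in> P" if "r \<in> polys V" for r
        using mem[OF that] that eq unfolding carr by blast
      then have "carrier (PR V) = P" using Ps(1) unfolding carrier_PR by blast
      then show False using P.I_notcarr by simp
    qed
    fix C D assume CD: "C \<in> carrier (PR V Quot I)" "D \<in> carrier (PR V Quot I)"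
        "C \<otimes>\<^bsub>PR V Quot I\<^esub> D \<in> (+>\<^bsub>PR V\<^esub>) I ` P"
    then obtain a b where ab: "a \<in> polys V" "b \<in> polys V" "C = I +>\<^bsub>PR V\<^esub> a" "D = I +>\<^bsub>PR V\<^esub> b"
      unfolding carr by auto
    then have "I +>\<^bsub>PR V\<^esub> (a \<otimes>\<^bsub>PR V\<^esub> b) \<in> (+>\<^bsub>PR V\<^esub>) I ` P"
      using CD(3) h.hom_mult[of a b] by (simp add: carrier_PR)
    then have "a \<otimes>\<^bsub>PR V\<^esub> b \<in> P"
      using ab submod_mult[OF submod_polys] by (intro mem) (auto simp: polynomial_ring_simps(2))
    then show "C \<in> (+>\<^bsub>PR V\<^esub>) I ` P \<or> D \<in> (+>\<^bsub>PR V\<^esub>) I ` P"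
      using P.I_prime[of a b] ab by (auto simp: carrier_PR)
  qed
qed

text \<open>Dropping the vertices of \<open>F\<close> one at a time turns the prime of
  \<open>F\<close> into an increasing chain of face primes with \<open>card F\<close> steps. Each is
  strict because the dropped variable enters there.\<close>

lemma krull_dim_ge:
  fixes I :: "(('v \<Rightarrow>\<^sub>0 nat) \<Rightarrow>\<^sub>0 'k::field) set"
  assumes "finite V" "F \<subseteq> V" "ideal I (PR V)" "I \<subseteq> nonface_ideal V (Pow F)"
  shows "ereal (real (card F)) \<le> krull_dim (PR V Quot I)"
proof -
  obtain xs where xs: "set xs = F" "distinct xs"
    using finite_distinct_list[OF finite_subset[OF assms(2,1)]] by blast
  have n: "card F = length xs" using xs distinct_card by metis
  define P where "P i = (nonface_ideal V (Pow (set (drop i xs))) :: (('v \<Rightarrow>\<^sub>0 nat) \<Rightarrow>\<^sub>0 'k) set)" for i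
  have sub: "set (drop i xs) \<subseteq> V" for i using xs(1) assms(2) set_drop_subset[of i xs] by auto
  have prime: "primeideal (P i) (PR V)" for i
    unfolding P_def primeideal_iff by (rule prime_set_face[OF assms(1) sub])
  have I: "I \<subseteq> P i" for i
  proof -
    have "nonface_ideal V (Pow F) \<subseteq> P i"
      unfolding P_def using xs(1) set_drop_subset[of i xs] by (intro nonface_ideal_antimono Pow_mono) auto
    then show ?thesis using assms(4) by blast
  qed
  define Q where "Q i = (+>\<^bsub>PR V\<^esub>) I ` P i" for i
  have "Q i \<subset> Q (Suc i)" if i: "i < card F" for i
  proof -
    have "P i \<subseteq> P (Suc i)"
      unfolding P_def by (intro nonface_ideal_antimono Pow_mono set_drop_subset_set_drop) simp
    then have "Q i \<subseteq> Q (Suc i)" by (auto simp: Q_def)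
    moreover
    have x: "drop i xs = xs ! i # drop (Suc i) xs" using i n by (simp add: Cons_nth_drop_Suc)
    have xV: "xs ! i \<in> V" using i n xs(1) assms(2) by auto
    have "xs ! i \<notin> set (drop (Suc i) xs)" using x distinct_drop[OF xs(2), of i] by simp
    then have 1: "pvar (xs ! i) \<in> P (Suc i)" using xV by (auto simp: P_def nonface_ideal_def pvar_def intro!: monomial_span_single)
    have 2: "pvar (xs ! i) \<notin> P i" using x by (auto simp: P_def nonface_ideal_def pvar_def monomial_span_def)
    have "pvar (xs ! i) \<in> polys V" using xV by (auto simp: polys_def pvar_def intro!: monomial_span_single)
    then have "I +>\<^bsub>PR V\<^esub> pvar (xs ! i) \<notin> Q i"
      using primeideal_image_quot(2)[OF assms(3) prime I] 2 unfolding Q_def by blast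
    ultimately show ?thesis using 1 by (auto simp: Q_def)
  qed
  moreover have "primeideal (Q i) (PR V Quot I)" for i
    unfolding Q_def by (rule primeideal_image_quot(1)[OF assms(3) prime I])
  ultimately show ?thesis
    unfolding krull_dim_def by (intro Sup_upper CollectI exI[of _ "card F"] conjI exI[of _ Q]) auto
qed

section \<open>Modules presented as quotients of ideals\<close>

text \<open>\<open>\<pi>\<close> induces an isomorphism from A/U to \<open>N\<close>. The element
  type of \<open>N\<close> is a parameter because every \<open>quotient_module\<close> nests another
  layer of cosets; here the module notions are translated once into statements on \<open>A\<close>
  and \<open>U\<close>.\<close>

locale presentation =
  fixes V :: "'v set" and A U :: "(('v \<Rightarrow>\<^sub>0 nat) \<Rightarrow>\<^sub>0 'k::field) set"
    and N :: "(('v \<Rightarrow>\<^sub>0 nat) \<Rightarrow>\<^sub>0 'k, 'b, 'm) module_scheme" and \<pi> :: "(('v \<Rightarrow>\<^sub>0 nat) \<Rightarrow>\<^sub>0 'k) \<Rightarrow> 'b"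
  assumes submod_A: "submod (polys V) A" and submod_U: "submod (polys V) U" and U_A: "U \<subseteq> A" and A_polys: "A \<subseteq> polys V"
    and module_N: "module (PR V) N"
    and carrier_N: "carrier N = \<pi> ` A"
    and add_N: "a \<in> A \<Longrightarrow> b \<in> A \<Longrightarrow> \<pi> a \<oplus>\<^bsub>N\<^esub> \<pi> b = \<pi> (a + b)"
    and smult_N: "r \<in> polys V \<Longrightarrow> a \<in> A \<Longrightarrow> r \<odot>\<^bsub>N\<^esub> \<pi> a = \<pi> (r * a)"
    and zero_N: "a \<in> A \<Longrightarrow> \<pi> a = \<zero>\<^bsub>N\<^esub> \<longleftrightarrow> a \<in> U"
begin

interpretation module "PR V" N by (rule module_N)

lemma pi_uminus: "a \<in> A \<Longrightarrow> \<ominus>\<^bsub>N\<^esub> \<pi> a = \<pi> (- a)"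
  using submod_uminus[OF submod_A, of a] submod_zero[OF submod_A] zero_N[of 0] submod_zero[OF submod_U]
  by (intro minus_equality) (auto simp: carrier_N add_N)

lemma pi_eq: "a \<in> A \<Longrightarrow> b \<in> A \<Longrightarrow> \<pi> a = \<pi> b \<longleftrightarrow> a - b \<in> U"
proof -
  assume ab: "a \<in> A" "b \<in> A"
  then have c: "\<pi> a \<in> carrier N" "\<pi> b \<in> carrier N" by (auto simp: carrier_N)
  have "\<pi> a = \<pi> b \<longleftrightarrow> \<pi> a \<oplus>\<^bsub>N\<^esub> \<ominus>\<^bsub>N\<^esub> \<pi> b = \<zero>\<^bsub>N\<^esub>"
    using c by (metis M.minus_equality M.minus_minus M.r_neg M.a_inv_closed)
  also have "\<dots> \<longleftrightarrow> a - b \<in> U"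
    using ab submod_uminus[OF submod_A ab(2)] submod_diff[OF submod_A ab] by (simp add: pi_uminus add_N zero_N)
  finally show ?thesis .
qed

lemma pi_image_mem: "submod (polys V) B \<Longrightarrow> U \<subseteq> B \<Longrightarrow> B \<subseteq> A \<Longrightarrow> a \<in> A \<Longrightarrow> \<pi> a \<in> \<pi> ` B \<longleftrightarrow> a \<in> B"
proof
  assume B: "submod (polys V) B" "U \<subseteq> B" "B \<subseteq> A" "a \<in> A" "\<pi> a \<in> \<pi> ` B"
  then obtain b where b: "b \<in> B" "a - b \<in> U" using pi_eq by blast
  then have "(a - b) + b \<in> B" using B by (intro submod_add[OF B(1)]) auto
  then show "a \<in> B" by simp
qed simp

lemma submodule_image:
  assumes "submod (polys V) B" "B \<subseteq> A"
  shows "submodule (\<pi> ` B) (PR V) N"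
proof (rule submoduleI)
  show "\<zero>\<^bsub>N\<^esub> \<in> \<pi> ` B"
    using submod_zero[OF assms(1)] submod_zero[OF submod_A] zero_N[of 0] submod_zero[OF submod_U]
    by (metis image_eqI)
  show "\<pi> ` B \<subseteq> carrier N" using assms by (auto simp: carrier_N)
  show "\<ominus>\<^bsub>N\<^esub> x \<in> \<pi> ` B" if "x \<in> \<pi> ` B" for x
    using that assms submod_uminus[OF assms(1)] by (auto simp: pi_uminus subset_iff)
  show "x \<oplus>\<^bsub>N\<^esub> y \<in> \<pi> ` B" if "x \<in> \<pi> ` B" "y \<in> \<pi> ` B" for x y
    using that assms submod_add[OF assms(1)] by (auto simp: add_N subset_iff)
  show "r \<odot>\<^bsub>N\<^esub> x \<in> \<pi> ` B" if "r \<in> carrier (PR V)" "x \<in> \<pi> ` B" for r x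
    using that assms submod_mult[OF assms(1)] by (auto simp: smult_N subset_iff carrier_PR)
qed

lemma submodule_preimage:
  assumes "submodule W (PR V) N"
  defines "B \<equiv> {a \<in> A. \<pi> a \<in> W}"
  shows "submod (polys V) B" "U \<subseteq> B" "B \<subseteq> A" "W = \<pi> ` B"
proof -
  note W = submoduleE[OF assms(1)]
  interpret W: submodule W "PR V" N by fact
  have zero: "\<zero>\<^bsub>N\<^esub> \<in> W" using W.one_closed by simp
  show "B \<subseteq> A" by (auto simp: B_def)
  show U: "U \<subseteq> B"
  proof
    fix u assume "u \<in> U"
    then show "u \<in> B" using zero_N[of u] zero U_A by (auto simp: B_def)
  qed
  show "W = \<pi> ` B" using W(1) by (auto simp: B_def carrier_N)
  show "submod (polys V) B"
  proof (rule submodI)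
    show "0 \<in> B" using submod_zero[OF submod_U] U by blast
    show "a - b \<in> B" if "a \<in> B" "b \<in> B" for a b
    proof -
      have "\<pi> a \<oplus>\<^bsub>N\<^esub> \<ominus>\<^bsub>N\<^esub> \<pi> b \<in> W" using that by (intro W(5) W(3)) (auto simp: B_def)
      then show ?thesis
        using that submod_uminus[OF submod_A, of b] submod_diff[OF submod_A, of a b]
        by (simp add: B_def pi_uminus add_N)
    qed
    show "r * a \<in> B" if "r \<in> polys V" "a \<in> B" for r a
      using that W(4)[of r "\<pi> a"] submod_mult[OF submod_A that(1), of a] by (simp add: B_def smult_N carrier_PR)
  qed
qed

lemma presentation_submodule:
  assumes "submod (polys V) B" "U \<subseteq> B" "B \<subseteq> A"
  shows "presentation V B U (N\<lparr>carrier := \<pi> ` B\<rparr>) \<pi>"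
proof (rule presentation.intro)
  show "module (PR V) (N\<lparr>carrier := \<pi> ` B\<rparr>)"
    by (rule submodule.submodule_is_module[OF submodule_image[OF assms(1,3)] module_N])
  show "\<pi> a \<oplus>\<^bsub>N\<lparr>carrier := \<pi> ` B\<rparr>\<^esub> \<pi> b = \<pi> (a + b)" if "a \<in> B" "b \<in> B" for a b
    using that assms(3) by (simp add: add_N subset_iff)
qed (use assms submod_U A_polys smult_N zero_N in auto)

text \<open>The third isomorphism theorem, (A/U)/(B/U) = A/B.\<close>

lemma presentation_quotient:
  assumes "submod (polys V) B" "U \<subseteq> B" "B \<subseteq> A"
  shows "presentation V A B (quotient_module N (\<pi> ` B)) (\<lambda>a. \<pi> ` B +>\<^bsub>N\<^esub> \<pi> a)"
proof (rule presentation.intro)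
  let ?W = "\<pi> ` B"
  have sub: "submodule ?W (PR V) N" by (rule submodule_image[OF assms(1,3)])
  interpret W: submodule ?W "PR V" N by (rule sub)
  interpret W: abelian_subgroup ?W N
    by (intro abelian_subgroupI3 additive_subgroup.intro W.subgroup_axioms M.abelian_group_axioms)
  show "module (PR V) (quotient_module N ?W)" by (rule module_quotient_module[OF module_N sub])
  have carr: "carrier (quotient_module N ?W) = (\<lambda>x. ?W +>\<^bsub>N\<^esub> x) ` carrier N"
    by (auto simp: quotient_module_def A_RCOSETS_def')
  show "carrier (quotient_module N ?W) = (\<lambda>a. ?W +>\<^bsub>N\<^esub> \<pi> a) ` A"
    unfolding carr carrier_N image_image ..
  show "(?W +>\<^bsub>N\<^esub> \<pi> a) \<oplus>\<^bsub>quotient_module N ?W\<^esub> (?W +>\<^bsub>N\<^esub> \<pi> b) = ?W +>\<^bsub>N\<^esub> \<pi> (a + b)"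
    if "a \<in> A" "b \<in> A" for a b
    using W.a_rcos_sum[of "\<pi> a" "\<pi> b"] that by (simp add: quotient_module_def carrier_N add_N)
  show "r \<odot>\<^bsub>quotient_module N ?W\<^esub> (?W +>\<^bsub>N\<^esub> \<pi> a) = ?W +>\<^bsub>N\<^esub> \<pi> (r * a)" if "r \<in> polys V" "a \<in> A" for r a
    using smult_quotient_module[OF module_N sub, of r "\<pi> a"] that by (simp add: carrier_PR carrier_N smult_N)
  show "?W +>\<^bsub>N\<^esub> \<pi> a = \<zero>\<^bsub>quotient_module N ?W\<^esub> \<longleftrightarrow> a \<in> B" if "a \<in> A" for a
  proof -
    have z: "\<zero>\<^bsub>quotient_module N ?W\<^esub> = ?W" by (simp add: quotient_module_def)
    have c: "\<pi> a \<in> carrier N" using that by (simp add: carrier_N)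
    have "?W +>\<^bsub>N\<^esub> \<pi> a = ?W \<longleftrightarrow> \<pi> a \<in> ?W"
      using W.a_rcos_self[OF c] W.a_rcos_const[of "\<pi> a"] by blast
    then show ?thesis unfolding z using pi_image_mem[OF assms that] by simp
  qed
qed (use assms submod_A A_polys in auto)

lemma nonzerodivisor_iff:
  assumes "f \<in> polys V"
  shows "nonzerodivisor_on N f \<longleftrightarrow> (\<forall>a\<in>A. f * a \<in> U \<longrightarrow> a \<in> U)"
  using assms submod_mult[OF submod_A assms] by (auto simp: nonzerodivisor_on_def carrier_N smult_N zero_N)

lemma annihilator_carrier: "annihilator (PR V) N (carrier N) = {r \<in> polys V. \<forall>a\<in>A. r * a \<in> U}"
  using submod_mult[OF submod_A] by (auto simp: annihilator_def carrier_N smult_N zero_N carrier_PR)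

lemma carrier_eq_zero: "carrier N = {\<zero>\<^bsub>N\<^esub>} \<longleftrightarrow> A \<subseteq> U"
proof -
  have "\<zero>\<^bsub>N\<^esub> = \<pi> 0" "0 \<in> A"
    using submod_zero[OF submod_A] submod_zero[OF submod_U] zero_N[of 0] by auto
  then show ?thesis using zero_N unfolding carrier_N by auto
qed

lemma mult_submodule_eq:
  assumes "set fs \<subseteq> polys V"
  shows "mult_submodule (PR V) N fs = \<pi> ` (U \<boxplus> list_span fs A)"
proof -
  let ?B = "U \<boxplus> list_span fs A"
  have B: "submod (polys V) ?B" "U \<subseteq> ?B" "?B \<subseteq> A"
  proof -
    show "submod (polys V) ?B" by (rule submod_plus[OF submod_U submod_list_span[OF submod_A]])
    show "U \<subseteq> ?B" by (rule plus_set_left[OF submod_list_span[OF submod_A]])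
    show "?B \<subseteq> A"
      using list_span_subset[OF submod_A assms] U_A submod_add[OF submod_A] by (auto simp: plus_set_def)
  qed
  let ?S = "{f \<odot>\<^bsub>N\<^esub> x |f x. f \<in> set fs \<and> x \<in> carrier N}"
  have S: "?S = {\<pi> (f * a) |f a. f \<in> set fs \<and> a \<in> A}"
    using assms by (auto simp: carrier_N) (metis smult_N subsetD image_eqI)+
  have "?S \<subseteq> \<pi> ` ?B"
    unfolding S using list_span_mem[OF submod_A] plus_set_right[OF submod_U] by blast
  then have "mult_submodule (PR V) N fs \<subseteq> \<pi> ` ?B"
    unfolding mult_submodule_def gen_submodule_def using submodule_image[OF B(1,3)] by blast
  moreover have "\<pi> ` ?B \<subseteq> W" if W: "submodule W (PR V) N" "?S \<subseteq> W" for W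
  proof -
    define D where "D = {a \<in> A. \<pi> a \<in> W}"
    note D = submodule_preimage[OF W(1), folded D_def]
    have gen: "f * a \<in> D" if "f \<in> set fs" "a \<in> A" for f a
      using that W(2) assms submod_mult[OF submod_A, of f a] unfolding S D_def by auto
    have "list_span gs A \<subseteq> D" if "set gs \<subseteq> set fs" for gs
      using that
    proof (induction gs)
      case Nil
      then show ?case using submod_zero[OF D(1)] by simp
    next
      case (Cons g gs)
      then show ?case using gen by (auto intro!: submod_add[OF D(1)])
    qed
    from this[OF subset_refl] have "?B \<subseteq> D" using D(2) submod_add[OF D(1)] by (auto simp: plus_set_def)
    then show ?thesis using D(4) by blast
  qed
  then have "\<pi> ` ?B \<subseteq> mult_submodule (PR V) N fs"
    unfolding mult_submodule_def gen_submodule_def by blast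
  ultimately show ?thesis by blast
qed

lemma regular_sequence_iff:
  "regular_sequence (PR V) N fs \<longleftrightarrow> set fs \<subseteq> polys V \<and>
     (\<forall>i<length fs. \<forall>a\<in>A. fs ! i * a \<in> U \<boxplus> list_span (take i fs) A \<longrightarrow> a \<in> U \<boxplus> list_span (take i fs) A) \<and>
     \<not> A \<subseteq> U \<boxplus> list_span fs A"
proof (cases "set fs \<subseteq> polys V")
  case True
  have B: "submod (polys V) (U \<boxplus> list_span gs A)" "U \<subseteq> U \<boxplus> list_span gs A" "U \<boxplus> list_span gs A \<subseteq> A"
    if "set gs \<subseteq> polys V" for gs
  proof -
    show "submod (polys V) (U \<boxplus> list_span gs A)" by (rule submod_plus[OF submod_U submod_list_span[OF submod_A]])
    show "U \<subseteq> U \<boxplus> list_span gs A" by (rule plus_set_left[OF submod_list_span[OF submod_A]])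
    show "U \<boxplus> list_span gs A \<subseteq> A"
      using list_span_subset[OF submod_A that] U_A submod_add[OF submod_A] by (auto simp: plus_set_def)
  qed
  have "nonzerodivisor_on (quotient_module N (mult_submodule (PR V) N (take i fs))) (fs ! i) \<longleftrightarrow>
      (\<forall>a\<in>A. fs ! i * a \<in> U \<boxplus> list_span (take i fs) A \<longrightarrow> a \<in> U \<boxplus> list_span (take i fs) A)" if "i < length fs" for i
  proof -
    have t: "set (take i fs) \<subseteq> polys V" using True set_take_subset[of i fs] by blast
    have "fs ! i \<in> polys V" using True that by auto
    then show ?thesis
      unfolding mult_submodule_eq[OF t]
      by (rule presentation.nonzerodivisor_iff[OF presentation_quotient[OF B[OF t]]])
  qed
  moreover have "mult_submodule (PR V) N fs \<noteq> carrier N \<longleftrightarrow> \<not> A \<subseteq> U \<boxplus> list_span fs A"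
    unfolding mult_submodule_eq[OF True] carrier_N
    using pi_image_mem[OF B[OF True]] B(3)[OF True] by blast
  ultimately show ?thesis using True by (simp add: regular_sequence_def carrier_PR)
qed (simp add: regular_sequence_def carrier_PR)

end

section \<open>Stanley--Reisner rings as quotients of monomial ideals\<close>

lemma presentation_self_module:
  "presentation V (polys V :: (('v \<Rightarrow>\<^sub>0 nat) \<Rightarrow>\<^sub>0 'k::field) set) {0} (self_module (PR V)) id"
proof (rule presentation.intro)
  show "module (PR V :: (('v \<Rightarrow>\<^sub>0 nat) \<Rightarrow>\<^sub>0 'k) ring) (self_module (PR V))"
    by (rule module_self_module[OF cring_polynomial_ring])
qed (auto simp: submod_polys submod_singleton submod_zero[OF submod_polys] self_module_def carrier_PR polynomial_ring_simps(2-))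

lemma list_span_least:
  assumes "submod C I" "set xs \<subseteq> I"
  shows "list_span xs C \<subseteq> I"
  using assms(2)
proof (induction xs)
  case (Cons x xs)
  have "x * a \<in> I" if "a \<in> C" for a
    using submod_mult[OF assms(1) that, of x] Cons.prems by (simp add: mult.commute)
  then show ?case using Cons by (auto intro!: submod_add[OF assms(1)])
qed (simp add: submod_zero[OF assms(1)])

lemma irrelevant_ideal_eq:
  assumes "set vs = V"
  shows "irrelevant_ideal V = list_span (map pvar vs) (polys V)"
proof -
  interpret cring "PR V :: (('a \<Rightarrow>\<^sub>0 nat) \<Rightarrow>\<^sub>0 'b) ring" by (rule cring_polynomial_ring)
  have V: "pvar ` V \<subseteq> (polys V :: (('a \<Rightarrow>\<^sub>0 nat) \<Rightarrow>\<^sub>0 'b) set)"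
    by (auto simp: pvar_def polys_def intro!: monomial_span_single)
  have gen: "ideal (irrelevant_ideal V) (PR V :: (('a \<Rightarrow>\<^sub>0 nat) \<Rightarrow>\<^sub>0 'b) ring)"
    unfolding irrelevant_ideal_def using V by (intro genideal_ideal) (simp add: carrier_PR)
  have "pvar ` V \<subseteq> (irrelevant_ideal V :: (('a \<Rightarrow>\<^sub>0 nat) \<Rightarrow>\<^sub>0 'b) set)"
    unfolding irrelevant_ideal_def using V by (intro genideal_self) (simp add: carrier_PR)
  then have "list_span (map pvar vs) (polys V) \<subseteq> (irrelevant_ideal V :: (('a \<Rightarrow>\<^sub>0 nat) \<Rightarrow>\<^sub>0 'b) set)"
    using gen assms by (intro list_span_least) (auto simp: ideal_iff)
  moreover have "irrelevant_ideal V \<subseteq> (list_span (map pvar vs) (polys V) :: (('a \<Rightarrow>\<^sub>0 nat) \<Rightarrow>\<^sub>0 'b) set)"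
    unfolding irrelevant_ideal_def
  proof (rule genideal_minimal)
    show "ideal (list_span (map pvar vs) (polys V)) (PR V :: (('a \<Rightarrow>\<^sub>0 nat) \<Rightarrow>\<^sub>0 'b) ring)"
      using V assms by (simp add: ideal_iff submod_list_span[OF submod_polys] list_span_subset[OF submod_polys])
    show "pvar ` V \<subseteq> (list_span (map pvar vs) (polys V) :: (('a \<Rightarrow>\<^sub>0 nat) \<Rightarrow>\<^sub>0 'b) set)"
      using list_span_mem[OF submod_polys _ one_polys, of _ "map pvar vs" V] assms by auto
  qed
  ultimately show ?thesis by blast
qed

lemma single_face_nonface_ideal:
  "F \<subseteq> V \<Longrightarrow> finite F \<Longrightarrow> psingle (indic F) 1 \<in> (nonface_ideal V \<Gamma> :: (('v \<Rightarrow>\<^sub>0 nat) \<Rightarrow>\<^sub>0 'k::field) set) \<longleftrightarrow> F \<notin> \<Gamma>"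
  by (auto simp: nonface_ideal_def monomial_span_def supp_indic)

text \<open>A support outside \<open>\<Gamma>\<close> contains a minimal nonface, whose squarefree
  monomial divides the given monomial.\<close>

lemma stanley_reisner_ideal_eq:
  assumes "finite V" "\<Gamma> \<subseteq> Pow V" "down_closed \<Gamma>"
  shows "stanley_reisner_ideal V \<Gamma> = (nonface_ideal V \<Gamma> :: (('v \<Rightarrow>\<^sub>0 nat) \<Rightarrow>\<^sub>0 'k::field) set)"
proof -
  interpret cring "PR V :: (('v \<Rightarrow>\<^sub>0 nat) \<Rightarrow>\<^sub>0 'k) ring" by (rule cring_polynomial_ring)
  let ?G = "(\<lambda>F. \<Prod>x\<in>F. pvar x) ` minimal_nonfaces V \<Gamma> :: (('v \<Rightarrow>\<^sub>0 nat) \<Rightarrow>\<^sub>0 'k) set"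
  have G: "?G = (\<lambda>F. psingle (indic F) 1) ` minimal_nonfaces V \<Gamma>"
    using assms(1) by (intro image_cong refl prod_pvar) (auto simp: minimal_nonfaces_def dest: finite_subset)
  have sub: "?G \<subseteq> nonface_ideal V \<Gamma>"
    unfolding G using assms(1) single_face_nonface_ideal[of _ V \<Gamma>]
    by (auto simp: minimal_nonfaces_def dest: finite_subset)
  then have Gp: "?G \<subseteq> carrier (PR V)" using nonface_ideal_subset_polys by (simp add: carrier_PR) blast
  have I: "submod (polys V) (stanley_reisner_ideal V \<Gamma> :: (('v \<Rightarrow>\<^sub>0 nat) \<Rightarrow>\<^sub>0 'k) set)"
    using genideal_ideal[OF Gp] by (simp add: ideal_iff stanley_reisner_ideal_def)
  show ?thesis
  proof
    show "stanley_reisner_ideal V \<Gamma> \<subseteq> (nonface_ideal V \<Gamma> :: (('v \<Rightarrow>\<^sub>0 nat) \<Rightarrow>\<^sub>0 'k) set)"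
      unfolding stanley_reisner_ideal_def
      by (rule genideal_minimal[OF _ sub]) (simp add: ideal_iff nonface_ideal_subset_polys submod_nonface_ideal[OF assms(3)])
    show "nonface_ideal V \<Gamma> \<subseteq> (stanley_reisner_ideal V \<Gamma> :: (('v \<Rightarrow>\<^sub>0 nat) \<Rightarrow>\<^sub>0 'k) set)"
      unfolding nonface_ideal_def
    proof (rule monomial_span_least)
      fix m :: "'v \<Rightarrow>\<^sub>0 nat" and c :: 'k
      assume m: "m \<in> {m. supp m \<subseteq> V \<and> supp m \<notin> \<Gamma>}"
      have "\<exists>F. F \<subseteq> supp m \<and> F \<in> minimal_nonfaces V \<Gamma>"
      proof -
        let ?P = "\<lambda>F. F \<subseteq> supp m \<and> F \<notin> \<Gamma>"
        obtain F where F: "?P F" "\<And>G. ?P G \<Longrightarrow> card F \<le> card G"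
          using m ex_has_least_nat[of ?P "supp m" card] by blast
        have "G \<in> \<Gamma>" if "G \<subset> F" for G
        proof (rule ccontr)
          assume "G \<notin> \<Gamma>"
          then have "card F \<le> card G" using that F by (intro F(2)) auto
          moreover have "finite F" using F(1) finite_subset[of F "supp m"] by simp
          ultimately show False using psubset_card_mono[OF _ that] by simp
        qed
        then show ?thesis using F(1) m by (auto simp: minimal_nonfaces_def)
      qed
      then obtain F where F: "F \<subseteq> supp m" "F \<in> minimal_nonfaces V \<Gamma>" by blast
      have finF: "finite F" using F(1) finite_subset[of F "supp m"] by simp
      have "m = (m - indic F) + indic F"
        using F(1) by (auto intro!: poly_mapping_eqI simp: lookup_add lookup_minus lookup_indic[OF finF] in_keys_iff subset_iff)
      then have "psingle m c = psingle (m - indic F) c * psingle (indic F) 1"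
        by (simp add: mult_single)
      moreover have "psingle (indic F) 1 \<in> (stanley_reisner_ideal V \<Gamma> :: (('v \<Rightarrow>\<^sub>0 nat) \<Rightarrow>\<^sub>0 'k) set)"
        unfolding stanley_reisner_ideal_def using genideal_self[OF Gp] F(2) G by blast
      moreover have "supp (m - indic F) \<subseteq> supp m" by (auto simp: in_keys_iff lookup_minus)
      then have "psingle (m - indic F) c \<in> polys V" using m by (auto simp: polys_def intro!: monomial_span_single)
      ultimately show "psingle m c \<in> stanley_reisner_ideal V \<Gamma>" using submod_mult[OF I] by simp
    qed (auto intro: submod_zero[OF I] submod_add[OF I])
  qed
qed

lemma presentation_stanley_reisner_ring:
  fixes V :: "'v set"
  assumes "finite V" "\<Gamma> \<subseteq> Pow V" "down_closed \<Gamma>"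
  shows "presentation V (polys V) (nonface_ideal V \<Gamma>) (stanley_reisner_ring V \<Gamma>)
    (\<lambda>a. nonface_ideal V \<Gamma> +>\<^bsub>self_module (PR V)\<^esub> (a :: ('v \<Rightarrow>\<^sub>0 nat) \<Rightarrow>\<^sub>0 'k::field))"
  using presentation.presentation_quotient[OF presentation_self_module submod_nonface_ideal[OF assms(3)], of V]
    submod_zero[OF submod_nonface_ideal[OF assms(3), of V]] nonface_ideal_subset_polys[of V \<Gamma>]
  by (simp add: stanley_reisner_ring_def stanley_reisner_ideal_eq[OF assms])

lemma regseqI:
  assumes "\<forall>i<length fs. \<forall>a\<in>A. fs ! i * a \<in> U \<boxplus> list_span (take i fs) A \<longrightarrow> a \<in> U \<boxplus> list_span (take i fs) A"
  shows "regseq A U fs"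
  using assms
proof (induction fs arbitrary: U)
  case (Cons f fs)
  have "\<forall>a\<in>A. f * a \<in> U \<longrightarrow> a \<in> U" using Cons.prems[rule_format, of 0] by (auto simp: plus_set_zero)
  moreover have "regseq A (U \<boxplus> (*) f ` A) fs"
  proof (rule Cons.IH, intro allI impI)
    fix i assume "i < length fs"
    then show "\<forall>a\<in>A. fs ! i * a \<in> U \<boxplus> (*) f ` A \<boxplus> list_span (take i fs) A \<longrightarrow> a \<in> U \<boxplus> (*) f ` A \<boxplus> list_span (take i fs) A"
      using Cons.prems[rule_format, of "Suc i"] by (simp add: list_span_Cons plus_set_assoc del: list_span.simps)
  qed
  ultimately show ?case by simp
qed simp

lemma list_span_rev: "list_span (rev xs) A = list_span xs A"
proof (induction xs)
  case (Cons x xs)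
  have "list_span (rev (x # xs)) A = list_span xs A \<boxplus> list_span [x] A" by (simp add: list_span_append Cons del: list_span.simps)
  also have "\<dots> = list_span xs A \<boxplus> (*) x ` A" by (simp only: list_span_Cons list_span.simps(1) plus_set_zero)
  also have "\<dots> = list_span (x # xs) A" by (simp only: list_span_Cons plus_set_commute)
  finally show ?case .
qed simp

section \<open>Skeletons and the dimension filtration\<close>

lemma ideal_colon:
  assumes "submod (polys V) A" "submod (polys V) U"
  shows "ideal {r \<in> polys V. \<forall>a\<in>A. r * a \<in> U} (PR V)"
  unfolding ideal_iff
  using submod_zero[OF submod_polys] submod_zero[OF assms(2)] submod_diff[OF submod_polys] submod_diff[OF assms(2)]
    submod_mult[OF submod_polys] submod_mult[OF assms(2)]
  by (auto intro!: submodI simp: left_diff_distrib mult.assoc)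

text \<open>The annihilator contains the nonface ideal of the complex generated by
  \<open>\<Gamma> - \<Gamma>'\<close>. If a term of \<open>r * a\<close> had its support in
  \<open>\<Gamma>\<close>, this support would be in \<open>\<Gamma> - \<Gamma>'\<close>, and the
  factor coming from \<open>r\<close> would be supported on one of its faces.\<close>

lemma krull_dim_colon_le:
  assumes "finite V" "\<Gamma> \<subseteq> Pow V" "down_closed \<Gamma>" "down_closed \<Gamma>'"
    and "\<And>F. F \<in> \<Gamma> - \<Gamma>' \<Longrightarrow> \<exists>G\<in>\<Gamma> - \<Gamma>'. F \<subseteq> G \<and> int (card G) \<le> i"
  shows "krull_dim (PR V Quot {r \<in> polys V. \<forall>a\<in>nonface_ideal V \<Gamma>'. r * a \<in> (nonface_ideal V \<Gamma> :: (('v \<Rightarrow>\<^sub>0 nat) \<Rightarrow>\<^sub>0 'k::field) set)}) \<le> ereal (of_int i)"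
proof (rule krull_dim_le[OF assms(1)])
  let ?I = "{r \<in> polys V. \<forall>a\<in>nonface_ideal V \<Gamma>'. r * a \<in> (nonface_ideal V \<Gamma> :: (('v \<Rightarrow>\<^sub>0 nat) \<Rightarrow>\<^sub>0 'k) set)}"
  let ?D = "{F. \<exists>G\<in>\<Gamma> - \<Gamma>'. F \<subseteq> G}"
  show "ideal ?I (PR V)" by (intro ideal_colon submod_nonface_ideal assms)
  show "?D \<subseteq> Pow V" using assms(2) by auto
  show "int (card F) \<le> i" if F: "F \<in> ?D" for F
  proof -
    obtain G where G: "G \<in> \<Gamma> - \<Gamma>'" "F \<subseteq> G" using F by auto
    from assms(5)[OF G(1)] obtain H where "H \<in> \<Gamma> - \<Gamma>'" "G \<subseteq> H" "int (card H) \<le> i" by (elim bexE conjE)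
    then have H: "H \<in> \<Gamma>" "F \<subseteq> H" "int (card H) \<le> i" using G(2) by auto
    have "finite H" using H(1) assms(1,2) by (auto dest: finite_subset)
    then show ?thesis using card_mono[OF _ H(2)] H(3) by simp
  qed
  show "nonface_ideal V ?D \<subseteq> ?I"
  proof
    fix r :: "('v \<Rightarrow>\<^sub>0 nat) \<Rightarrow>\<^sub>0 'k" assume r: "r \<in> nonface_ideal V ?D"
    have "r * a \<in> nonface_ideal V \<Gamma>" if "a \<in> nonface_ideal V \<Gamma>'" for a
      using r that unfolding nonface_ideal_def
    proof (rule monomial_span_mult)
      fix m m' :: "'v \<Rightarrow>\<^sub>0 nat"
      assume m: "m \<in> {m. supp m \<subseteq> V \<and> supp m \<notin> ?D}" "m' \<in> {m. supp m \<subseteq> V \<and> supp m \<notin> \<Gamma>'}"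
      have "supp (m + m') \<notin> \<Gamma>'"
        using m down_closedD[OF assms(4), of "supp (m + m')" "supp m'"] by (auto simp: keys_add_nat)
      then have "supp (m + m') \<notin> \<Gamma>" using m by (auto simp: keys_add_nat)
      then show "m + m' \<in> {m. supp m \<subseteq> V \<and> supp m \<notin> \<Gamma>}" using m by (auto simp: keys_add_nat)
    qed
    then show "r \<in> ?I" using r nonface_ideal_subset_polys by blast
  qed
qed

text \<open>If \<open>r\<close> annihilates, then \<open>r * p\<close> lies in the prime of
  \<open>F\<close> and \<open>p\<close> does not, so \<open>r\<close> does: the annihilator is
  contained in the prime of \<open>F\<close>.\<close>

lemma krull_dim_colon_ge:
  fixes A :: "(('v \<Rightarrow>\<^sub>0 nat) \<Rightarrow>\<^sub>0 'k::field) set"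
  assumes "finite V" "down_closed \<Gamma>" "F \<in> \<Gamma>" "F \<subseteq> V"
    and "submod (polys V) A" "p \<in> A" "p \<in> polys V" "p \<notin> nonface_ideal V (Pow F)"
  shows "ereal (real (card F)) \<le> krull_dim (PR V Quot {r \<in> polys V. \<forall>a\<in>A. r * a \<in> nonface_ideal V \<Gamma>})"
proof (rule krull_dim_ge[OF assms(1,4)])
  show "ideal {r \<in> polys V. \<forall>a\<in>A. r * a \<in> nonface_ideal V \<Gamma>} (PR V)"
    by (intro ideal_colon assms submod_nonface_ideal)
  have "Pow F \<subseteq> \<Gamma>" using down_closedD[OF assms(2,3)] by auto
  then have sub: "nonface_ideal V \<Gamma> \<subseteq> nonface_ideal V (Pow F)" by (rule nonface_ideal_antimono)
  show "{r \<in> polys V. \<forall>a\<in>A. r * a \<in> nonface_ideal V \<Gamma>} \<subseteq> nonface_ideal V (Pow F)"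
  proof
    fix r assume "r \<in> {r \<in> polys V. \<forall>a\<in>A. r * a \<in> nonface_ideal V \<Gamma>}"
    then have "r \<in> polys V" "r * p \<in> nonface_ideal V (Pow F)" using sub assms(6) by auto
    then show "r \<in> nonface_ideal V (Pow F)"
      using prime_set_face[OF assms(1,4)] assms(7,8) unfolding prime_set_def by blast
  qed
qed

text \<open>\<open>koszul_exact_imp_regular\<close> reads its list from the right; reversed, the
  list is e_1, ..., e_k in the usual order of a regular sequence.\<close>

lemma regular_esyms:
  fixes A U :: "(('v \<Rightarrow>\<^sub>0 nat) \<Rightarrow>\<^sub>0 'k::field) set"
  assumes "finite V" "submod (polys V) A" "submod (polys V) U" "ptrunc.graded A" "ptrunc.graded U"
    and "\<And>j. j < int k \<Longrightarrow> koszul_exact (esyms V k) A U j"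
    and "i < k" "a \<in> A" "rev (esyms V k) ! i * a \<in> U \<boxplus> list_span (take i (rev (esyms V k))) A"
  shows "a \<in> U \<boxplus> list_span (take i (rev (esyms V k))) A"
proof -
  let ?es = "esyms V k :: (('v \<Rightarrow>\<^sub>0 nat) \<Rightarrow>\<^sub>0 'k) list"
  obtain ds where ds: "list_all2 ptrunc.homog ds ?es" using homog_esyms[OF assms(1)] by blast
  have "rev ?es = take i (rev ?es) @ rev ?es ! i # drop (Suc i) (rev ?es)"
    using assms(7) by (intro id_take_nth_drop) simp
  from arg_cong[OF this, of rev]
  have split: "?es = rev (drop (Suc i) (rev ?es)) @ rev ?es ! i # rev (take i (rev ?es))"
    by (simp del: rev_take rev_drop)
  have "a \<in> U \<boxplus> list_span (rev (take i (rev ?es))) A"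
    using assms(6,9)
    by (intro ptrunc.koszul_exact_imp_regular[OF assms(2-5) set_esyms_polys[OF assms(1)] ds _ split assms(8)])
      (simp_all add: list_span_rev del: rev_take rev_drop)
  then show ?thesis by (simp add: list_span_rev del: rev_take rev_drop)
qed

lemma esyms_proper:
  fixes A U :: "(('v \<Rightarrow>\<^sub>0 nat) \<Rightarrow>\<^sub>0 'k::field) set"
  assumes "finite V" "submod (polys V) A" "submod (polys V) U" "ptrunc.graded A" "ptrunc.graded U"
    and "A \<subseteq> U \<boxplus> list_span (esyms V k) A"
  shows "A \<subseteq> U"
  using ptrunc.nakayama[OF assms(5,4,2,3) set_esyms_polys[OF assms(1)]] homog_esyms[OF assms(1)] assms(6)
  by metis

text \<open>Unless the module is zero, \<open>i\<close> is its dimension and no regular sequence is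
  longer. So Cohen--Macaulay means depth at least \<open>i\<close>, and then e_1, ..., e_i is a
  regular sequence of that length.\<close>

theorem cohen_macaulay_iff_depth_ge:
  fixes N :: "(('v \<Rightarrow>\<^sub>0 nat) \<Rightarrow>\<^sub>0 'k::field, 'b, 'm) module_scheme"
  assumes "presentation V (nonface_ideal V \<Gamma>') (nonface_ideal V \<Gamma>) N \<pi>"
    and "finite V" "\<Gamma> \<subseteq> Pow V" "down_closed \<Gamma>" "down_closed \<Gamma>'" "\<Gamma>' \<subseteq> \<Gamma>"
    and le: "\<And>F. F \<in> \<Gamma> - \<Gamma>' \<Longrightarrow> int (card F) \<le> i"
    and attained: "\<Gamma> \<noteq> \<Gamma>' \<Longrightarrow> \<exists>F\<in>\<Gamma> - \<Gamma>'. int (card F) = i"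
  shows "cohen_macaulay (PR V) (irrelevant_ideal V) N \<longleftrightarrow>
    depth_ge V i (nonface_ideal V \<Gamma>' :: (('v \<Rightarrow>\<^sub>0 nat) \<Rightarrow>\<^sub>0 'k) set) (nonface_ideal V \<Gamma>)"
proof -
  interpret presentation V "nonface_ideal V \<Gamma>'" "nonface_ideal V \<Gamma>" N \<pi> by fact
  show ?thesis
  proof (cases "\<Gamma> = \<Gamma>'")
    case True
    then have "depth_ge V i (nonface_ideal V \<Gamma>' :: (('v \<Rightarrow>\<^sub>0 nat) \<Rightarrow>\<^sub>0 'k) set) (nonface_ideal V \<Gamma>)"
      using koszul_exact_trivial[OF submod_A order_refl] by (simp add: depth_ge_def)
    moreover have "carrier N = {\<zero>\<^bsub>N\<^esub>}" using True by (simp add: carrier_eq_zero)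
    ultimately show ?thesis by (simp add: cohen_macaulay_def)
  next
    case False
    let ?A = "nonface_ideal V \<Gamma>' :: (('v \<Rightarrow>\<^sub>0 nat) \<Rightarrow>\<^sub>0 'k) set"
    let ?U = "nonface_ideal V \<Gamma> :: (('v \<Rightarrow>\<^sub>0 nat) \<Rightarrow>\<^sub>0 'k) set"
    obtain F where F: "F \<in> \<Gamma>" "F \<notin> \<Gamma>'" "int (card F) = i" using attained[OF False] by auto
    define k where "k = card F"
    have ik: "i = int k" using F by (simp add: k_def)
    have FV: "F \<subseteq> V" "finite F" using F(1) assms(2,3) by (auto dest: finite_subset)
    have kV: "k \<le> card V" using card_mono[OF assms(2) FV(1)] by (simp add: k_def)
    \<comment> \<open>The squarefree monomial of a largest face \<open>F\<close> shows both that the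
      module is nonzero and, lying outside the prime of \<open>F\<close>, that the dimension is at
      least \<open>card F\<close>.\<close>
    let ?x = "psingle (indic F) 1 :: ('v \<Rightarrow>\<^sub>0 nat) \<Rightarrow>\<^sub>0 'k"
    have x: "?x \<in> ?A" "?x \<notin> ?U" "?x \<notin> nonface_ideal V (Pow F)"
      using single_face_nonface_ideal[OF FV, where ?'k = 'k] F by simp_all
    have nz: "\<not> ?A \<subseteq> ?U" using x by blast
    have gr: "ptrunc.graded ?A" "ptrunc.graded ?U" by (simp_all add: nonface_ideal_def graded_monomial_span)
    have dim: "module_dim (PR V) N = ereal (real k)"
    proof (rule antisym)
      have "module_dim (PR V) N \<le> ereal (of_int i)"
        unfolding module_dim_def annihilator_carrier
        using le by (intro krull_dim_colon_le assms) auto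
      then show "module_dim (PR V) N \<le> ereal (real k)" by (simp add: ik)
      show "ereal (real k) \<le> module_dim (PR V) N"
        unfolding module_dim_def annihilator_carrier k_def
        using x A_polys by (intro krull_dim_colon_ge[where p = ?x] assms F FV submod_A) auto
    qed
    obtain vs where vs: "set vs = V" using finite_list[OF assms(2)] by blast
    note irr = irrelevant_ideal_eq[OF vs, where ?'b = 'k]
    have koszul_exact_es: "koszul_exact (esyms V k) ?A ?U j" if "depth_ge V d ?A ?U" "j < d" for d j
      by (rule depth_ge_esyms[OF assms(2) submod_A submod_U kV _ that])
        (rule esym_annihilates[OF assms(2,5)], use le ik in auto)
    have depth: "depth_ge V (int (length fs)) ?A ?U"
      if "set fs \<subseteq> irrelevant_ideal V" "regular_sequence (PR V) N fs" for fs
      using that unfolding regular_sequence_iff irr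
      by (intro regseq_depth_ge[OF assms(2) submod_A submod_U vs] regseqI) auto
    \<comment> \<open>A longer sequence would make the top cohomology of e_1, ..., e_k vanish, hence
      A = U + (e_1, ..., e_k) A, against the Nakayama lemma.\<close>
    have bound: "length fs \<le> k"
      if "set fs \<subseteq> irrelevant_ideal V" "regular_sequence (PR V) N fs" for fs
    proof (rule ccontr)
      assume "\<not> length fs \<le> k"
      then have "koszul_exact (esyms V k) ?A ?U (int k)" using koszul_exact_es[OF depth[OF that]] by simp
      then have "?A \<subseteq> ?U \<boxplus> list_span (esyms V k) ?A"
        using koszul_exact_top[OF submod_A submod_U, of "esyms V k"] by auto
      then show False using esyms_proper[OF assms(2) submod_A submod_U gr] nz by blast
    qed
    have "module_depth (PR V) (irrelevant_ideal V) N = ereal (real k) \<longleftrightarrow> depth_ge V (int k) ?A ?U"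
    proof
      assume eq: "module_depth (PR V) (irrelevant_ideal V) N = ereal (real k)"
      show "depth_ge V (int k) ?A ?U"
      proof (rule ccontr)
        assume no: "\<not> depth_ge V (int k) ?A ?U"
        \<comment> \<open>The depth is a supremum of extended reals. Lengths below \<open>k\<close>
          are at most \<open>k - 1\<close>, and this gap keeps the supremum away from
          \<open>k\<close>.\<close>
        have "module_depth (PR V) (irrelevant_ideal V) N \<le> ereal (real k - 1)"
          unfolding module_depth_def
        proof (rule Sup_least)
          fix y assume "y \<in> {ereal (real (length fs)) |fs. set fs \<subseteq> irrelevant_ideal V \<and> regular_sequence (PR V) N fs}"
          then obtain fs where fs: "y = ereal (real (length fs))" "set fs \<subseteq> irrelevant_ideal V"
            "regular_sequence (PR V) N fs" by auto
          have "length fs < k"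
            using depth_ge_mono[OF depth[OF fs(2,3)], of "int k"] no by linarith
          then show "y \<le> ereal (real k - 1)" using fs(1) by simp
        qed
        then show False using eq by simp
      qed
    next
      assume d: "depth_ge V (int k) ?A ?U"
      let ?fs = "rev (esyms V k) :: (('v \<Rightarrow>\<^sub>0 nat) \<Rightarrow>\<^sub>0 'k) list"
      have set: "set ?fs \<subseteq> irrelevant_ideal V"
      proof
        fix y assume "y \<in> set ?fs"
        then obtain j where j: "y = esym V j" "1 \<le> j" by (auto simp: set_esyms)
        have I: "submod (polys V) (irrelevant_ideal V :: (('v \<Rightarrow>\<^sub>0 nat) \<Rightarrow>\<^sub>0 'k) set)"
          unfolding irr by (rule submod_list_span[OF submod_polys])
        have "psingle (indic Y) 1 \<in> (irrelevant_ideal V :: (('v \<Rightarrow>\<^sub>0 nat) \<Rightarrow>\<^sub>0 'k) set)"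
          if Y: "Y \<subseteq> V" "card Y = j" for Y
        proof -
          have "finite Y" "Y \<noteq> {}" using Y j(2) assms(2) by (auto dest: finite_subset)
          then obtain v where v: "v \<in> Y" by auto
          have "psingle (indic Y) (1 :: 'k) = (\<Prod>x\<in>Y. pvar x)" using \<open>finite Y\<close> by (simp add: prod_pvar)
          also have "\<dots> = pvar v * (\<Prod>x\<in>Y - {v}. pvar x)" using \<open>finite Y\<close> v by (rule prod.remove)
          also have "\<dots> = pvar v * psingle (indic (Y - {v})) 1" using \<open>finite Y\<close> by (simp add: prod_pvar)
          finally have eq: "psingle (indic Y) (1 :: 'k) = pvar v * psingle (indic (Y - {v})) 1" .
          have "psingle (indic (Y - {v})) (1 :: 'k) \<in> polys V"
            using Y(1) \<open>finite Y\<close> by (auto simp: polys_def supp_indic intro!: monomial_span_single)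
          then show ?thesis
            unfolding eq irr using v Y(1) vs by (intro list_span_mem[OF submod_polys]) auto
        qed
        then show "y \<in> irrelevant_ideal V"
          unfolding j(1) esym_def by (intro submod_sum[OF I]) auto
      qed
      have "regular_sequence (PR V) N ?fs"
        unfolding regular_sequence_iff
      proof (intro conjI allI impI ballI)
        show "set ?fs \<subseteq> polys V" using set_esyms_polys[OF assms(2)] by simp
        show "\<not> ?A \<subseteq> ?U \<boxplus> list_span ?fs ?A"
          using esyms_proper[OF assms(2) submod_A submod_U gr] nz by (auto simp: list_span_rev)
        fix j a assume j: "j < length ?fs" "a \<in> ?A" "?fs ! j * a \<in> ?U \<boxplus> list_span (take j ?fs) ?A"
        have "j < k" using j(1) by simp
        then show "a \<in> ?U \<boxplus> list_span (take j ?fs) ?A"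
          using regular_esyms[OF assms(2) submod_A submod_U gr, of k j a] koszul_exact_es[OF d] j(2,3) by blast
      qed
      then have "ereal (real k) \<le> module_depth (PR V) (irrelevant_ideal V) N"
        unfolding module_depth_def using set by (intro Sup_upper CollectI exI[of _ ?fs]) simp
      moreover have "module_depth (PR V) (irrelevant_ideal V) N \<le> ereal (real k)"
        unfolding module_depth_def using bound by (intro Sup_least) auto
      ultimately show "module_depth (PR V) (irrelevant_ideal V) N = ereal (real k)" by (rule antisym[rotated])
    qed
    moreover have "carrier N \<noteq> {\<zero>\<^bsub>N\<^esub>}" using nz by (simp add: carrier_eq_zero)
    ultimately show ?thesis by (simp add: cohen_macaulay_def dim ik)
  qed
qed

section \<open>Faces with many vertices, pure skeletons and the filtration\<close>

definition large_part :: "'v set set \<Rightarrow> int \<Rightarrow> 'v set set" where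
  "large_part \<Delta> i = {G. \<exists>F\<in>\<Delta>. G \<subseteq> F \<and> i \<le> int (card F)}"

lemma down_closed_large_part: "down_closed (large_part \<Delta> i)"
  by (auto simp: down_closed_def large_part_def)

lemma large_part_subset: "down_closed \<Delta> \<Longrightarrow> large_part \<Delta> i \<subseteq> \<Delta>"
  by (auto simp: large_part_def dest: down_closedD)

lemma large_part_antimono: "i \<le> j \<Longrightarrow> large_part \<Delta> j \<subseteq> large_part \<Delta> i"
  unfolding large_part_def by (intro Collect_mono impI) (meson order_trans)

text \<open>The prime of a face \<open>F\<close> has dimension \<open>card F\<close>, one more than
  \<open>face_dim F\<close>. Dimension at most \<open>i\<close> therefore excludes the faces with at
  least \<open>i + 1\<close> vertices.\<close>

lemma dim_filtration_eq:
  fixes N :: "(('v \<Rightarrow>\<^sub>0 nat) \<Rightarrow>\<^sub>0 'k::field, 'b, 'm) module_scheme"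
  assumes "presentation V (polys V) (nonface_ideal V \<Delta>) N \<pi>"
    and "finite V" "\<Delta> \<subseteq> Pow V" "down_closed \<Delta>"
  shows "dim_filtration (PR V) N i = \<pi> ` nonface_ideal V (large_part \<Delta> (i + 1))"
  unfolding dim_filtration_def
proof (rule Greatest_equality)
  interpret presentation V "polys V" "nonface_ideal V \<Delta>" N \<pi> by fact
  \<comment> \<open>Here and below \<open>?kwords\<close> stands for a family of faces; it is
    unrelated to the constant \<open>kwords\<close>.\<close>
  let ?kwords = "large_part \<Delta> (i + 1)"
  have B: "submod (polys V) (nonface_ideal V ?kwords)" "nonface_ideal V \<Delta> \<subseteq> nonface_ideal V ?kwords" "nonface_ideal V ?kwords \<subseteq> polys V"
    by (simp_all add: submod_nonface_ideal down_closed_large_part nonface_ideal_antimono large_part_subset assms nonface_ideal_subset_polys)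
  interpret B: presentation V "nonface_ideal V ?kwords" "nonface_ideal V \<Delta>" "N\<lparr>carrier := \<pi> ` nonface_ideal V ?kwords\<rparr>" \<pi>
    by (rule presentation_submodule[OF B])
  have "module_dim (PR V) (N\<lparr>carrier := \<pi> ` nonface_ideal V ?kwords\<rparr>) \<le> ereal (of_int i)"
    unfolding module_dim_def B.annihilator_carrier
  proof (rule krull_dim_colon_le[OF assms(2,3,4) down_closed_large_part])
    fix F assume F: "F \<in> \<Delta> - ?kwords"
    then have "\<not> i + 1 \<le> int (card F)" by (auto simp: large_part_def)
    then show "\<exists>G\<in>\<Delta> - ?kwords. F \<subseteq> G \<and> int (card G) \<le> i" using F by (intro bexI[of _ F]) auto
  qed
  then show "submodule (\<pi> ` nonface_ideal V ?kwords) (PR V) N \<and>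
      module_dim (PR V) (N\<lparr>carrier := \<pi> ` nonface_ideal V ?kwords\<rparr>) \<le> ereal (of_int i)"
    using submodule_image[OF B(1,3)] by simp
next
  interpret presentation V "polys V" "nonface_ideal V \<Delta>" N \<pi> by fact
  fix W assume W: "submodule W (PR V) N \<and> module_dim (PR V) (N\<lparr>carrier := W\<rparr>) \<le> ereal (of_int i)"
  define B where "B = {a \<in> polys V. \<pi> a \<in> W}"
  note B = submodule_preimage[of W, folded B_def]
  have sub: "submodule W (PR V) N" using W by simp
  have WB: "W = \<pi> ` B" by (rule B(4)[OF sub])
  interpret B: presentation V B "nonface_ideal V \<Delta>" "N\<lparr>carrier := \<pi> ` B\<rparr>" \<pi>
    by (rule presentation_submodule[OF B(1-3)[OF sub]])
  have dim: "krull_dim (PR V Quot {r \<in> polys V. \<forall>a\<in>B. r * a \<in> nonface_ideal V \<Delta>}) \<le> ereal (of_int i)"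
    using W B.annihilator_carrier unfolding module_dim_def WB by simp
  have "B \<subseteq> nonface_ideal V (large_part \<Delta> (i + 1))"
  proof
    fix p assume p: "p \<in> B"
    then have pV: "p \<in> polys V" using B(3)[OF sub] by blast
    show "p \<in> nonface_ideal V (large_part \<Delta> (i + 1))"
    proof (rule ccontr)
      assume "p \<notin> nonface_ideal V (large_part \<Delta> (i + 1))"
      then obtain m where m: "m \<in> supp p" "supp m \<in> large_part \<Delta> (i + 1)"
        using pV by (auto simp: nonface_ideal_def polys_def monomial_span_def)
      then obtain F where F: "F \<in> \<Delta>" "supp m \<subseteq> F" "i + 1 \<le> int (card F)"
        by (auto simp: large_part_def)
      \<comment> \<open>An element of \<open>W\<close> outside the prime of a face with more than
        \<open>i\<close> vertices forces the dimension of \<open>W\<close> above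
        \<open>i\<close>.\<close>
      have "p \<notin> nonface_ideal V (Pow F)" using m(1) F(2) by (auto simp: nonface_ideal_def monomial_span_def)
      then have "ereal (real (card F)) \<le> krull_dim (PR V Quot {r \<in> polys V. \<forall>a\<in>B. r * a \<in> nonface_ideal V \<Delta>})"
        using F(1) assms(3) by (intro krull_dim_colon_ge[OF assms(2,4) F(1) _ B(1)[OF sub] p pV]) auto
      then have "ereal (real (card F)) \<le> ereal (of_int i)" using dim by (rule order_trans)
      then have "real (card F) \<le> of_int i" by simp
      then show False using F(3) by linarith
    qed
  qed
  then show "W \<le> \<pi> ` nonface_ideal V (large_part \<Delta> (i + 1))" unfolding WB by blast
qed

text \<open>Here \<open>i\<close> counts vertices, hence the shift. A set with at most
  \<open>i\<close> vertices inside a face with at least \<open>i\<close> lies in an intermediate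
  face with exactly \<open>i\<close>.\<close>

lemma pure_skeleton_eq:
  assumes "finite V" "\<Delta> \<subseteq> Pow V" "down_closed \<Delta>"
  shows "pure_skeleton (i - 1) \<Delta> = {G \<in> large_part \<Delta> i. int (card G) \<le> i}"
proof
  show "pure_skeleton (i - 1) \<Delta> \<subseteq> {G \<in> large_part \<Delta> i. int (card G) \<le> i}"
  proof
    fix G assume "G \<in> pure_skeleton (i - 1) \<Delta>"
    then obtain F where F: "F \<in> \<Delta>" "int (card F) = i" "G \<subseteq> F" by (auto simp: pure_skeleton_def face_dim_def)
    moreover have "finite F" using F(1) assms by (auto dest: finite_subset)
    then have "card G \<le> card F" using F(3) by (rule card_mono)
    ultimately show "G \<in> {G \<in> large_part \<Delta> i. int (card G) \<le> i}" by (auto simp: large_part_def)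
  qed
  show "{G \<in> large_part \<Delta> i. int (card G) \<le> i} \<subseteq> pure_skeleton (i - 1) \<Delta>"
  proof
    fix G assume "G \<in> {G \<in> large_part \<Delta> i. int (card G) \<le> i}"
    then obtain F where F: "F \<in> \<Delta>" "G \<subseteq> F" "i \<le> int (card F)" "int (card G) \<le> i" by (auto simp: large_part_def)
    have "finite F" using F(1) assms by (auto dest: finite_subset)
    moreover have "card G \<le> nat i" "nat i \<le> card F" using F by linarith+
    ultimately obtain H where "G \<subseteq> H" "H \<subseteq> F" "card H = nat i"
      using exists_subset_between[of G "nat i" F] F(2) by blast
    moreover have "H \<in> \<Delta>" using down_closedD[OF assms(3) F(1) \<open>H \<subseteq> F\<close>] .
    moreover have "0 \<le> i" using F(4) by linarith
    ultimately show "G \<in> pure_skeleton (i - 1) \<Delta>"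
      by (auto simp: pure_skeleton_def face_dim_def intro!: bexI[of _ H])
  qed
qed

lemma down_closed_bounded:
  assumes "down_closed \<Gamma>" "\<Gamma> \<subseteq> Pow V" "finite V"
  shows "down_closed {G \<in> \<Gamma>. int (card G) \<le> i}"
  unfolding down_closed_def
proof (intro ballI allI impI)
  fix F G assume F: "F \<in> {G \<in> \<Gamma>. int (card G) \<le> i}" "G \<subseteq> F"
  then have "finite F" using assms(2,3) by (auto dest: finite_subset)
  then have "card G \<le> card F" using F(2) by (rule card_mono)
  then show "G \<in> {G \<in> \<Gamma>. int (card G) \<le> i}" using F down_closedD[OF assms(1)] by auto
qed

lemma depth_skeleton_step:
  fixes V :: "'v set" and \<Delta> :: "'v set set"
  defines "I \<equiv> \<lambda>i. nonface_ideal V (pure_skeleton (i - 1) \<Delta>) :: (('v \<Rightarrow>\<^sub>0 nat) \<Rightarrow>\<^sub>0 'k::field) set"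
  assumes "finite V" "\<Delta> \<subseteq> Pow V" "down_closed \<Delta>"
    and "depth_ge V (i + 1) (polys V) (I (i + 1))"
  shows "depth_ge V i (polys V) (I i) \<longleftrightarrow>
    depth_ge V i (nonface_ideal V (large_part \<Delta> (i + 1))) (nonface_ideal V (large_part \<Delta> i) :: (('v \<Rightarrow>\<^sub>0 nat) \<Rightarrow>\<^sub>0 'k) set)"
proof -
  let ?kwords = "large_part \<Delta>"
  define S where "S = {G \<in> ?kwords i. int (card G) \<le> i}"
  define T where "T = {G \<in> ?kwords (i + 1). int (card G) \<le> i}"
  define S1 where "S1 = {G \<in> ?kwords (i + 1). int (card G) \<le> i + 1}"
  have LV: "?kwords j \<subseteq> Pow V" for j using large_part_subset[OF assms(4)] assms(3) by blast
  have dc: "down_closed S" "down_closed T" "down_closed S1"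
    unfolding S_def T_def S1_def by (rule down_closed_bounded[OF down_closed_large_part LV assms(2)])+
  have I: "I i = nonface_ideal V S" "I (i + 1) = nonface_ideal V S1"
    unfolding I_def pure_skeleton_eq[OF assms(2-4)] S_def S1_def by simp_all
  have kwords: "?kwords (i + 1) \<subseteq> ?kwords i" by (rule large_part_antimono) simp
  note id = submod_nonface_ideal[OF dc(1), of V] submod_nonface_ideal[OF dc(2), of V] submod_nonface_ideal[OF dc(3), of V]
  have TS1: "T \<subseteq> S1" and TS: "T \<subseteq> S" using kwords by (auto simp: T_def S1_def S_def)
  have "depth_ge V (i + 1) (nonface_ideal V T) (nonface_ideal V S1 :: (('v \<Rightarrow>\<^sub>0 nat) \<Rightarrow>\<^sub>0 'k) set)"
  \<comment> \<open>\<open>faces_depth\<close> counts vertices by a natural number; for a negative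
    bound all degrees concerned are negative.\<close>
  proof (cases "i + 1 < 0")
    case True
    then show ?thesis by (auto simp: depth_ge_def intro: koszul_exact_neg)
  next
    case False
    have "depth_ge V (int (nat (i + 1))) (nonface_ideal V T) (nonface_ideal V S1 :: (('v \<Rightarrow>\<^sub>0 nat) \<Rightarrow>\<^sub>0 'k) set)"
      using LV TS1 by (intro faces_depth[OF assms(2) _ dc(3,2)]) (auto simp: S1_def T_def)
    then show ?thesis using False by simp
  qed
  then have T: "depth_ge V i (polys V) (nonface_ideal V T :: (('v \<Rightarrow>\<^sub>0 nat) \<Rightarrow>\<^sub>0 'k) set)"
    using depth_ge_mono[OF assms(5), of i] unfolding I
    by (intro depth_ge_extension(3)[OF assms(2) submod_polys id(2,3)] nonface_ideal_subset_polys nonface_ideal_antimono TS1) auto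
  \<comment> \<open>The left-term form of the depth lemma uses \<open>T\<close> one degree lower,
    the middle-term form uses it in the same degree; both are supplied by \<open>T\<close>.\<close>
  have ext: "depth_ge V i (polys V) (nonface_ideal V S :: (('v \<Rightarrow>\<^sub>0 nat) \<Rightarrow>\<^sub>0 'k) set) \<longleftrightarrow>
      depth_ge V i (nonface_ideal V T) (nonface_ideal V S :: (('v \<Rightarrow>\<^sub>0 nat) \<Rightarrow>\<^sub>0 'k) set)"
    using depth_ge_extension(1,2)[OF assms(2) submod_polys id(2,1) nonface_ideal_subset_polys nonface_ideal_antimono[OF TS]]
      T depth_ge_mono[OF T, of "i - 1"] by auto
  \<comment> \<open>\<open>T\<close> is the intersection and \<open>large_part \<Delta> i\<close>
    the union of \<open>large_part \<Delta> (i + 1)\<close> and \<open>S\<close>. On ideals these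
    become a sum and an intersection, as the second isomorphism theorem requires.\<close>
  have sum: "nonface_ideal V T = nonface_ideal V (?kwords (i + 1)) \<boxplus> (nonface_ideal V S :: (('v \<Rightarrow>\<^sub>0 nat) \<Rightarrow>\<^sub>0 'k) set)"
    unfolding nonface_ideal_def monomial_span_plus by (rule arg_cong[of _ _ monomial_span]) (use kwords in \<open>auto simp: T_def S_def\<close>)
  have below: "G \<in> ?kwords (i + 1)" if G: "G \<in> ?kwords i" "\<not> int (card G) \<le> i" for G
  proof -
    obtain F where F: "F \<in> \<Delta>" "G \<subseteq> F" using G(1) by (auto simp: large_part_def)
    then have "finite F" using assms(2,3) by (auto dest: finite_subset)
    then have "card G \<le> card F" using F(2) by (rule card_mono)
    then show ?thesis using F G by (auto simp: large_part_def intro!: bexI[of _ F])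
  qed
  have inter: "nonface_ideal V (?kwords i) = nonface_ideal V (?kwords (i + 1)) \<inter> (nonface_ideal V S :: (('v \<Rightarrow>\<^sub>0 nat) \<Rightarrow>\<^sub>0 'k) set)"
    unfolding nonface_ideal_def monomial_span_Int by (rule arg_cong[of _ _ monomial_span]) (use kwords below in \<open>auto simp: S_def\<close>)
  have "depth_ge V i (nonface_ideal V T) (nonface_ideal V S :: (('v \<Rightarrow>\<^sub>0 nat) \<Rightarrow>\<^sub>0 'k) set) \<longleftrightarrow>
      depth_ge V i (nonface_ideal V (?kwords (i + 1))) (nonface_ideal V (?kwords i) :: (('v \<Rightarrow>\<^sub>0 nat) \<Rightarrow>\<^sub>0 'k) set)"
    unfolding depth_ge_def
    using koszul_exact_second_iso[OF submod_nonface_ideal[OF down_closed_large_part] id(1) set_esyms_polys[OF assms(2)] sum inter]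
    by simp
  then show ?thesis using ext by (simp add: I)
qed

theorem theorem1p7:
  fixes V :: "'v set" and \<Delta> :: "'v set set"
  assumes "simplicial_complex V \<Delta>"
  shows "sequentially_cohen_macaulay_complex TYPE('k::field) V \<Delta> \<longleftrightarrow>
    (\<forall>i::int. complex_indim TYPE('k) V \<Delta> \<le> ereal (of_int i) \<and> i \<le> complex_dim \<Delta> \<longrightarrow>
       cohen_macaulay_complex TYPE('k) V (pure_skeleton i \<Delta>))"
proof -
  let ?R = "PR V :: (('v \<Rightarrow>\<^sub>0 nat) \<Rightarrow>\<^sub>0 'k) ring"
  let ?N = "stanley_reisner_ring V \<Delta> :: (('v \<Rightarrow>\<^sub>0 nat) \<Rightarrow>\<^sub>0 'k, (('v \<Rightarrow>\<^sub>0 nat) \<Rightarrow>\<^sub>0 'k) set) module"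
  let ?f = "nonface_ideal V :: 'v set set \<Rightarrow> (('v \<Rightarrow>\<^sub>0 nat) \<Rightarrow>\<^sub>0 'k) set"
  let ?S = "\<lambda>i. pure_skeleton (i - 1) \<Delta>" and ?kwords = "large_part \<Delta>"
  define \<pi> where "\<pi> = (\<lambda>a :: ('v \<Rightarrow>\<^sub>0 nat) \<Rightarrow>\<^sub>0 'k. ?f \<Delta> +>\<^bsub>self_module (PR V)\<^esub> a)"
  have V: "finite V" "\<Delta> \<subseteq> Pow V" "{} \<in> \<Delta>" and dc: "down_closed \<Delta>"
    using assms by (auto simp: simplicial_complex_def down_closed_def)
  have fin: "finite \<Delta>" using V by (meson finite_Pow_iff finite_subset)
  have face: "finite F" if "F \<in> \<Delta>" for F using that V by (auto dest: finite_subset)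
  interpret N: presentation V "polys V" "?f \<Delta>" ?N \<pi>
    unfolding \<pi>_def by (rule presentation_stanley_reisner_ring[OF V(1,2) dc])
  have filt: "dim_filtration ?R ?N i = \<pi> ` ?f (?kwords (i + 1))" for i
    by (rule dim_filtration_eq[OF N.presentation_axioms V(1,2) dc])
  have LV: "?kwords j \<subseteq> Pow V" for j using large_part_subset[OF dc] V(2) by blast
  have CM_quot: "cohen_macaulay ?R (irrelevant_ideal V)
      (quotient_module (?N\<lparr>carrier := dim_filtration ?R ?N i\<rparr>) (dim_filtration ?R ?N (i - 1))) \<longleftrightarrow>
      depth_ge V i (?f (?kwords (i + 1))) (?f (?kwords i))" for i
  proof -
    have sub: "?f \<Delta> \<subseteq> ?f (?kwords j)" for j by (rule nonface_ideal_antimono[OF large_part_subset[OF dc]])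
    have kwords: "?kwords (i + 1) \<subseteq> ?kwords i" by (rule large_part_antimono) simp
    note id = submod_nonface_ideal[OF down_closed_large_part[of \<Delta>], of V]
    have "presentation V (?f (?kwords (i + 1))) (?f (?kwords i))
       (quotient_module (?N\<lparr>carrier := \<pi> ` ?f (?kwords (i + 1))\<rparr>) (\<pi> ` ?f (?kwords i)))
       (\<lambda>a. \<pi> ` ?f (?kwords i) +>\<^bsub>?N\<lparr>carrier := \<pi> ` ?f (?kwords (i + 1))\<rparr>\<^esub> \<pi> a)"
      by (rule presentation.presentation_quotient[OF N.presentation_submodule[OF id sub nonface_ideal_subset_polys]
            id nonface_ideal_antimono[OF large_part_subset[OF dc]] nonface_ideal_antimono[OF kwords]])
    then show ?thesis
      unfolding filt diff_add_cancel
    proof (rule cohen_macaulay_iff_depth_ge[OF _ V(1) LV down_closed_large_part down_closed_large_part kwords])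
      have le: "int (card F) \<le> i" if "F \<in> \<Delta>" "F \<notin> ?kwords (i + 1)" for F
        using that by (force simp: large_part_def)
      show "int (card F) \<le> i" if "F \<in> ?kwords i - ?kwords (i + 1)" for F
        using le[of F] that large_part_subset[OF dc] by blast
      \<comment> \<open>A face over \<open>G\<close> with at least \<open>i\<close> vertices cannot
        have more, since \<open>G\<close> is not in the next family; it has exactly
        \<open>i\<close>.\<close>
      show "\<exists>F\<in>?kwords i - ?kwords (i + 1). int (card F) = i" if ne: "?kwords i \<noteq> ?kwords (i + 1)"
      proof -
        obtain G where G: "G \<in> ?kwords i" "G \<notin> ?kwords (i + 1)" using ne kwords by blast
        then obtain F where F: "F \<in> \<Delta>" "G \<subseteq> F" "i \<le> int (card F)" by (auto simp: large_part_def)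
        have "F \<notin> ?kwords (i + 1)" using G(2) F(2) down_closedD[OF down_closed_large_part, of F \<Delta> "i + 1" G] by blast
        moreover have "F \<in> ?kwords i" using F by (auto simp: large_part_def)
        ultimately show ?thesis using le[OF F(1)] F(3) by (intro bexI[of _ F]) auto
      qed
    qed
  qed
  have CM_skel: "cohen_macaulay_complex TYPE('k) V (?S i) \<longleftrightarrow> depth_ge V i (polys V) (?f (?S i))" for i
  proof -
    have S: "?S i \<subseteq> Pow V" "down_closed (?S i)"
      unfolding pure_skeleton_eq[OF V(1,2) dc]
      using LV[of i] down_closed_bounded[OF down_closed_large_part LV V(1)] by auto
    \<comment> \<open>A Stanley--Reisner ring is the case where the numerator is
      \<open>nonface_ideal V {}\<close>, the whole ring.\<close>
    have "presentation V (?f {}) (?f (?S i)) (stanley_reisner_ring V (?S i))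
       (\<lambda>a. ?f (?S i) +>\<^bsub>self_module (PR V)\<^esub> a)"
      unfolding nonface_ideal_empty by (rule presentation_stanley_reisner_ring[OF V(1) S])
    then have "cohen_macaulay ?R (irrelevant_ideal V) (stanley_reisner_ring V (?S i)) \<longleftrightarrow>
        depth_ge V i (?f {}) (?f (?S i))"
    proof (rule cohen_macaulay_iff_depth_ge[OF _ V(1) S])
      show "int (card F) \<le> i" if "F \<in> ?S i - {}" for F
        using that unfolding pure_skeleton_eq[OF V(1,2) dc] by simp
      show "\<exists>F\<in>?S i - {}. int (card F) = i" if "?S i \<noteq> {}"
        using that by (auto simp: pure_skeleton_def face_dim_def)
    qed (auto simp: down_closed_def)
    then show ?thesis by (simp add: cohen_macaulay_complex_def nonface_ideal_empty)
  qed
  \<comment> \<open>\<open>d\<close> is the dimension of the ring, the largest number of vertices of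
    a face.\<close>
  define d where "d = complex_dim \<Delta> + 1"
  have d_ge: "int (card F) \<le> d" if "F \<in> \<Delta>" for F
  proof -
    have "face_dim F \<le> complex_dim \<Delta>"
      unfolding complex_dim_def using fin that by (intro Max_ge) auto
    then show ?thesis by (simp add: d_def face_dim_def)
  qed
  obtain M where M: "M \<in> \<Delta>" "int (card M) = d"
  proof -
    have "complex_dim \<Delta> \<in> face_dim ` \<Delta>"
      unfolding complex_dim_def using fin V(3) by (intro Max_in) auto
    then show ?thesis using that by (auto simp: d_def face_dim_def)
  qed
  have dim: "module_dim ?R ?N = ereal (of_int d)"
  proof (rule antisym)
    have "krull_dim (?R Quot {r \<in> polys V. \<forall>a\<in>?f {}. r * a \<in> ?f \<Delta>}) \<le> ereal (of_int d)"
      using d_ge by (intro krull_dim_colon_le[OF V(1,2) dc]) (auto simp: down_closed_def)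
    then show "module_dim ?R ?N \<le> ereal (of_int d)"
      by (simp add: module_dim_def N.annihilator_carrier nonface_ideal_empty)
    have "1 \<notin> ?f (Pow M)" by (auto simp: nonface_ideal_def monomial_span_def)
    then have "ereal (real (card M)) \<le> module_dim ?R ?N"
      unfolding module_dim_def N.annihilator_carrier
      using M(1) V(2) by (intro krull_dim_colon_ge[OF V(1) dc M(1) _ submod_polys one_polys one_polys]) auto
    moreover have "real (card M) = of_int d" using M(2) by (metis of_int_of_nat_eq)
    ultimately show "ereal (of_int d) \<le> module_dim ?R ?N" by simp
  qed
  \<comment> \<open>The equivalence is stated for all indices from \<open>i\<close> to
    \<open>d\<close> together, because the step at \<open>i - 1\<close> needs the skeleton at
    \<open>i\<close> to have full depth. At \<open>d + 1\<close> the range is empty.\<close>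
  have induct: "(\<forall>j. i \<le> j \<and> j \<le> d \<longrightarrow> depth_ge V j (?f (?kwords (j + 1))) (?f (?kwords j))) \<longleftrightarrow>
      (\<forall>j. i \<le> j \<and> j \<le> d \<longrightarrow> depth_ge V j (polys V) (?f (?S j)))" if "i \<le> d + 1" for i
    using that
  proof (induction i rule: int_le_induct)
    case (step i)
    let ?l = "\<lambda>j. depth_ge V j (?f (?kwords (j + 1))) (?f (?kwords j))" and ?r = "\<lambda>j. depth_ge V j (polys V) (?f (?S j))"
    have split: "(\<forall>j. i - 1 \<le> j \<and> j \<le> d \<longrightarrow> P j) \<longleftrightarrow> P (i - 1) \<and> (\<forall>j. i \<le> j \<and> j \<le> d \<longrightarrow> P j)"
      for P :: "int \<Rightarrow> bool"
    proof -
      have "i - 1 \<le> j \<longleftrightarrow> j = i - 1 \<or> i \<le> j" for j :: int by auto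
      moreover have "i - 1 \<le> d" using step.hyps by simp
      ultimately show ?thesis by metis
    qed
    have "?r (i - 1) \<longleftrightarrow> ?l (i - 1)" if r: "\<forall>j. i \<le> j \<and> j \<le> d \<longrightarrow> ?r j"
    proof (rule depth_skeleton_step[OF V(1,2) dc])
      show "depth_ge V (i - 1 + 1) (polys V) (?f (pure_skeleton (i - 1 + 1 - 1) \<Delta>))"
      proof (cases "i \<le> d")
        case True
        then show ?thesis using r by simp
      next
        case False
        \<comment> \<open>Above the dimension the skeleton is the empty family, without even the
          empty face; its ring is zero and has every depth.\<close>
        then have "pure_skeleton (i - 1) \<Delta> = {}"
          using d_ge by (force simp: pure_skeleton_def face_dim_def)
        then show ?thesis by (simp add: depth_ge_def nonface_ideal_empty koszul_exact_trivial[OF submod_polys])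
      qed
    qed
    then show ?case using step.IH unfolding split by blast
  qed auto
  let ?b = "module_indim ?R ?N"
  \<comment> \<open>The shift by one passes from dimensions of faces to numbers of vertices; the
    case distinction covers infinite values.\<close>
  have indim: "complex_indim TYPE('k) V \<Delta> \<le> ereal (of_int i) \<longleftrightarrow> ?b \<le> ereal (of_int (i + 1))" for i
    unfolding complex_indim_def by (cases ?b) (auto simp: one_ereal_def)
  \<comment> \<open>The lower bound selects an upward closed set of indices, so each selected
    \<open>i\<close> brings the whole range from \<open>i\<close> to \<open>d\<close> along, as
    \<open>induct\<close> requires.\<close>
  have up: "?b \<le> ereal (of_int j)" if "?b \<le> ereal (of_int i)" "i \<le> j" for i j
    using that by (meson ereal_less_eq(3) of_int_le_iff order_trans)
  have "(\<forall>i. ?b \<le> ereal (of_int i) \<and> i \<le> d \<longrightarrow> depth_ge V i (?f (?kwords (i + 1))) (?f (?kwords i))) \<longleftrightarrow>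
      (\<forall>i. ?b \<le> ereal (of_int i) \<and> i \<le> d \<longrightarrow> depth_ge V i (polys V) (?f (?S i)))"
    using up induct by (smt (verit, best))
  moreover have "sequentially_cohen_macaulay_complex TYPE('k) V \<Delta> \<longleftrightarrow>
      (\<forall>i. ?b \<le> ereal (of_int i) \<and> i \<le> d \<longrightarrow> depth_ge V i (?f (?kwords (i + 1))) (?f (?kwords i)))"
    by (simp add: sequentially_cohen_macaulay_complex_def sequentially_cohen_macaulay_def CM_quot dim)
  moreover have "(\<forall>i. complex_indim TYPE('k) V \<Delta> \<le> ereal (of_int i) \<and> i \<le> complex_dim \<Delta> \<longrightarrow>
       cohen_macaulay_complex TYPE('k) V (pure_skeleton i \<Delta>)) \<longleftrightarrow>
      (\<forall>i. ?b \<le> ereal (of_int i) \<and> i \<le> d \<longrightarrow> depth_ge V i (polys V) (?f (?S i)))" (is "?l \<longleftrightarrow> ?r")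
  proof
    assume l: ?l
    show ?r
    proof (intro allI impI)
      fix i assume "?b \<le> ereal (of_int i) \<and> i \<le> d"
      then show "depth_ge V i (polys V) (?f (?S i))"
        using l[rule_format, of "i - 1"] CM_skel[of i] indim[of "i - 1"] by (simp add: d_def)
    qed
  next
    assume r: ?r
    show ?l
    proof (intro allI impI)
      fix i assume "complex_indim TYPE('k) V \<Delta> \<le> ereal (of_int i) \<and> i \<le> complex_dim \<Delta>"
      then show "cohen_macaulay_complex TYPE('k) V (pure_skeleton i \<Delta>)"
        using r[rule_format, of "i + 1"] CM_skel[of "i + 1"] indim[of i] by (simp add: d_def)
    qed
  qed
  ultimately show ?thesis by simp
qed

end
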